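(* Let $d\ge 1$ and fix $1<b_1<b_2<\infty$ and $c_1,\varepsilon>0$. Then there exist a sequence of positive integers $n_k\to\infty$ ($k\ge 0$) and sets $\widetilde{\mathcal{E}}_k\subset\mathbb{R}^d$ ($k\ge 0$), depending on these parameters, such that $\mathcal{L}^d(\widetilde{\mathcal{E}}_k)=0$ and the following holds for every integer $k\ge 0$. For every $\boldsymbol{\theta}=(\theta_1,\ldots,\theta_d)\in\mathbb{R}^d\setminus\widetilde{\mathcal{E}}_k$ satisfying $$b_1\le\min_j|\theta_j^{n_k}|<\max_j|\theta_j^{n_k}|\le b_2\quad\text{and}\quad|\theta_i^{n_k}-\theta_j^{n_k}|\ge c_1\ \text{ for all } i\ne j,$$ for every finite digit set $\mathcal{D}=\{a_1,\ldots,a_m\}\subset\mathbb{R}^d$ ($m\ge 2$) such that the iterated function system $\{x\mapsto Ax+a_j\}_{j=1}^m$ with $A=\mathrm{Diag}[\theta_1^{-1},\ldots,\theta_d^{-1}]$ is affinely irreducible, and for every probability vector $\boldsymbol{p}=(p_1,\ldots,p_m)$ with $\min_j p_j\ge\varepsilon$, the measure $\mu(\boldsymbol{\theta},\mathcal{D},\boldsymbol{p})$ is absolutely continuous with respect to $\mathcal{L}^d$, with a Radon–Nikodym derivative in $C^k(\mathbb{R}^d)$.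
   Context: $\mathcal{L}^d$ is Lebesgue measure on $\mathbb{R}^d$. For $\boldsymbol{\theta}=(\theta_1,\ldots,\theta_d)$ with real entries $|\theta_j|>1$, put $A=\mathrm{Diag}[\theta_1^{-1},\ldots,\theta_d^{-1}]$. For a digit set $\mathcal{D}=\{a_1,\ldots,a_m\}\subset\mathbb{R}^d$, $m\ge2$, and a probability vector $\boldsymbol{p}=(p_1,\ldots,p_m)$, the self-affine measure $\mu=\mu(\boldsymbol{\theta},\mathcal{D},\boldsymbol{p})$ is the unique Borel probability measure on $\mathbb{R}^d$ satisfying $\mu=\sum_{j=1}^m p_j\,(\mu\circ f_j^{-1})$, where $f_j(x)=Ax+a_j$. The iterated function system $\{f_j\}_{j=1}^m$ is affinely irreducible if its attractor $K_{A,\mathcal{D}}=\{\sum_{n=0}^\infty A^n b_n:\ b_n\in\mathcal{D}\}$ is not contained in a proper affine subspace of $\mathbb{R}^d$. *)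

theory Defs
  imports "HOL-Probability.Probability"
begin

definition contraction_matrix :: "real ^ 'd \<Rightarrow> real ^ 'd ^ 'd" where
  "contraction_matrix \<theta> = (\<chi> i j. if i = j then inverse (\<theta> $ i) else 0)"

text \<open>
  A digit set with \<open>m\<close> elements is given by an enumeration \<open>a 1, \<dots>, a m\<close>; the weight
  \<open>p j\<close> belongs to the digit \<open>a j\<close>. Values of \<open>a\<close> and \<open>p\<close> outside \<open>{1..m}\<close> are irrelevant.
\<close>

definition ifs_map :: "real ^ 'd \<Rightarrow> (nat \<Rightarrow> real ^ 'd) \<Rightarrow> nat \<Rightarrow> real ^ 'd \<Rightarrow> real ^ 'd" where
  "ifs_map \<theta> a j x = contraction_matrix \<theta> *v x + a j"

definition is_self_affine_measure ::
  "real ^ 'd \<Rightarrow> nat \<Rightarrow> (nat \<Rightarrow> real ^ 'd) \<Rightarrow> (nat \<Rightarrow> real) \<Rightarrow> (real ^ 'd) measure \<Rightarrow> bool" where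
  "is_self_affine_measure \<theta> m a p \<mu> \<longleftrightarrow>
     prob_space \<mu> \<and> sets \<mu> = sets borel \<and>
     (\<forall>B\<in>sets borel. emeasure \<mu> B =
        (\<Sum>j=1..m. ennreal (p j) * emeasure (distr \<mu> borel (ifs_map \<theta> a j)) B))"

text \<open>
  The description below is proper when all \<open>\<bar>\<theta> $ i\<bar> > 1\<close> and \<open>p\<close> is a probability
  vector on \<open>{1..m}\<close>: the self-affine measure then exists and is unique (Hutchinson).
\<close>

definition self_affine_measure ::
  "real ^ 'd \<Rightarrow> nat \<Rightarrow> (nat \<Rightarrow> real ^ 'd) \<Rightarrow> (nat \<Rightarrow> real) \<Rightarrow> (real ^ 'd) measure" where
  "self_affine_measure \<theta> m a p = (THE \<mu>. is_self_affine_measure \<theta> m a p \<mu>)"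

definition attractor :: "real ^ 'd \<Rightarrow> (real ^ 'd) set \<Rightarrow> (real ^ 'd) set" where
  "attractor \<theta> D =
     {x. \<exists>b :: nat \<Rightarrow> real ^ 'd. (\<forall>n. b n \<in> D) \<and>
           (\<lambda>n. (((*v) (contraction_matrix \<theta>)) ^^ n) (b n)) sums x}"

definition affinely_irreducible :: "real ^ 'd \<Rightarrow> (real ^ 'd) set \<Rightarrow> bool" where
  "affinely_irreducible \<theta> D \<longleftrightarrow> \<not> (\<exists>S. affine S \<and> S \<noteq> UNIV \<and> attractor \<theta> D \<subseteq> S)"

definition prob_vector :: "nat \<Rightarrow> (nat \<Rightarrow> real) \<Rightarrow> bool" where
  "prob_vector m p \<longleftrightarrow> (\<forall>j\<in>{1..m}. 0 \<le> p j) \<and> (\<Sum>j=1..m. p j) = 1"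

text \<open>
  \<open>C\<^sup>k(\<real>\<^sup>d)\<close>: all partial derivatives of order at most \<open>k\<close> exist everywhere and are
  continuous. In the successor case \<open>g i\<close> is the partial derivative in the \<open>i\<close>-th coordinate.
\<close>

primrec C_k :: "nat \<Rightarrow> (real ^ 'd \<Rightarrow> real) \<Rightarrow> bool" where
  "C_k 0 f \<longleftrightarrow> continuous_on UNIV f"
| "C_k (Suc k) f \<longleftrightarrow> continuous_on UNIV f \<and>
     (\<exists>g. \<forall>i. (\<forall>x. ((\<lambda>t. f (x + t *\<^sub>R axis i 1)) has_real_derivative g i x) (at 0))
            \<and> C_k k (g i))"

text \<open>
  A Radon--Nikodym derivative is determined only up to null sets, so the claim is that some
  version of it is \<open>C\<^sup>k\<close>.
\<close>

definition abs_cont_with_C_k_density :: "nat \<Rightarrow> (real ^ 'd) measure \<Rightarrow> bool" where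
  "abs_cont_with_C_k_density k \<mu> \<longleftrightarrow>
     absolutely_continuous lborel \<mu> \<and>
     (\<exists>g. C_k k g \<and> (\<forall>x. 0 \<le> g x) \<and> \<mu> = density lborel (\<lambda>x. ennreal (g x)))"

end

theory Submission
  imports Defs "HOL-Computational_Algebra.Polynomial"
begin

text \<open>
  The Fourier transform of the self-affine measure is the infinite product of the values
  \<open>\<phi> (A\<^sup>n \<xi>)\<close>, where \<open>\<phi> \<xi> = (\<Sum>j. p j * exp (- \<i> (a j \<bullet> \<xi>)))\<close>. Put \<open>\<tau> = \<theta>\<^sup>q\<close>
  (coordinatewise) and sort the factors by \<open>n mod q\<close>: the product becomes \<open>q\<close> products along the
  powers of \<open>A\<^sup>q\<close>. If each of them is \<open>O(\<bar>\<xi>\<bar> powr - \<alpha>)\<close> with an \<open>\<alpha> > 0\<close> that depends only on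
  \<open>b1\<close>, \<open>b2\<close>, \<open>\<epsilon>\<close> and the dimension \<open>d\<close>, the whole product is \<open>O(\<bar>\<xi>\<bar> powr - (q \<alpha>))\<close>. So it suffices
  to choose \<open>q = n k\<close> with \<open>q \<alpha> \<ge> k + 2 d\<close>: then \<open>\<bar>\<xi>\<bar>\<^sup>k\<close> times the transform is integrable, and
  Fourier inversion gives a density of class \<open>C\<^sup>k\<close> (\<open>fourier_decay_imp_C_k_density\<close>).

  The uniform exponent comes from the Erdos--Kahane argument. Let \<open>v\<close> be a difference of two digits.
  A factor \<open>\<phi> \<eta>\<close> is bounded by some \<open>\<beta> < 1\<close> unless \<open>v \<bullet> \<eta>\<close> is close to \<open>2 \<pi> \<int>\<close>. Along the powers of
  \<open>A\<^sup>q\<close>, read backwards from the last one at which \<open>\<xi>\<close> is still large, these phases are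
  \<open>y n = (\<Sum>s. w s * \<tau> s ^ n)\<close> with bounded weights and one weight \<open>w i\<close> bounded away from zero.
  So it is enough that, for all large \<open>N\<close>, more than a proportion \<open>\<kappa>\<close> of \<open>y 0, \<dots>, y (N - 1)\<close> stays
  away from \<open>2 \<pi> \<int>\<close>; the parameters for which this fails form the exceptional set.

  Fix all coordinates of \<open>\<theta>\<close> except \<open>\<theta> i\<close>. The polynomial \<open>\<Prod>s \<noteq> i. (X - \<tau> s)\<close> in the shift operator
  annihilates all exponentials but the \<open>i\<close>-th, and turns \<open>y\<close> into a geometric sequence with ratio
  \<open>\<tau> i\<close>. Hence the integers nearest to \<open>y n / (2 \<pi>)\<close> nearly satisfy a recurrence: each one is
  determined by its predecessors when the rounding errors nearby are small, and has boundedly many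
  candidates otherwise. If only \<open>\<kappa> N\<close> errors are large, there are few such integer sequences, and
  each confines \<open>\<tau> i\<close> to an interval of length \<open>O(b1\<^sup>-\<^sup>N)\<close> (\<open>Erdos_Kahane\<close>). Borel--Cantelli on the
  line and Fubini's theorem show that the exceptional set is null (\<open>exceptional_null\<close>).

  The exceptional set depends on the weights \<open>w\<close> only through a bound \<open>M\<close>, over which a countable
  union is taken; therefore one null set serves all digit sets and all probability vectors.
  Affine irreducibility supplies, for every coordinate \<open>i\<close>, a digit difference \<open>v\<close> with \<open>v i \<noteq> 0\<close>.
\<close>

section \<open>Fourier inversion and smooth densities\<close>

lemma
  fixes f :: "'a::euclidean_space \<Rightarrow> real \<Rightarrow> 'b::{real_normed_field,banach,second_countable_topology}"
  assumes "\<And>b. b \<in> Basis \<Longrightarrow> integrable lborel (f b)"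
  shows integrable_lborel_prod: "integrable lborel (\<lambda>x::'a. \<Prod>b\<in>Basis. f b (x \<bullet> b))"
    and integral_lborel_prod: "(\<integral>x. (\<Prod>b\<in>Basis. f b (x \<bullet> b)) \<partial>(lborel :: 'a measure)) = (\<Prod>b\<in>Basis. \<integral>t. f b t \<partial>lborel)"
proof -
  interpret product_sigma_finite "\<lambda>_::'a. lborel :: real measure" ..
  have [measurable]: "b \<in> Basis \<Longrightarrow> f b \<in> borel_measurable borel" for b
    using borel_measurable_integrable[OF assms, of b] by simp
  show "integrable lborel (\<lambda>x::'a. \<Prod>b\<in>Basis. f b (x \<bullet> b))"
    using product_integrable_prod[OF finite_Basis assms]
    by (subst lborel_eq) (simp add: integrable_distr_eq cong: prod.cong)
  show "(\<integral>x. (\<Prod>b\<in>Basis. f b (x \<bullet> b)) \<partial>(lborel :: 'a measure)) = (\<Prod>b\<in>Basis. \<integral>t. f b t \<partial>lborel)"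
    using product_integral_prod[OF finite_Basis assms]
    by (subst lborel_eq) (simp add: integral_distr cong: prod.cong)
qed

lemma
  fixes \<sigma> t :: real
  assumes "0 < \<sigma>"
  shows integrable_gaussian_char: "integrable lborel (\<lambda>x. iexp (t * x) * complex_of_real (exp (- (\<sigma> * x)\<^sup>2 / 2)))"
    and integral_gaussian_char: "(\<integral>x. iexp (t * x) * complex_of_real (exp (- (\<sigma> * x)\<^sup>2 / 2)) \<partial>lborel)
      = complex_of_real (2 * pi * normal_density 0 \<sigma> t)"
proof -
  let ?F = "\<lambda>x. std_normal_density x *\<^sub>R iexp (t / \<sigma> * x)"
  have int: "integrable lborel ?F"
    by (rule Bochner_Integration.integrable_bound[OF integrable_normal_density[of 1 0]]) auto
  have "(\<integral>x. ?F x \<partial>lborel) = char std_normal_distribution (t / \<sigma>)"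
    unfolding char_def by (subst integral_density) auto
  then have val: "(\<integral>x. ?F x \<partial>lborel) = complex_of_real (exp (- (t / \<sigma>)\<^sup>2 / 2))"
    by (simp add: char_std_normal_distribution)
  have F: "?F (0 + \<sigma> * x) = complex_of_real (1 / sqrt (2 * pi)) * (iexp (t * x) * complex_of_real (exp (- (\<sigma> * x)\<^sup>2 / 2)))" for x
    using assms by (simp add: std_normal_density_def scaleR_conv_of_real mult_ac)
  have "integrable lborel (\<lambda>x. ?F (0 + \<sigma> * x))"
    using assms by (intro lborel_integrable_real_affine int) auto
  then have "integrable lborel (\<lambda>x. complex_of_real (sqrt (2 * pi)) * ?F (0 + \<sigma> * x))"
    by (rule integrable_mult_right)
  moreover have "complex_of_real (sqrt (2 * pi)) * ?F (0 + \<sigma> * x) =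
      iexp (t * x) * complex_of_real (exp (- (\<sigma> * x)\<^sup>2 / 2))" for x
    unfolding F by (simp flip: mult.assoc of_real_mult)
  ultimately show "integrable lborel (\<lambda>x. iexp (t * x) * complex_of_real (exp (- (\<sigma> * x)\<^sup>2 / 2)))"
    by simp
  have "complex_of_real (exp (- (t / \<sigma>)\<^sup>2 / 2)) = \<bar>\<sigma>\<bar> *\<^sub>R (\<integral>x. ?F (0 + \<sigma> * x) \<partial>lborel)"
    unfolding val[symmetric] using assms by (intro lborel_integral_real_affine) auto
  also have "\<dots> = complex_of_real (\<sigma> / sqrt (2 * pi)) *
      (\<integral>x. iexp (t * x) * complex_of_real (exp (- (\<sigma> * x)\<^sup>2 / 2)) \<partial>lborel)"
    unfolding F using assms by (simp add: scaleR_conv_of_real)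
  finally have "(\<integral>x. iexp (t * x) * complex_of_real (exp (- (\<sigma> * x)\<^sup>2 / 2)) \<partial>lborel)
      = complex_of_real (sqrt (2 * pi) / \<sigma> * exp (- (t / \<sigma>)\<^sup>2 / 2))"
    using assms by (simp add: field_simps)
  also have "sqrt (2 * pi) / \<sigma> * exp (- (t / \<sigma>)\<^sup>2 / 2) = 2 * pi * normal_density 0 \<sigma> t"
    using assms by (simp add: normal_density_def real_sqrt_mult power_divide field_simps)
  finally show "(\<integral>x. iexp (t * x) * complex_of_real (exp (- (\<sigma> * x)\<^sup>2 / 2)) \<partial>lborel)
      = complex_of_real (2 * pi * normal_density 0 \<sigma> t)" .
qed

definition gaussian :: "real \<Rightarrow> 'a::euclidean_space \<Rightarrow> real" where
  "gaussian \<sigma> x = (\<Prod>b\<in>Basis. normal_density 0 \<sigma> (x \<bullet> b))"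

lemma gaussian_nonneg: "0 \<le> gaussian \<sigma> x"
  by (simp add: gaussian_def prod_nonneg)

lemma gaussian_measurable [measurable]: "gaussian \<sigma> \<in> borel_measurable borel"
  unfolding gaussian_def by measurable

lemma
  assumes "0 < \<sigma>"
  shows integrable_gaussian: "integrable lborel (gaussian \<sigma> :: 'a::euclidean_space \<Rightarrow> real)"
    and integral_gaussian: "(\<integral>x. gaussian \<sigma> (x::'a) \<partial>lborel) = 1"
  using integrable_lborel_prod[of "\<lambda>_::'a. normal_density 0 \<sigma>"] integral_lborel_prod[of "\<lambda>_::'a. normal_density 0 \<sigma>"] assms
  unfolding gaussian_def by auto

lemma
  fixes x :: "'a::euclidean_space"
  assumes "0 < \<sigma>"
  shows integrable_gaussian_char_euclidean:
      "integrable lborel (\<lambda>\<xi>. iexp (x \<bullet> \<xi>) * complex_of_real (exp (- (\<sigma> * norm \<xi>)\<^sup>2 / 2)))"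
    and integral_gaussian_char_euclidean:
      "(\<integral>\<xi>. iexp (x \<bullet> \<xi>) * complex_of_real (exp (- (\<sigma> * norm \<xi>)\<^sup>2 / 2)) \<partial>lborel)
       = complex_of_real ((2 * pi) ^ DIM('a) * gaussian \<sigma> x)"
proof -
  have eq: "iexp (x \<bullet> \<xi>) * complex_of_real (exp (- (\<sigma> * norm \<xi>)\<^sup>2 / 2))
      = (\<Prod>b\<in>Basis. iexp ((x \<bullet> b) * (\<xi> \<bullet> b)) * complex_of_real (exp (- (\<sigma> * (\<xi> \<bullet> b))\<^sup>2 / 2)))" for \<xi>
  proof -
    have "iexp (x \<bullet> \<xi>) = (\<Prod>b\<in>Basis. iexp ((x \<bullet> b) * (\<xi> \<bullet> b)))"
      by (subst euclidean_inner) (simp add: exp_sum sum_distrib_left)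
    moreover have "exp (- (\<sigma> * norm \<xi>)\<^sup>2 / 2) = (\<Prod>b\<in>Basis. exp (- (\<sigma> * (\<xi> \<bullet> b))\<^sup>2 / 2))"
    proof -
      have "(\<sigma> * norm \<xi>)\<^sup>2 = (\<Sum>b\<in>Basis. (\<sigma> * (\<xi> \<bullet> b))\<^sup>2)"
        by (simp add: power_mult_distrib power2_norm_eq_inner euclidean_inner[of \<xi> \<xi>] sum_distrib_left
            flip: power2_eq_square)
      then show ?thesis by (simp add: sum_divide_distrib sum_negf flip: exp_sum)
    qed
    ultimately show ?thesis by (simp add: prod.distrib)
  qed
  note int = integrable_gaussian_char[OF assms, of "x \<bullet> b" for b]
  show "integrable lborel (\<lambda>\<xi>. iexp (x \<bullet> \<xi>) * complex_of_real (exp (- (\<sigma> * norm \<xi>)\<^sup>2 / 2)))"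
    unfolding eq by (rule integrable_lborel_prod[OF int])
  show "(\<integral>\<xi>. iexp (x \<bullet> \<xi>) * complex_of_real (exp (- (\<sigma> * norm \<xi>)\<^sup>2 / 2)) \<partial>lborel)
       = complex_of_real ((2 * pi) ^ DIM('a) * gaussian \<sigma> x)"
    unfolding eq integral_lborel_prod[OF int] integral_gaussian_char[OF assms]
    by (simp add: gaussian_def prod.distrib)
qed

text \<open>
  The substitution \<open>x = y + \<sigma> u\<close> moves the scale \<open>\<sigma>\<close> from the kernel into the argument of \<open>f\<close>, where
  continuity and dominated convergence apply.
\<close>

lemma gaussian_approximate_identity:
  fixes f :: "'a::euclidean_space \<Rightarrow> real"
  assumes f: "continuous_on UNIV f" "\<And>x. \<bar>f x\<bar> \<le> 1"
  shows "(\<lambda>n. \<integral>x. f x * gaussian (1 / real (Suc n)) (x - y) \<partial>lborel) \<longlonglongrightarrow> f y"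
proof -
  have [measurable]: "f \<in> borel_measurable borel" using f(1) by (rule borel_measurable_continuous_onI)
  have scale: "(\<integral>x. f x * gaussian \<sigma> (x - y) \<partial>lborel) = (\<integral>u. f (y + \<sigma> *\<^sub>R u) * gaussian 1 u \<partial>lborel)"
    if "0 < \<sigma>" for \<sigma>
  proof -
    have "normal_density 0 \<sigma> (\<sigma> * t) = normal_density 0 1 t / \<sigma>" for t
      using that by (simp add: normal_density_def power_mult_distrib real_sqrt_mult)
    then have g: "\<sigma> ^ DIM('a) * gaussian \<sigma> (\<sigma> *\<^sub>R u) = gaussian 1 u" for u :: 'a
      using that by (simp add: gaussian_def prod_dividef)
    have "(\<integral>x. f x * gaussian \<sigma> (x - y) \<partial>lborel) = (\<integral>u. \<sigma> ^ DIM('a) * (f (y + \<sigma> *\<^sub>R u) * gaussian \<sigma> (\<sigma> *\<^sub>R u)) \<partial>lborel)"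
      using that by (subst lborel_affine[of \<sigma> y]) (simp_all add: integral_density integral_distr)
    also have "\<dots> = (\<integral>u. f (y + \<sigma> *\<^sub>R u) * gaussian 1 u \<partial>lborel)"
      unfolding g[symmetric] by (simp add: mult_ac)
    finally show ?thesis .
  qed
  have "(\<lambda>n. \<integral>u. f (y + (1 / real (Suc n)) *\<^sub>R u) * gaussian 1 u \<partial>lborel) \<longlonglongrightarrow> (\<integral>u. f y * gaussian 1 (u::'a) \<partial>lborel)"
  proof (rule integral_dominated_convergence[where w = "gaussian 1"])
    show "integrable lborel (gaussian 1 :: 'a \<Rightarrow> real)" by (simp add: integrable_gaussian)
    show "AE u in lborel. norm (f (y + (1 / real (Suc n)) *\<^sub>R u) * gaussian 1 u) \<le> gaussian 1 u" for n
      using f(2) by (intro AE_I2) (simp add: abs_mult gaussian_nonneg mult_left_le_one_le)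
    show "AE u in lborel. (\<lambda>n. f (y + (1 / real (Suc n)) *\<^sub>R u) * gaussian 1 u) \<longlonglongrightarrow> f y * gaussian 1 u"
    proof (rule AE_I2)
      fix u :: 'a
      have "(\<lambda>n. y + (1 / real (Suc n)) *\<^sub>R u) \<longlonglongrightarrow> y + 0 *\<^sub>R u"
        using LIMSEQ_inverse_real_of_nat by (intro tendsto_intros) (simp add: inverse_eq_divide)
      then have "(\<lambda>n. f (y + (1 / real (Suc n)) *\<^sub>R u)) \<longlonglongrightarrow> f y"
        by (intro continuous_on_tendsto_compose[OF f(1)]) auto
      then show "(\<lambda>n. f (y + (1 / real (Suc n)) *\<^sub>R u) * gaussian 1 u) \<longlonglongrightarrow> f y * gaussian 1 u"
        by (rule tendsto_mult_right)
    qed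
  qed (auto intro: borel_measurable_continuous_onI)
  then show ?thesis by (simp add: scale integral_gaussian)
qed

definition fourier_transform :: "'a::euclidean_space measure \<Rightarrow> 'a \<Rightarrow> complex" where
  "fourier_transform \<mu> \<xi> = (\<integral>x. iexp (- (x \<bullet> \<xi>)) \<partial>\<mu>)"

definition fourier_inverse :: "('a::euclidean_space \<Rightarrow> complex) \<Rightarrow> 'a \<Rightarrow> real" where
  "fourier_inverse h x = Re (\<integral>\<xi>. iexp (x \<bullet> \<xi>) * h \<xi> \<partial>lborel) / (2 * pi) ^ DIM('a)"

lemma fourier_transform_measurable [measurable]:
  assumes "prob_space \<mu>" and [measurable_cong]: "sets \<mu> = sets borel"
  shows "fourier_transform \<mu> \<in> borel_measurable borel"
proof -
  interpret prob_space \<mu> by fact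
  show ?thesis unfolding fourier_transform_def by measurable
qed

lemma norm_fourier_transform_le_1:
  assumes "prob_space \<mu>" "sets \<mu> = sets borel"
  shows "norm (fourier_transform \<mu> \<xi>) \<le> 1"
proof -
  interpret prob_space \<mu> by fact
  have "norm (fourier_transform \<mu> \<xi>) \<le> (\<integral>x. norm (iexp (- (x \<bullet> \<xi>))) \<partial>\<mu>)"
    unfolding fourier_transform_def by (rule integral_norm_bound)
  then show ?thesis by (simp add: prob_space)
qed

text \<open>
  Damping the transform of \<open>\<mu>\<close> by a Gaussian makes Fubini's theorem applicable to the inversion
  integral, whatever \<open>\<mu>\<close> is. This smoothed inversion formula is the source of the exact one.
\<close>

lemma convolution_gaussian_eq:
  fixes \<mu> :: "'a::euclidean_space measure"
  assumes "prob_space \<mu>" and sets [measurable_cong]: "sets \<mu> = sets borel" and \<sigma>: "0 < \<sigma>"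
  shows "(\<integral>y. gaussian \<sigma> (x - y) \<partial>\<mu>)
    = fourier_inverse (\<lambda>\<xi>. fourier_transform \<mu> \<xi> * complex_of_real (exp (- (\<sigma> * norm \<xi>)\<^sup>2 / 2))) x"
proof -
  interpret prob_space \<mu> by fact
  interpret P: pair_sigma_finite \<mu> "lborel :: 'a measure" ..
  let ?k = "\<lambda>\<xi>::'a. complex_of_real (exp (- (\<sigma> * norm \<xi>)\<^sup>2 / 2))"
  let ?f = "\<lambda>y \<xi>. iexp ((x - y) \<bullet> \<xi>) * ?k \<xi>"
  have k: "integrable lborel ?k"
    using integrable_gaussian_char_euclidean[OF \<sigma>, of 0] by simp
  have pair: "integrable (\<mu> \<Otimes>\<^sub>M lborel) (case_prod ?f)"
  proof (rule P.Fubini_integrable)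
    show "case_prod ?f \<in> borel_measurable (\<mu> \<Otimes>\<^sub>M lborel)" by measurable
    show "integrable \<mu> (\<lambda>y. \<integral>\<xi>. norm (case_prod ?f (y, \<xi>)) \<partial>lborel)" by (simp add: norm_mult)
    show "AE y in \<mu>. integrable lborel (\<lambda>\<xi>. case_prod ?f (y, \<xi>))"
      using integrable_gaussian_char_euclidean[OF \<sigma>] by auto
  qed
  have "complex_of_real ((2 * pi) ^ DIM('a) * (\<integral>y. gaussian \<sigma> (x - y) \<partial>\<mu>)) = (\<integral>y. \<integral>\<xi>. ?f y \<xi> \<partial>lborel \<partial>\<mu>)"
    unfolding integral_gaussian_char_euclidean[OF \<sigma>] by simp
  also have "\<dots> = (\<integral>\<xi>. \<integral>y. ?f y \<xi> \<partial>\<mu> \<partial>lborel)" by (rule P.Fubini_integral[OF pair, symmetric])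
  also have "\<dots> = (\<integral>\<xi>. iexp (x \<bullet> \<xi>) * (fourier_transform \<mu> \<xi> * ?k \<xi>) \<partial>lborel)"
  proof (rule Bochner_Integration.integral_cong[OF refl])
    fix \<xi> :: 'a
    have "?f y \<xi> = iexp (x \<bullet> \<xi>) * ?k \<xi> * iexp (- (y \<bullet> \<xi>))" for y
      by (simp add: inner_diff_left right_diff_distrib exp_diff exp_minus field_simps)
    then show "(\<integral>y. ?f y \<xi> \<partial>\<mu>) = iexp (x \<bullet> \<xi>) * (fourier_transform \<mu> \<xi> * ?k \<xi>)"
      by (simp add: fourier_transform_def mult_ac)
  qed
  finally have "(2 * pi) ^ DIM('a) * (\<integral>y. gaussian \<sigma> (x - y) \<partial>\<mu>)
      = Re (\<integral>\<xi>. iexp (x \<bullet> \<xi>) * (fourier_transform \<mu> \<xi> * ?k \<xi>) \<partial>lborel)"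
    by (metis Re_complex_of_real)
  then show ?thesis
    by (simp add: fourier_inverse_def eq_divide_eq mult.commute)
qed

text \<open>
  Let the width of the Gaussian tend to zero. The mollified densities converge to \<open>g\<close>, uniformly
  bounded because the transform is integrable, and the mollified measures converge weakly to \<open>\<mu>\<close>.
  Comparing the two limits on continuous test functions identifies \<open>\<mu>\<close> with \<open>g\<close> times Lebesgue
  measure on boxes, and boxes generate the Borel sets.
\<close>

theorem fourier_inversion:
  fixes \<mu> :: "'a::euclidean_space measure"
  assumes "prob_space \<mu>" and sets [measurable_cong]: "sets \<mu> = sets borel"
    and int: "integrable lborel (fourier_transform \<mu>)"
  defines "g \<equiv> fourier_inverse (fourier_transform \<mu>)"
  shows "0 \<le> g x" and "\<mu> = density lborel (\<lambda>x. ennreal (g x))"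
proof -
  interpret prob_space \<mu> by fact
  let ?F = "fourier_transform \<mu>"
  define \<sigma> where "\<sigma> n = 1 / real (Suc n)" for n
  define C where "C = (\<integral>\<xi>. norm (?F \<xi>) \<partial>lborel) / (2 * pi) ^ DIM('a)"
  define gn where "gn n x = (\<integral>y. gaussian (\<sigma> n) (x - y) \<partial>\<mu>)" for n x
  have \<sigma>: "0 < \<sigma> n" for n by (simp add: \<sigma>_def)
  have [measurable]: "?F \<in> borel_measurable borel"
    using fourier_transform_measurable[OF assms(1,2)] .
  have inv_le: "\<bar>fourier_inverse h x\<bar> \<le> C" if "\<And>\<xi>. norm (h \<xi>) \<le> norm (?F \<xi>)"
    and [measurable]: "h \<in> borel_measurable borel" for h x
  proof -
    have "\<bar>Re (\<integral>\<xi>. iexp (x \<bullet> \<xi>) * h \<xi> \<partial>lborel)\<bar> \<le> norm (\<integral>\<xi>. iexp (x \<bullet> \<xi>) * h \<xi> \<partial>lborel)"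
      by (rule abs_Re_le_cmod)
    also have "\<dots> \<le> (\<integral>\<xi>. norm (iexp (x \<bullet> \<xi>) * h \<xi>) \<partial>lborel)" by (rule integral_norm_bound)
    also have "\<dots> \<le> (\<integral>\<xi>. norm (?F \<xi>) \<partial>lborel)"
      using that int by (intro integral_mono integrable_norm Bochner_Integration.integrable_bound[OF int])
        (auto simp: norm_mult)
    finally show ?thesis by (simp add: fourier_inverse_def C_def divide_right_mono)
  qed
  have gn_eq: "gn n x = fourier_inverse (\<lambda>\<xi>. ?F \<xi> * complex_of_real (exp (- (\<sigma> n * norm \<xi>)\<^sup>2 / 2))) x" for n x
    unfolding gn_def by (rule convolution_gaussian_eq[OF assms(1,2) \<sigma>])
  have gn_le: "\<bar>gn n x\<bar> \<le> C" for n x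
    unfolding gn_eq by (rule inv_le) (auto simp: norm_mult mult_left_le)
  have g_le: "\<bar>g x\<bar> \<le> C" for x unfolding g_def by (rule inv_le) auto
  have gn_nonneg: "0 \<le> gn n x" for n x unfolding gn_def by (simp add: gaussian_nonneg)
  have gn_lim: "(\<lambda>n. gn n x) \<longlonglongrightarrow> g x" for x
  proof -
    have "(\<lambda>n. \<integral>\<xi>. iexp (x \<bullet> \<xi>) * (?F \<xi> * complex_of_real (exp (- (\<sigma> n * norm \<xi>)\<^sup>2 / 2))) \<partial>lborel)
        \<longlonglongrightarrow> (\<integral>\<xi>. iexp (x \<bullet> \<xi>) * ?F \<xi> \<partial>lborel)"
    proof (rule integral_dominated_convergence[where w = "\<lambda>\<xi>. norm (?F \<xi>)"])
      show "integrable lborel (\<lambda>\<xi>. norm (?F \<xi>))" using int by (rule integrable_norm)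
      show "AE \<xi> in lborel. (\<lambda>n. iexp (x \<bullet> \<xi>) * (?F \<xi> * complex_of_real (exp (- (\<sigma> n * norm \<xi>)\<^sup>2 / 2))))
          \<longlonglongrightarrow> iexp (x \<bullet> \<xi>) * ?F \<xi>"
      proof (rule AE_I2)
        fix \<xi> :: 'a
        have "\<sigma> \<longlonglongrightarrow> 0" unfolding \<sigma>_def using LIMSEQ_inverse_real_of_nat by (simp add: inverse_eq_divide)
        then have "(\<lambda>n. iexp (x \<bullet> \<xi>) * (?F \<xi> * complex_of_real (exp (- (\<sigma> n * norm \<xi>)\<^sup>2 / 2))))
            \<longlonglongrightarrow> iexp (x \<bullet> \<xi>) * (?F \<xi> * complex_of_real (exp (- (0 * norm \<xi>)\<^sup>2 / 2)))"
          by (intro tendsto_intros) auto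
        then show "(\<lambda>n. iexp (x \<bullet> \<xi>) * (?F \<xi> * complex_of_real (exp (- (\<sigma> n * norm \<xi>)\<^sup>2 / 2))))
          \<longlonglongrightarrow> iexp (x \<bullet> \<xi>) * ?F \<xi>" by simp
      qed
    qed (auto simp: norm_mult mult_left_le)
    then show ?thesis
      unfolding gn_eq g_def fourier_inverse_def by (intro tendsto_intros) auto
  qed
  show g_nonneg: "0 \<le> g x" for x
    by (rule LIMSEQ_le_const[OF gn_lim]) (use gn_nonneg in auto)
  have [measurable]: "g \<in> borel_measurable borel" unfolding g_def fourier_inverse_def by measurable
  have [measurable]: "gn n \<in> borel_measurable borel" for n unfolding gn_def by measurable
  have test: "(\<integral>x. f x \<partial>\<mu>) = (\<integral>x. f x * g x \<partial>lborel)"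
    if f: "continuous_on UNIV f" "\<And>x. \<bar>f x\<bar> \<le> 1" and fi: "integrable lborel f" for f :: "'a \<Rightarrow> real"
  proof (rule LIMSEQ_unique)
    have [measurable]: "f \<in> borel_measurable borel" using f(1) by (rule borel_measurable_continuous_onI)
    interpret P: pair_sigma_finite \<mu> "lborel :: 'a measure" ..
    show "(\<lambda>n. \<integral>x. f x * gn n x \<partial>lborel) \<longlonglongrightarrow> (\<integral>x. f x * g x \<partial>lborel)"
    proof (rule integral_dominated_convergence[where w = "\<lambda>x. \<bar>f x\<bar> * C"])
      show "integrable lborel (\<lambda>x. \<bar>f x\<bar> * C)" using fi by auto
      show "AE x in lborel. (\<lambda>n. f x * gn n x) \<longlonglongrightarrow> f x * g x"
        using gn_lim by (auto intro!: tendsto_intros)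
      show "AE x in lborel. norm (f x * gn n x) \<le> \<bar>f x\<bar> * C" for n
        using gn_le by (auto simp: abs_mult intro!: mult_left_mono)
    qed measurable
    have shift: "integrable lborel (\<lambda>x. gaussian (\<sigma> n) (x - y))"
        "(\<integral>x. gaussian (\<sigma> n) (x - y) \<partial>lborel) = 1" for y :: 'a and n
    proof -
      have eq: "(lborel :: 'a measure) = distr lborel borel (\<lambda>x. y + x)"
        using lborel_affine[of 1 y] by (simp add: density_1)
      show "integrable lborel (\<lambda>x. gaussian (\<sigma> n) (x - y))"
        by (subst eq, subst integrable_distr_eq) (auto simp: integrable_gaussian \<sigma>)
      show "(\<integral>x. gaussian (\<sigma> n) (x - y) \<partial>lborel) = 1"
        by (subst eq, subst integral_distr) (auto simp: integral_gaussian \<sigma>)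
    qed
    have le: "norm (f x * gaussian (\<sigma> n) (x - y)) \<le> gaussian (\<sigma> n) (x - y)" for x y n
      using f(2)[of x] gaussian_nonneg[of "\<sigma> n" "x - y"] by (auto simp: abs_mult intro!: mult_left_le_one_le)
    have i1: "integrable lborel (\<lambda>x. f x * gaussian (\<sigma> n) (x - y))" for y n
      by (rule Bochner_Integration.integrable_bound[OF shift(1)[of n y]])
        (use le in \<open>auto simp: gaussian_nonneg\<close>)
    have swap: "(\<integral>x. f x * gn n x \<partial>lborel) = (\<integral>y. \<integral>x. f x * gaussian (\<sigma> n) (x - y) \<partial>lborel \<partial>\<mu>)" for n
    proof -
      have pair: "integrable (\<mu> \<Otimes>\<^sub>M lborel) (\<lambda>(y, x). f x * gaussian (\<sigma> n) (x - y))"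
      proof (rule P.Fubini_integrable)
        show "integrable \<mu> (\<lambda>y. \<integral>x. norm (case (y, x) of (y, x) \<Rightarrow> f x * gaussian (\<sigma> n) (x - y)) \<partial>lborel)"
        proof (rule integrable_const_bound[where B = 1])
          have "(\<integral>x. norm (f x * gaussian (\<sigma> n) (x - y)) \<partial>lborel) \<le> (\<integral>x. gaussian (\<sigma> n) (x - y) \<partial>lborel)" for y
            using le i1 shift(1) by (intro integral_mono) auto
          then show "AE y in \<mu>. norm (\<integral>x. norm (case (y, x) of (y, x) \<Rightarrow> f x * gaussian (\<sigma> n) (x - y)) \<partial>lborel) \<le> 1"
            by (auto simp: shift(2))
        qed measurable
      qed (use i1 in auto)
      have "(\<integral>x. f x * gn n x \<partial>lborel) = (\<integral>x. \<integral>y. f x * gaussian (\<sigma> n) (x - y) \<partial>\<mu> \<partial>lborel)"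
        by (simp add: gn_def)
      also have "\<dots> = (\<integral>y. \<integral>x. f x * gaussian (\<sigma> n) (x - y) \<partial>lborel \<partial>\<mu>)"
        by (rule P.Fubini_integral[OF pair])
      finally show ?thesis .
    qed
    have abs1: "(\<integral>x. norm (f x * gaussian (\<sigma> n) (x - y)) \<partial>lborel) \<le> 1" for n y
      using integral_mono[OF integrable_norm[OF i1] shift(1) le] by (simp add: shift(2))
    have bd: "\<bar>\<integral>x. f x * gaussian (\<sigma> n) (x - y) \<partial>lborel\<bar> \<le> 1" for n y
      using order_trans[OF integral_norm_bound abs1] by simp
    have "(\<lambda>n. \<integral>y. \<integral>x. f x * gaussian (\<sigma> n) (x - y) \<partial>lborel \<partial>\<mu>) \<longlonglongrightarrow> (\<integral>y. f y \<partial>\<mu>)"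
    proof (rule integral_dominated_convergence[where w = "\<lambda>_. 1"])
      show "AE y in \<mu>. (\<lambda>n. \<integral>x. f x * gaussian (\<sigma> n) (x - y) \<partial>lborel) \<longlonglongrightarrow> f y"
        unfolding \<sigma>_def using gaussian_approximate_identity[OF f] by auto
    qed (use bd in auto)
    then show "(\<lambda>n. \<integral>x. f x * gn n x \<partial>lborel) \<longlonglongrightarrow> (\<integral>x. f x \<partial>\<mu>)" unfolding swap .
  qed
  show "\<mu> = density lborel (\<lambda>x. ennreal (g x))"
  proof (rule measure_eqI_generator_eq)
    let ?E = "range (\<lambda>(a, b). box a b::'a set)"
    show "Int_stable ?E" by (auto simp: Int_stable_def box_Int_box)
    show "?E \<subseteq> Pow UNIV" "sets \<mu> = sigma_sets UNIV ?E"
        "sets (density lborel (\<lambda>x. ennreal (g x))) = sigma_sets UNIV ?E"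
      by (simp_all add: borel_eq_box sets)
    let ?A = "\<lambda>n::nat. box (- (real n *\<^sub>R One)) (real n *\<^sub>R One) :: 'a set"
    show "range ?A \<subseteq> ?E" "(\<Union>i. ?A i) = UNIV" unfolding UN_box_eq_UNIV by auto
    show "emeasure \<mu> (?A i) \<noteq> \<infinity>" for i by auto
    fix U assume "U \<in> ?E"
    then obtain l u where U: "U = box l u" by auto
    have ne: "- U \<noteq> {}" using not_bounded_UNIV bounded_box[of l u] U by (metis Compl_UNIV_eq double_compl)
    \<comment> \<open>continuous functions that increase to the indicator of the open box\<close>
    define f where "f n x = min 1 (real n * infdist x (- U))" for n x
    have f: "continuous_on UNIV (f n)" "\<bar>f n x\<bar> \<le> 1" "\<bar>f n x\<bar> \<le> indicator U x" for n x
      using ne by (auto simp: f_def infdist_nonneg indicator_def intro!: continuous_intros)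
    have [measurable]: "f n \<in> borel_measurable borel" for n using f(1) by (rule borel_measurable_continuous_onI)
    have [measurable]: "U \<in> sets borel" by (simp add: U)
    have Ui: "integrable lborel (indicator U :: 'a \<Rightarrow> real)"
      using emeasure_lborel_box_finite[of l u] by (auto simp: U)
    have lim: "(\<lambda>n. f n x) \<longlonglongrightarrow> indicator U x" for x
    proof (cases "x \<in> U")
      case True
      have "closed (- U)" by (simp add: U open_box closed_Compl)
      then have "infdist x (- U) \<noteq> 0" using in_closed_iff_infdist_zero[of "- U" x] ne True by auto
      then have pos: "0 < infdist x (- U)" using infdist_nonneg[of x "- U"] by linarith
      obtain N :: nat where N: "1 / infdist x (- U) \<le> real N" using real_arch_simple by blast
      have "f n x = 1" if "N \<le> n" for n
      proof -
        have "1 / infdist x (- U) \<le> real n" using N that by linarith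
        then show ?thesis using pos by (simp add: f_def field_simps)
      qed
      then show ?thesis using True by (intro tendsto_eventually) (auto simp: eventually_sequentially)
    next
      case False
      then show ?thesis using f(3)[of _ x] by simp
    qed
    have "(\<lambda>n. \<integral>x. f n x \<partial>\<mu>) \<longlonglongrightarrow> (\<integral>x. indicator U x \<partial>\<mu>)"
      by (rule integral_dominated_convergence[where w = "\<lambda>_. 1"]) (use f lim in auto)
    moreover have "(\<lambda>n. \<integral>x. f n x * g x \<partial>lborel) \<longlonglongrightarrow> (\<integral>x. indicator U x * g x \<partial>lborel)"
    proof (rule integral_dominated_convergence[where w = "\<lambda>x. indicator U x * C"])
      show "integrable lborel (\<lambda>x. indicator U x * C)" using Ui by auto
      show "AE x in lborel. (\<lambda>n. f n x * g x) \<longlonglongrightarrow> indicator U x * g x"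
        using lim by (auto intro!: tendsto_intros)
      show "AE x in lborel. norm (f n x * g x) \<le> indicator U x * C" for n
        using f(3) g_le by (auto simp: abs_mult intro!: mult_mono)
    qed measurable
    moreover have "(\<integral>x. f n x \<partial>\<mu>) = (\<integral>x. f n x * g x \<partial>lborel)" for n
      by (rule test[OF f(1,2)], rule Bochner_Integration.integrable_bound[OF Ui]) (use f(3) in auto)
    ultimately have "(\<integral>x. indicator U x \<partial>\<mu>) = (\<integral>x. indicator U x * g x \<partial>lborel)"
      by (simp add: LIMSEQ_unique)
    then have m: "measure \<mu> U = (\<integral>x. indicator U x * g x \<partial>lborel)" by (simp add: sets)
    have "integrable lborel (\<lambda>x. indicator U x * C)" using Ui by auto
    then have Ugi: "integrable lborel (\<lambda>x. indicator U x * g x)"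
      by (rule Bochner_Integration.integrable_bound)
        (use order_trans[OF g_le abs_ge_self] in \<open>auto simp: indicator_def\<close>)
    have "emeasure (density lborel (\<lambda>x. ennreal (g x))) U = (\<integral>\<^sup>+x. ennreal (indicator U x * g x) \<partial>lborel)"
      by (auto simp: emeasure_density indicator_def intro!: nn_integral_cong)
    also have "\<dots> = ennreal (\<integral>x. indicator U x * g x \<partial>lborel)"
      using Ugi g_nonneg by (intro nn_integral_eq_integral) auto
    finally show "emeasure \<mu> U = emeasure (density lborel (\<lambda>x. ennreal (g x))) U"
      by (simp add: emeasure_eq_measure m)
  qed
qed

lemma fourier_inverse_continuous:
  fixes h :: "'a::euclidean_space \<Rightarrow> complex"
  assumes h: "integrable lborel h"
  shows "continuous_on UNIV (fourier_inverse h)"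
proof -
  have "(fourier_inverse h \<circ> u) \<longlonglongrightarrow> fourier_inverse h x" if u: "u \<longlonglongrightarrow> x" for u x
  proof -
    have "(\<lambda>n. \<integral>\<xi>. iexp (u n \<bullet> \<xi>) * h \<xi> \<partial>lborel) \<longlonglongrightarrow> (\<integral>\<xi>. iexp (x \<bullet> \<xi>) * h \<xi> \<partial>lborel)"
    proof (rule integral_dominated_convergence[where w = "\<lambda>\<xi>. norm (h \<xi>)"])
      show "integrable lborel (\<lambda>\<xi>. norm (h \<xi>))" using h by (rule integrable_norm)
      show "AE \<xi> in lborel. (\<lambda>n. iexp (u n \<bullet> \<xi>) * h \<xi>) \<longlonglongrightarrow> iexp (x \<bullet> \<xi>) * h \<xi>"
        using u by (intro AE_I2 tendsto_intros)
    qed (use borel_measurable_integrable[OF h] in \<open>auto simp: norm_mult\<close>)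
    then show ?thesis
      unfolding fourier_inverse_def comp_def by (intro tendsto_intros) auto
  qed
  then show ?thesis
    by (auto simp: continuous_on_sequentially)
qed

lemma norm_iexp_diff_le: "norm (iexp s - iexp t) \<le> \<bar>s - t\<bar>"
proof -
  have "iexp s - iexp t = iexp t * (iexp (s - t) - 1)"
    by (simp add: right_diff_distrib exp_diff)
  then show ?thesis
    using iexp_approx1[of "s - t" 0] by (simp add: norm_mult)
qed

text \<open>
  Differentiation under the integral sign: the difference quotients of \<open>iexp\<close> are bounded by
  \<open>norm v * norm \<xi>\<close>, so \<open>h1\<close> provides the dominating function.
\<close>

lemma fourier_inverse_has_partial_derivative:
  fixes h :: "'a::euclidean_space \<Rightarrow> complex"
  assumes h: "integrable lborel h" and h1: "integrable lborel (\<lambda>\<xi>. of_real (norm \<xi>) * h \<xi>)"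
  shows "((\<lambda>t. fourier_inverse h (x + t *\<^sub>R v)) has_real_derivative
    fourier_inverse (\<lambda>\<xi>. \<i> * of_real (v \<bullet> \<xi>) * h \<xi>) x) (at 0)"
proof -
  have [measurable]: "h \<in> borel_measurable borel" using borel_measurable_integrable[OF h] by simp
  have int: "integrable lborel (\<lambda>\<xi>. iexp (y \<bullet> \<xi>) * h \<xi>)" for y
    by (rule Bochner_Integration.integrable_bound[OF h]) (auto simp: norm_mult)
  have "((\<lambda>t. (fourier_inverse h (x + t *\<^sub>R v) - fourier_inverse h x) / t) \<longlongrightarrow>
      fourier_inverse (\<lambda>\<xi>. \<i> * of_real (v \<bullet> \<xi>) * h \<xi>) x) (at 0)"
  proof (rule tendsto_at_iff_sequentially[THEN iffD2], safe)
    fix u :: "nat \<Rightarrow> real" assume u0: "\<forall>i. u i \<in> UNIV - {0}" and u: "u \<longlonglongrightarrow> 0"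
    have quot: "(fourier_inverse h (x + u n *\<^sub>R v) - fourier_inverse h x) / u n
      = Re (\<integral>\<xi>. iexp (x \<bullet> \<xi>) * ((iexp (u n * (v \<bullet> \<xi>)) - 1) / of_real (u n)) * h \<xi> \<partial>lborel) / (2 * pi) ^ DIM('a)" for n
    proof -
      have "(\<integral>\<xi>. iexp (x \<bullet> \<xi>) * ((iexp (u n * (v \<bullet> \<xi>)) - 1) / of_real (u n)) * h \<xi> \<partial>lborel)
          = (\<integral>\<xi>. (iexp ((x + u n *\<^sub>R v) \<bullet> \<xi>) * h \<xi> - iexp (x \<bullet> \<xi>) * h \<xi>) / of_real (u n) \<partial>lborel)"
        by (intro Bochner_Integration.integral_cong refl)
          (simp add: inner_add_left exp_add algebra_simps diff_divide_distrib)
      also have "\<dots> = ((\<integral>\<xi>. iexp ((x + u n *\<^sub>R v) \<bullet> \<xi>) * h \<xi> \<partial>lborel) - (\<integral>\<xi>. iexp (x \<bullet> \<xi>) * h \<xi> \<partial>lborel)) / of_real (u n)"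
        using int by simp
      finally show ?thesis
        by (simp add: fourier_inverse_def diff_divide_distrib Re_divide_of_real divide_divide_eq_left mult.commute)
    qed
    have "(\<lambda>n. \<integral>\<xi>. iexp (x \<bullet> \<xi>) * ((iexp (u n * (v \<bullet> \<xi>)) - 1) / of_real (u n)) * h \<xi> \<partial>lborel)
      \<longlonglongrightarrow> (\<integral>\<xi>. iexp (x \<bullet> \<xi>) * (\<i> * of_real (v \<bullet> \<xi>)) * h \<xi> \<partial>lborel)"
    proof (rule integral_dominated_convergence[where w = "\<lambda>\<xi>. norm v * norm (of_real (norm \<xi>) * h \<xi>)"])
      show "integrable lborel (\<lambda>\<xi>. norm v * norm (of_real (norm \<xi>) * h \<xi>))"
        using integrable_norm[OF h1] by (rule integrable_mult_right)
      show "AE \<xi> in lborel. norm (iexp (x \<bullet> \<xi>) * ((iexp (u n * (v \<bullet> \<xi>)) - 1) / of_real (u n)) * h \<xi>)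
          \<le> norm v * norm (of_real (norm \<xi>) * h \<xi>)" for n
      proof (rule AE_I2)
        fix \<xi> :: 'a
        have "norm (iexp (u n * (v \<bullet> \<xi>)) - 1) \<le> \<bar>u n\<bar> * \<bar>v \<bullet> \<xi>\<bar>"
          using norm_iexp_diff_le[of "u n * (v \<bullet> \<xi>)" 0] by (simp add: abs_mult)
        also have "\<dots> \<le> \<bar>u n\<bar> * (norm v * norm \<xi>)"
          by (intro mult_left_mono Cauchy_Schwarz_ineq2) auto
        finally have "norm ((iexp (u n * (v \<bullet> \<xi>)) - 1) / of_real (u n)) \<le> norm v * norm \<xi>"
          using u0 by (simp add: norm_divide field_simps)
        then have "norm ((iexp (u n * (v \<bullet> \<xi>)) - 1) / of_real (u n)) * norm (h \<xi>) \<le> norm v * norm \<xi> * norm (h \<xi>)"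
          by (rule mult_right_mono) simp
        then show "norm (iexp (x \<bullet> \<xi>) * ((iexp (u n * (v \<bullet> \<xi>)) - 1) / of_real (u n)) * h \<xi>)
          \<le> norm v * norm (of_real (norm \<xi>) * h \<xi>)"
          by (simp add: norm_mult norm_divide mult.assoc)
      qed
      show "AE \<xi> in lborel. (\<lambda>n. iexp (x \<bullet> \<xi>) * ((iexp (u n * (v \<bullet> \<xi>)) - 1) / of_real (u n)) * h \<xi>)
          \<longlonglongrightarrow> iexp (x \<bullet> \<xi>) * (\<i> * of_real (v \<bullet> \<xi>)) * h \<xi>"
      proof (rule AE_I2)
        fix \<xi> :: 'a
        have "((\<lambda>z. exp (\<i> * (z * of_real (v \<bullet> \<xi>)))) has_field_derivative \<i> * of_real (v \<bullet> \<xi>)) (at 0)"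
          by (auto intro!: derivative_eq_intros)
        then have lim: "((\<lambda>z. (exp (\<i> * (z * of_real (v \<bullet> \<xi>))) - 1) / z) \<longlongrightarrow> \<i> * of_real (v \<bullet> \<xi>)) (at 0)"
          by (simp add: DERIV_def)
        have "(\<lambda>n. complex_of_real (u n)) \<longlonglongrightarrow> 0" using tendsto_of_real[OF u] by simp
        then have "((\<lambda>z. (exp (\<i> * (z * of_real (v \<bullet> \<xi>))) - 1) / z) \<circ> (\<lambda>n. complex_of_real (u n)))
            \<longlonglongrightarrow> \<i> * of_real (v \<bullet> \<xi>)"
          using u0 by (intro tendsto_at_iff_sequentially[THEN iffD1, OF lim, rule_format]) auto
        then have "(\<lambda>n. (iexp (u n * (v \<bullet> \<xi>)) - 1) / of_real (u n)) \<longlonglongrightarrow> \<i> * of_real (v \<bullet> \<xi>)"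
          by (simp add: comp_def)
        then show "(\<lambda>n. iexp (x \<bullet> \<xi>) * ((iexp (u n * (v \<bullet> \<xi>)) - 1) / of_real (u n)) * h \<xi>)
          \<longlonglongrightarrow> iexp (x \<bullet> \<xi>) * (\<i> * of_real (v \<bullet> \<xi>)) * h \<xi>"
          by (intro tendsto_intros)
      qed
    qed measurable
    then have "(\<lambda>n. Re (\<integral>\<xi>. iexp (x \<bullet> \<xi>) * ((iexp (u n * (v \<bullet> \<xi>)) - 1) / of_real (u n)) * h \<xi> \<partial>lborel) / (2 * pi) ^ DIM('a))
      \<longlonglongrightarrow> Re (\<integral>\<xi>. iexp (x \<bullet> \<xi>) * (\<i> * of_real (v \<bullet> \<xi>)) * h \<xi> \<partial>lborel) / (2 * pi) ^ DIM('a)"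
      by (intro tendsto_intros) auto
    then show "((\<lambda>t. (fourier_inverse h (x + t *\<^sub>R v) - fourier_inverse h x) / t) \<circ> u)
        \<longlonglongrightarrow> fourier_inverse (\<lambda>\<xi>. \<i> * of_real (v \<bullet> \<xi>) * h \<xi>) x"
      unfolding comp_def quot by (simp add: fourier_inverse_def mult.assoc)
  qed
  then show ?thesis by (simp add: DERIV_def)
qed

text \<open>
  A partial derivative of an inverse transform is the inverse transform of \<open>\<i> * \<xi>\<^sub>i * h \<xi>\<close>, which costs
  one power of \<open>1 + norm \<xi>\<close>; so the claim follows by induction on \<open>k\<close>.
\<close>

lemma fourier_inverse_C_k:
  fixes h :: "real ^ 'd \<Rightarrow> complex"
  assumes [measurable]: "h \<in> borel_measurable borel"
    and "integrable lborel (\<lambda>\<xi>. (1 + norm \<xi>) ^ k * norm (h \<xi>))"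
  shows "C_k k (fourier_inverse h)"
  using assms
proof (induction k arbitrary: h)
  case 0
  then have "integrable lborel h" by (simp add: integrable_norm_iff)
  then show ?case by (simp add: fourier_inverse_continuous)
next
  case (Suc k)
  have [measurable]: "h \<in> borel_measurable borel" by fact
  have bound: "integrable lborel f" if "\<And>\<xi>. norm (f \<xi>) \<le> norm ((1 + norm \<xi>) ^ Suc k * norm (h \<xi>))"
    "f \<in> borel_measurable borel" for f :: "real ^ 'd \<Rightarrow> 'b::{banach, second_countable_topology}"
    by (rule Bochner_Integration.integrable_bound[OF Suc.prems(2)]) (use that in auto)
  have one: "1 \<le> (1 + norm \<xi>) ^ n" for \<xi> :: "real ^ 'd" and n by (simp add: one_le_power)
  have h0: "integrable lborel h"
  proof (rule bound)
    show "norm (h \<xi>) \<le> norm ((1 + norm \<xi>) ^ Suc k * norm (h \<xi>))" for \<xi>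
      using mult_right_mono[OF one[of \<xi> "Suc k"] norm_ge_zero[of "h \<xi>"]] by (simp add: abs_mult)
  qed measurable
  have h1: "integrable lborel (\<lambda>\<xi>. of_real (norm \<xi>) * h \<xi>)"
  proof (rule bound)
    fix \<xi> :: "real ^ 'd"
    have "norm \<xi> * 1 \<le> (1 + norm \<xi>) * (1 + norm \<xi>) ^ k" using one[of \<xi> k] by (intro mult_mono) auto
    then show "norm (of_real (norm \<xi>) * h \<xi>) \<le> norm ((1 + norm \<xi>) ^ Suc k * norm (h \<xi>))"
      by (simp add: norm_mult abs_mult mult_right_mono del: distrib_right distrib_left)
  qed measurable
  define g where "g i = fourier_inverse (\<lambda>\<xi>. \<i> * of_real (axis i 1 \<bullet> \<xi>) * h \<xi>)" for i
  have "C_k k (g i)" for i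
    unfolding g_def
  proof (rule Suc.IH)
    show "integrable lborel (\<lambda>\<xi>. (1 + norm \<xi>) ^ k * norm (\<i> * of_real (axis i 1 \<bullet> \<xi>) * h \<xi>))"
    proof (rule bound)
      fix \<xi> :: "real ^ 'd"
      have "\<bar>axis i 1 \<bullet> \<xi>\<bar> \<le> 1 + norm \<xi>" using Cauchy_Schwarz_ineq2[of "axis i 1" \<xi>] by simp
      then have "(1 + norm \<xi>) ^ k * (\<bar>axis i 1 \<bullet> \<xi>\<bar> * norm (h \<xi>)) \<le> (1 + norm \<xi>) ^ k * ((1 + norm \<xi>) * norm (h \<xi>))"
        by (intro mult_left_mono mult_right_mono) auto
      then show "norm ((1 + norm \<xi>) ^ k * norm (\<i> * of_real (axis i 1 \<bullet> \<xi>) * h \<xi>))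
          \<le> norm ((1 + norm \<xi>) ^ Suc k * norm (h \<xi>))"
        by (simp add: norm_mult abs_mult mult_ac del: distrib_right distrib_left)
    qed measurable
  qed measurable
  moreover have "((\<lambda>t. fourier_inverse h (x + t *\<^sub>R axis i 1)) has_real_derivative g i x) (at 0)" for i x
    unfolding g_def by (rule fourier_inverse_has_partial_derivative[OF h0 h1])
  ultimately show ?case
    using fourier_inverse_continuous[OF h0] by auto
qed

text \<open>
  The exponent \<open>2 * DIM('a)\<close> is far from optimal, but it allows a comparison with the product of the
  one-dimensional functions \<open>1 / (1 + t\<^sup>2)\<close>.
\<close>

lemma integrable_inverse_one_plus_norm_power:
  "integrable lborel (\<lambda>\<xi>::'a::euclidean_space. 1 / (1 + norm \<xi>) ^ (2 * DIM('a)))"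
proof -
  have "integrable lborel (\<lambda>x::real. inverse (1 + x\<^sup>2))"
    using integrable_inverse_1_plus_square by (simp add: set_integrable_def)
  then have "integrable lborel (\<lambda>\<xi>::'a. \<Prod>b\<in>Basis. inverse (1 + (\<xi> \<bullet> b)\<^sup>2))"
    by (rule integrable_lborel_prod)
  then show ?thesis
  proof (rule Bochner_Integration.integrable_bound)
    show "AE \<xi> in lborel. norm (1 / (1 + norm (\<xi>::'a)) ^ (2 * DIM('a))) \<le> norm (\<Prod>b\<in>Basis. inverse (1 + (\<xi> \<bullet> b)\<^sup>2))"
    proof (rule AE_I2)
      fix \<xi> :: 'a
      have "1 + (\<xi> \<bullet> b)\<^sup>2 \<le> (1 + norm \<xi>)\<^sup>2" if "b \<in> Basis" for b
      proof -
        have "(\<xi> \<bullet> b)\<^sup>2 \<le> (norm \<xi>)\<^sup>2"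
          using Basis_le_norm[OF that, of \<xi>] by (simp add: abs_le_square_iff[symmetric])
        then show ?thesis by (simp add: power2_sum add_increasing2)
      qed
      then have "(\<Prod>b\<in>Basis. 1 + (\<xi> \<bullet> b)\<^sup>2) \<le> (\<Prod>b\<in>(Basis::'a set). (1 + norm \<xi>)\<^sup>2)"
        by (intro prod_mono) (auto simp: add_nonneg_nonneg)
      then have "(\<Prod>b\<in>Basis. 1 + (\<xi> \<bullet> b)\<^sup>2) \<le> (1 + norm \<xi>) ^ (2 * DIM('a))"
        by (simp add: power_mult)
      moreover have "0 < (\<Prod>b\<in>Basis. 1 + (\<xi> \<bullet> b)\<^sup>2)"
        by (intro prod_pos) (simp add: add_pos_nonneg)
      ultimately show "norm (1 / (1 + norm \<xi>) ^ (2 * DIM('a))) \<le> norm (\<Prod>b\<in>Basis. inverse (1 + (\<xi> \<bullet> b)\<^sup>2))"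
        by (simp add: prod_dividef inverse_eq_divide frac_le)
    qed
  qed measurable
qed

lemma
  fixes \<mu> :: "(real ^ 'd) measure"
  assumes "prob_space \<mu>" "sets \<mu> = sets borel"
    and decay: "\<And>\<xi>. norm (fourier_transform \<mu> \<xi>) * (1 + norm \<xi>) ^ (k + 2 * CARD('d)) \<le> C"
  shows fourier_decay_imp_density: "\<mu> = density lborel (\<lambda>x. ennreal (fourier_inverse (fourier_transform \<mu>) x))"
    and fourier_decay_imp_C_k_density: "abs_cont_with_C_k_density k \<mu>"
proof -
  let ?F = "fourier_transform \<mu>"
  have [measurable]: "?F \<in> borel_measurable borel" using fourier_transform_measurable[OF assms(1,2)] .
  have "integrable lborel (\<lambda>\<xi>::real ^ 'd. C * (1 / (1 + norm \<xi>) ^ (2 * CARD('d))))"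
    using integrable_inverse_one_plus_norm_power[where 'a = "real ^ 'd"] by (intro integrable_mult_right) simp
  then have k: "integrable lborel (\<lambda>\<xi>. (1 + norm \<xi>) ^ k * norm (?F \<xi>))"
  proof (rule Bochner_Integration.integrable_bound)
    show "AE \<xi> in lborel. norm ((1 + norm \<xi>) ^ k * norm (?F \<xi>)) \<le> norm (C * (1 / (1 + norm \<xi>) ^ (2 * CARD('d))))"
    proof (rule AE_I2)
      fix \<xi> :: "real ^ 'd"
      have pos: "0 < (1 + norm \<xi>) ^ (2 * CARD('d))" by (simp add: add_pos_nonneg)
      have "(1 + norm \<xi>) ^ k * norm (?F \<xi>) \<le> C / (1 + norm \<xi>) ^ (2 * CARD('d))"
        using decay[of \<xi>] pos by (simp add: pos_le_divide_eq power_add mult_ac)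
      then show "norm ((1 + norm \<xi>) ^ k * norm (?F \<xi>)) \<le> norm (C * (1 / (1 + norm \<xi>) ^ (2 * CARD('d))))"
        using order_trans[OF _ divide_right_mono[OF abs_ge_self less_imp_le[OF pos]]] by (simp add: abs_mult)
    qed
  qed measurable
  have "integrable lborel ?F"
  proof (rule Bochner_Integration.integrable_bound[OF k])
    show "AE \<xi> in lborel. norm (?F \<xi>) \<le> norm ((1 + norm \<xi>) ^ k * norm (?F \<xi>))"
    proof (rule AE_I2)
      fix \<xi> :: "real ^ 'd"
      have "1 \<le> (1 + norm \<xi>) ^ k" by (simp add: one_le_power)
      then show "norm (?F \<xi>) \<le> norm ((1 + norm \<xi>) ^ k * norm (?F \<xi>))"
        using mult_right_mono[of 1 "(1 + norm \<xi>) ^ k" "norm (?F \<xi>)"] by (simp add: abs_mult)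
    qed
  qed measurable
  note inversion = fourier_inversion[OF assms(1,2) this]
  show \<mu>: "\<mu> = density lborel (\<lambda>x. ennreal (fourier_inverse ?F x))" by (rule inversion(2))
  have C: "C_k k (fourier_inverse ?F)" using k by (intro fourier_inverse_C_k) auto
  have "(\<lambda>x. ennreal (fourier_inverse ?F x)) \<in> borel_measurable lborel"
    unfolding fourier_inverse_def by measurable
  then have "absolutely_continuous lborel \<mu>"
    by (subst \<mu>) (rule absolutely_continuousI_density)
  then show "abs_cont_with_C_k_density k \<mu>"
    unfolding abs_cont_with_C_k_density_def using C inversion(1) \<mu> by blast
qed

lemma fourier_transform_tendsto_one:
  assumes "prob_space \<mu>" and [measurable_cong]: "sets \<mu> = sets borel" and u: "u \<longlonglongrightarrow> 0"
  shows "(\<lambda>n. fourier_transform \<mu> (u n)) \<longlonglongrightarrow> 1"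
proof -
  interpret prob_space \<mu> by fact
  have "(\<lambda>n. fourier_transform \<mu> (u n)) \<longlonglongrightarrow> (\<integral>x. iexp (- (x \<bullet> 0)) \<partial>\<mu>)"
    unfolding fourier_transform_def
  proof (rule integral_dominated_convergence[where w = "\<lambda>_. 1"])
    show "AE x in \<mu>. (\<lambda>n. iexp (- (x \<bullet> u n))) \<longlonglongrightarrow> iexp (- (x \<bullet> 0))"
      using u by (intro AE_I2 tendsto_intros)
  qed auto
  then show ?thesis by (simp add: prob_space)
qed

section \<open>Self-affine measures and their Fourier transforms\<close>

lemma contraction_matrix_nth: "(contraction_matrix \<theta> *v x) $ i = x $ i / \<theta> $ i"
  by (simp add: contraction_matrix_def matrix_vector_mult_def if_distrib[of "\<lambda>u. u * _"] inverse_eq_divide cong: if_cong)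

lemma contraction_matrix_funpow_nth: "(((*v) (contraction_matrix \<theta>)) ^^ n) x $ i = x $ i / \<theta> $ i ^ n"
  by (induction n) (simp_all add: contraction_matrix_nth mult.commute)

lemma contraction_matrix_inner: "(contraction_matrix \<theta> *v x) \<bullet> y = x \<bullet> (contraction_matrix \<theta> *v y)"
  by (simp add: inner_vec_def contraction_matrix_nth)

text \<open>
  If all digits agreed in coordinate \<open>i\<close>, the \<open>i\<close>-th coordinate of every point of the attractor would
  be the sum of one and the same series, and the attractor would lie in a hyperplane.
\<close>

lemma irreducible_imp_coordinate_differs:
  fixes \<theta> :: "real ^ 'd"
  assumes "affinely_irreducible \<theta> (a ` {1..m})"
  shows "\<exists>j\<in>{1..m}. a j $ i \<noteq> a 1 $ i"
proof (rule ccontr)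
  assume "\<not> ?thesis"
  then have eq: "v $ i = a 1 $ i" if "v \<in> a ` {1..m}" for v using that by auto
  define c where "c = (\<Sum>n. a 1 $ i / \<theta> $ i ^ n)"
  have "x $ i = c" if x: "x \<in> attractor \<theta> (a ` {1..m})" for x
  proof -
    obtain b where b: "\<And>n. b n \<in> a ` {1..m}"
      and s: "(\<lambda>n. (((*v) (contraction_matrix \<theta>)) ^^ n) (b n)) sums x"
      using x by (auto simp: attractor_def)
    have "(\<lambda>n. (((*v) (contraction_matrix \<theta>)) ^^ n) (b n) $ i) sums (x $ i)"
      by (rule bounded_linear.sums[OF bounded_linear_vec_nth s])
    then have "(\<lambda>n. a 1 $ i / \<theta> $ i ^ n) sums (x $ i)"
      using b eq by (simp add: contraction_matrix_funpow_nth)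
    then show ?thesis unfolding c_def by (rule sums_unique)
  qed
  then have "attractor \<theta> (a ` {1..m}) \<subseteq> {x. axis i 1 \<bullet> x = c}"
    by (auto simp: inner_axis inner_commute)
  moreover have "(c + 1) *\<^sub>R axis i 1 \<notin> {x :: real ^ 'd. axis i 1 \<bullet> x = c}"
    by (simp add: inner_axis_axis inner_real_def)
  ultimately show False
    using assms affine_hyperplane[of "axis i (1::real)" c] unfolding affinely_irreducible_def by blast
qed

definition digit_sum :: "nat \<Rightarrow> (nat \<Rightarrow> real ^ 'd) \<Rightarrow> (nat \<Rightarrow> real) \<Rightarrow> real ^ 'd \<Rightarrow> complex" where
  "digit_sum m a p \<xi> = (\<Sum>j=1..m. of_real (p j) * iexp (- (a j \<bullet> \<xi>)))"

lemma norm_digit_sum_le_1: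
  assumes "prob_vector m p"
  shows "norm (digit_sum m a p \<xi>) \<le> 1"
proof -
  have "norm (digit_sum m a p \<xi>) \<le> (\<Sum>j=1..m. p j)"
    unfolding digit_sum_def using assms
    by (intro order_trans[OF norm_sum] sum_mono) (auto simp: norm_mult prob_vector_def)
  then show ?thesis using assms by (simp add: prob_vector_def)
qed

lemma norm_two_phases_le:
  fixes q r s t \<epsilon> :: real
  assumes "0 < \<epsilon>" "\<epsilon> \<le> q" "\<epsilon> \<le> r" "q + r \<le> 1"
  shows "norm (of_real q * iexp s + of_real r * iexp t) \<le> q + r - \<epsilon>\<^sup>2 * (1 - cos (t - s))"
proof (rule power2_le_imp_le)
  let ?k = "1 - cos (t - s)"
  have k: "0 \<le> ?k" "?k \<le> 2" using cos_ge_minus_one[of "t - s"] by simp_all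
  have qr: "\<epsilon>\<^sup>2 \<le> q * r" unfolding power2_eq_square using assms by (intro mult_mono) auto
  have "(norm (of_real q * iexp s + of_real r * iexp t))\<^sup>2 = (q * cos s + r * cos t)\<^sup>2 + (q * sin s + r * sin t)\<^sup>2"
    by (simp add: cmod_power2 Re_exp Im_exp)
  also have "\<dots> = q\<^sup>2 * ((sin s)\<^sup>2 + (cos s)\<^sup>2) + r\<^sup>2 * ((sin t)\<^sup>2 + (cos t)\<^sup>2) + 2 * q * r * cos (t - s)"
    unfolding cos_diff by algebra
  also have "\<dots> = (q + r)\<^sup>2 - 2 * (q * r) * ?k"
    by (simp add: power2_eq_square algebra_simps)
  also have "\<dots> \<le> (q + r)\<^sup>2 - 2 * \<epsilon>\<^sup>2 * ?k"
    using mult_right_mono[OF qr k(1)] by simp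
  also have "\<dots> \<le> (q + r)\<^sup>2 - 2 * (q + r) * (\<epsilon>\<^sup>2 * ?k)"
  proof -
    have "(q + r) * (\<epsilon>\<^sup>2 * ?k) \<le> 1 * (\<epsilon>\<^sup>2 * ?k)" using assms(4) k by (intro mult_right_mono) auto
    then show ?thesis by (simp only: mult.assoc mult_1)
  qed
  also have "\<dots> \<le> (q + r - \<epsilon>\<^sup>2 * ?k)\<^sup>2"
    by (simp add: power2_diff)
  finally show "(norm (of_real q * iexp s + of_real r * iexp t))\<^sup>2 \<le> (q + r - \<epsilon>\<^sup>2 * ?k)\<^sup>2" .
  have "\<epsilon>\<^sup>2 * ?k \<le> \<epsilon>\<^sup>2 * 2" using k by (intro mult_left_mono) auto
  also have "\<dots> \<le> q + r"
    using assms mult_mono[of \<epsilon> "1/2" \<epsilon> q] mult_mono[of \<epsilon> "1/2" \<epsilon> r] by (simp add: power2_eq_square)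
  finally show "0 \<le> q + r - \<epsilon>\<^sup>2 * ?k" by simp
qed

text \<open>
  Two terms of the sum whose phases differ noticeably cannot add up to the sum of their absolute
  values; the remaining terms are estimated trivially.
\<close>

lemma norm_digit_sum_le:
  assumes p: "prob_vector m p" and \<epsilon>: "0 < \<epsilon>" "\<And>j. j \<in> {1..m} \<Longrightarrow> \<epsilon> \<le> p j"
    and ij: "i \<in> {1..m}" "j \<in> {1..m}" "i \<noteq> j" and c: "cos ((a j - a i) \<bullet> \<xi>) \<le> \<gamma>"
  shows "norm (digit_sum m a p \<xi>) \<le> 1 - \<epsilon>\<^sup>2 * (1 - \<gamma>)"
proof -
  let ?f = "\<lambda>j. of_real (p j) * iexp (- (a j \<bullet> \<xi>))"
  have nonneg: "0 \<le> p l" if "l \<in> {1..m}" for l using p that by (simp add: prob_vector_def)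
  have split: "(\<Sum>l=1..m. g l) = g i + g j + (\<Sum>l\<in>{1..m} - {i, j}. g l)" for g :: "nat \<Rightarrow> 'b::comm_monoid_add"
  proof -
    let ?R = "{1..m} - {i, j}"
    have "sum g (insert i (insert j ?R)) = g i + g j + sum g ?R" using ij(3) by (simp add: add.assoc)
    moreover have "insert i (insert j ?R) = {1..m}" using ij by auto
    ultimately show ?thesis by simp
  qed
  have sum_p: "p i + p j + (\<Sum>l\<in>{1..m} - {i, j}. p l) = 1"
    using p split[of p] by (simp add: prob_vector_def)
  then have ple: "p i + p j \<le> 1"
    using sum_nonneg[of "{1..m} - {i, j}" p] nonneg by fastforce
  have "norm (digit_sum m a p \<xi>) \<le> norm (?f i + ?f j) + norm (\<Sum>l\<in>{1..m} - {i, j}. ?f l)"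
    unfolding digit_sum_def split[of ?f] by (rule norm_triangle_ineq)
  also have "norm (\<Sum>l\<in>{1..m} - {i, j}. ?f l) \<le> (\<Sum>l\<in>{1..m} - {i, j}. p l)"
    using nonneg by (intro order_trans[OF norm_sum] sum_mono) (auto simp: norm_mult)
  also have "norm (?f i + ?f j) \<le> p i + p j - \<epsilon>\<^sup>2 * (1 - cos (- (a j \<bullet> \<xi>) - - (a i \<bullet> \<xi>)))"
    using \<epsilon> ij ple by (intro norm_two_phases_le) auto
  also have "cos (- (a j \<bullet> \<xi>) - - (a i \<bullet> \<xi>)) = cos ((a j - a i) \<bullet> \<xi>)"
    by (subst cos_minus[symmetric]) (simp add: inner_diff_left)
  finally have "norm (digit_sum m a p \<xi>) \<le> 1 - \<epsilon>\<^sup>2 * (1 - cos ((a j - a i) \<bullet> \<xi>))"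
    using sum_p by linarith
  also have "\<dots> \<le> 1 - \<epsilon>\<^sup>2 * (1 - \<gamma>)"
    using c by (simp add: mult_left_mono)
  finally show ?thesis .
qed

definition digit_pmf :: "nat \<Rightarrow> (nat \<Rightarrow> real) \<Rightarrow> nat pmf" where
  "digit_pmf m p = embed_pmf (\<lambda>j. if j \<in> {1..m} then p j else 0)"

lemma
  assumes "prob_vector m p"
  shows pmf_digit_pmf: "pmf (digit_pmf m p) j = (if j \<in> {1..m} then p j else 0)"
    and set_digit_pmf: "set_pmf (digit_pmf m p) \<subseteq> {1..m}"
proof -
  have sum: "(\<integral>\<^sup>+j. ennreal (if j \<in> {1..m} then p j else 0) \<partial>count_space UNIV) = 1"
  proof -
    have "(\<integral>\<^sup>+j. ennreal (if j \<in> {1..m} then p j else 0) \<partial>count_space UNIV) = (\<Sum>j=1..m. ennreal (if j \<in> {1..m} then p j else 0))"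
      by (rule nn_integral_count_space') auto
    also have "\<dots> = (\<Sum>j=1..m. ennreal (p j))" by (intro sum.cong) auto
    also have "\<dots> = ennreal (\<Sum>j=1..m. p j)"
      using assms by (intro sum_ennreal) (auto simp: prob_vector_def)
    finally show ?thesis using assms by (simp add: prob_vector_def)
  qed
  have nn: "0 \<le> (if j \<in> {1..m} then p j else 0)" for j using assms by (auto simp: prob_vector_def)
  show "pmf (digit_pmf m p) j = (if j \<in> {1..m} then p j else 0)"
    unfolding digit_pmf_def by (rule pmf_embed_pmf[OF nn sum])
  show "set_pmf (digit_pmf m p) \<subseteq> {1..m}"
    unfolding digit_pmf_def by (subst set_embed_pmf[OF nn sum]) auto
qed

lemma ifs_map_measurable [measurable]: "ifs_map \<theta> a j \<in> borel_measurable borel"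
proof -
  have "continuous_on UNIV (ifs_map \<theta> a j)"
    unfolding ifs_map_def by (intro continuous_intros linear_continuous_on matrix_vector_mul_bounded_linear)
  then show ?thesis by (rule borel_measurable_continuous_onI)
qed

text \<open>
  The defining identity, read probabilistically: draw a digit and, independently, a point from \<open>\<mu>\<close>;
  then the image of the point has law \<open>\<mu>\<close> again. In this form it applies to integrals.
\<close>

lemma self_affine_measure_eq_distr:
  assumes p: "prob_vector m p" and \<mu>: "is_self_affine_measure \<theta> m a p \<mu>"
  shows "\<mu> = distr (measure_pmf (digit_pmf m p) \<Otimes>\<^sub>M \<mu>) borel (\<lambda>(j, x). ifs_map \<theta> a j x)" (is "\<mu> = ?R")
    and "(\<lambda>(j, x). ifs_map \<theta> a j x) \<in> borel_measurable (measure_pmf (digit_pmf m p) \<Otimes>\<^sub>M \<mu>)"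
proof -
  let ?P = "digit_pmf m p"
  have [measurable_cong]: "sets \<mu> = sets borel" using \<mu> by (simp add: is_self_affine_measure_def)
  interpret prob_space \<mu> using \<mu> by (simp add: is_self_affine_measure_def)
  show [measurable]: "(\<lambda>(j, x). ifs_map \<theta> a j x) \<in> borel_measurable (measure_pmf ?P \<Otimes>\<^sub>M \<mu>)"
  proof -
    have "(\<lambda>(j, x). ifs_map \<theta> a j x) \<in> borel_measurable (count_space UNIV \<Otimes>\<^sub>M \<mu>)"
      by (rule measurable_pair_measure_countable1) auto
    moreover have "sets (count_space UNIV \<Otimes>\<^sub>M \<mu>) = sets (measure_pmf ?P \<Otimes>\<^sub>M \<mu>)"
      by (rule sets_pair_measure_cong) auto
    ultimately show ?thesis by (simp cong: measurable_cong_sets)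
  qed
  show "\<mu> = ?R"
  proof (rule measure_eqI)
    show "sets \<mu> = sets ?R" using \<open>sets \<mu> = sets borel\<close> by simp
    fix B assume "B \<in> sets \<mu>"
    then have [measurable]: "B \<in> sets borel" by (simp add: \<open>sets \<mu> = sets borel\<close>)
    have sp: "space \<mu> = UNIV" using sets_eq_imp_space_eq[OF \<open>sets \<mu> = sets borel\<close>] by simp
    have "emeasure ?R B = emeasure (measure_pmf ?P \<Otimes>\<^sub>M \<mu>) ((\<lambda>(j, x). ifs_map \<theta> a j x) -` B \<inter> space (measure_pmf ?P \<Otimes>\<^sub>M \<mu>))"
      by (rule emeasure_distr) measurable
    also have "\<dots> = (\<integral>\<^sup>+j. emeasure \<mu> (Pair j -` ((\<lambda>(j, x). ifs_map \<theta> a j x) -` B \<inter> space (measure_pmf ?P \<Otimes>\<^sub>M \<mu>))) \<partial>measure_pmf ?P)"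
      by (rule emeasure_pair_measure_alt) measurable
    also have "\<dots> = (\<integral>\<^sup>+j. emeasure (distr \<mu> borel (ifs_map \<theta> a j)) B \<partial>measure_pmf ?P)"
      by (intro nn_integral_cong) (auto simp: emeasure_distr space_pair_measure sp intro!: arg_cong[where f = "emeasure \<mu>"])
    also have "\<dots> = (\<Sum>j=1..m. emeasure (distr \<mu> borel (ifs_map \<theta> a j)) B * ennreal (pmf ?P j))"
      using set_digit_pmf[OF p] by (intro nn_integral_measure_pmf_support) auto
    also have "\<dots> = emeasure \<mu> B"
      using \<mu> by (simp add: is_self_affine_measure_def pmf_digit_pmf[OF p] mult.commute)
    finally show "emeasure \<mu> B = emeasure ?R B" ..
  qed
qed

lemma fourier_transform_self_affine:
  assumes p: "prob_vector m p" and \<mu>: "is_self_affine_measure \<theta> m a p \<mu>"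
  shows "fourier_transform \<mu> \<xi> = digit_sum m a p \<xi> * fourier_transform \<mu> (contraction_matrix \<theta> *v \<xi>)"
proof -
  let ?P = "digit_pmf m p"
  have [measurable_cong]: "sets \<mu> = sets borel" using \<mu> by (simp add: is_self_affine_measure_def)
  interpret prob_space \<mu> using \<mu> by (simp add: is_self_affine_measure_def)
  interpret pair_prob_space "measure_pmf ?P" \<mu> ..
  note self_affine_measure_eq_distr(2)[OF p \<mu>, measurable]
  let ?e = "\<lambda>x. iexp (- (x \<bullet> \<xi>))"
  have "fourier_transform \<mu> \<xi> = (\<integral>x. ?e x \<partial>distr (measure_pmf ?P \<Otimes>\<^sub>M \<mu>) borel (\<lambda>(j, x). ifs_map \<theta> a j x))"
    unfolding fourier_transform_def by (subst self_affine_measure_eq_distr(1)[OF p \<mu>]) (rule refl)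
  also have "\<dots> = (\<integral>z. ?e ((\<lambda>(j, x). ifs_map \<theta> a j x) z) \<partial>(measure_pmf ?P \<Otimes>\<^sub>M \<mu>))"
    by (rule integral_distr) measurable
  also have "\<dots> = (\<integral>j. \<integral>x. ?e (ifs_map \<theta> a j x) \<partial>\<mu> \<partial>measure_pmf ?P)"
    by (subst integral_fst'[symmetric]) (auto intro!: P.integrable_const_bound[where B = 1])
  also have "\<dots> = (\<Sum>j=1..m. pmf ?P j *\<^sub>R (\<integral>x. ?e (ifs_map \<theta> a j x) \<partial>\<mu>))"
    using set_digit_pmf[OF p] by (intro integral_measure_pmf) auto
  also have "\<dots> = (\<Sum>j=1..m. of_real (p j) * ?e (a j) * fourier_transform \<mu> (contraction_matrix \<theta> *v \<xi>))"
  proof (rule sum.cong[OF refl])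
    fix j assume "j \<in> {1..m}"
    have "?e (ifs_map \<theta> a j x) = ?e (a j) * iexp (- (x \<bullet> (contraction_matrix \<theta> *v \<xi>)))" for x
      by (simp add: ifs_map_def inner_add_left contraction_matrix_inner algebra_simps exp_diff exp_minus field_simps)
    then show "pmf ?P j *\<^sub>R (\<integral>x. ?e (ifs_map \<theta> a j x) \<partial>\<mu>)
        = of_real (p j) * ?e (a j) * fourier_transform \<mu> (contraction_matrix \<theta> *v \<xi>)"
      using \<open>j \<in> {1..m}\<close> by (simp add: pmf_digit_pmf[OF p] fourier_transform_def scaleR_conv_of_real)
  qed
  finally show ?thesis by (simp add: digit_sum_def sum_distrib_right)
qed

lemma fourier_transform_self_affine_iterate:
  assumes p: "prob_vector m p" and \<mu>: "is_self_affine_measure \<theta> m a p \<mu>"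
  defines "T \<equiv> (*v) (contraction_matrix \<theta>)"
  shows "fourier_transform \<mu> \<xi> = (\<Prod>n<L. digit_sum m a p ((T ^^ n) \<xi>)) * fourier_transform \<mu> ((T ^^ L) \<xi>)"
proof (induction L)
  case (Suc L)
  then show ?case
    using fourier_transform_self_affine[OF p \<mu>, of "(T ^^ L) \<xi>"] by (simp add: T_def)
qed simp

lemma contraction_matrix_funpow_tendsto_0:
  assumes "\<And>i. 1 < \<bar>\<theta> $ i\<bar>"
  shows "(\<lambda>n. (((*v) (contraction_matrix \<theta>)) ^^ n) \<xi>) \<longlonglongrightarrow> 0"
proof (rule vec_tendstoI)
  fix i
  have "(\<lambda>n. \<xi> $ i * inverse (\<theta> $ i) ^ n) \<longlonglongrightarrow> \<xi> $ i * 0"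
    using assms[of i] by (intro tendsto_intros LIMSEQ_power_zero) (simp add: divide_simps flip: abs_inverse)
  then show "(\<lambda>n. (((*v) (contraction_matrix \<theta>)) ^^ n) \<xi> $ i) \<longlonglongrightarrow> 0 $ i"
    by (simp add: contraction_matrix_funpow_nth power_inverse divide_inverse)
qed

text \<open>
  By iteration two transforms differ at \<open>\<xi>\<close> by at most their difference at \<open>A\<^sup>L \<xi>\<close>, and both tend to \<open>1\<close>
  there as \<open>L\<close> grows.
\<close>

lemma fourier_transform_self_affine_unique:
  assumes \<theta>: "\<And>i. 1 < \<bar>\<theta> $ i\<bar>" and p: "prob_vector m p"
    and \<mu>: "is_self_affine_measure \<theta> m a p \<mu>" and \<nu>: "is_self_affine_measure \<theta> m a p \<nu>"
  shows "fourier_transform \<mu> = fourier_transform \<nu>"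
proof
  fix \<xi>
  let ?T = "(*v) (contraction_matrix \<theta>)"
  let ?P = "\<lambda>L. \<Prod>n<L. digit_sum m a p ((?T ^^ n) \<xi>)"
  have lim: "(\<lambda>L. fourier_transform \<kappa> ((?T ^^ L) \<xi>)) \<longlonglongrightarrow> 1" if "is_self_affine_measure \<theta> m a p \<kappa>" for \<kappa>
    using that contraction_matrix_funpow_tendsto_0[OF \<theta>]
    by (intro fourier_transform_tendsto_one) (auto simp: is_self_affine_measure_def)
  have P: "norm (?P L) \<le> 1" for L
    unfolding prod_norm[symmetric] using norm_digit_sum_le_1[OF p] by (intro prod_le_1) auto
  have le: "norm (fourier_transform \<mu> \<xi> - fourier_transform \<nu> \<xi>)
      \<le> norm (fourier_transform \<mu> ((?T ^^ L) \<xi>) - fourier_transform \<nu> ((?T ^^ L) \<xi>))" for L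
  proof -
    have "fourier_transform \<mu> \<xi> - fourier_transform \<nu> \<xi>
        = ?P L * (fourier_transform \<mu> ((?T ^^ L) \<xi>) - fourier_transform \<nu> ((?T ^^ L) \<xi>))"
      unfolding right_diff_distrib fourier_transform_self_affine_iterate[OF p \<mu>, symmetric]
        fourier_transform_self_affine_iterate[OF p \<nu>, symmetric] ..
    then show ?thesis using P[of L] by (simp add: norm_mult mult_left_le_one_le)
  qed
  have "(\<lambda>L. norm (fourier_transform \<mu> ((?T ^^ L) \<xi>) - fourier_transform \<nu> ((?T ^^ L) \<xi>))) \<longlonglongrightarrow> norm (1 - 1 :: complex)"
    by (intro tendsto_intros lim \<mu> \<nu>)
  then have "norm (fourier_transform \<mu> \<xi> - fourier_transform \<nu> \<xi>) \<le> norm (1 - 1 :: complex)"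
    by (rule LIMSEQ_le_const) (use le in auto)
  then show "fourier_transform \<mu> \<xi> = fourier_transform \<nu> \<xi>" by simp
qed

text \<open>
  The law of the random series \<open>\<Sum>n. A\<^sup>n (a (\<omega> n))\<close> with independent digits: prepending a digit \<open>j\<close> to
  \<open>\<omega>\<close> applies the map \<open>x \<mapsto> A x + a j\<close> to the sum.
\<close>

lemma self_affine_measure_exists:
  fixes \<theta> :: "real ^ 'd" and a :: "nat \<Rightarrow> real ^ 'd"
  assumes \<theta>: "\<And>i. 1 < \<bar>\<theta> $ i\<bar>" and p: "prob_vector m p"
  shows "\<exists>\<mu>. is_self_affine_measure \<theta> m a p \<mu>"
proof
  let ?P = "measure_pmf (digit_pmf m p)" and ?T = "(*v) (contraction_matrix \<theta>)"
  let ?S = "stream_space ?P"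
  \<comment> \<open>Digits outside the index range are set to \<open>0\<close>, so that the series converges for every \<open>\<omega>\<close>.\<close>
  define a' where "a' j = (if j \<in> {1..m} then a j else 0)" for j
  define X where "X \<omega> = (\<Sum>n. (?T ^^ n) (a' (\<omega> !! n)))" for \<omega>
  define C where "C = (\<Sum>j=1..m. norm (a j))"
  have C: "\<bar>a' j $ i\<bar> \<le> C" for j i
  proof -
    have "norm (a' j) \<le> C"
      using member_le_sum[of j "{1..m}" "\<lambda>j. norm (a j)"] by (auto simp: a'_def C_def sum_nonneg)
    then show ?thesis using component_le_norm_cart[of "a' j" i] by linarith
  qed
  have summable: "summable (\<lambda>n. (?T ^^ n) (a' (\<omega> !! n)))" for \<omega>
  proof (rule summable_comparison_test')
    show "norm ((?T ^^ n) (a' (\<omega> !! n))) \<le> (\<Sum>i\<in>UNIV. C * (1 / \<bar>\<theta> $ i\<bar>) ^ n)" for n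
    proof -
      have "norm ((?T ^^ n) (a' (\<omega> !! n))) \<le> (\<Sum>i\<in>UNIV. \<bar>(?T ^^ n) (a' (\<omega> !! n)) $ i\<bar>)" by (rule norm_le_l1_cart)
      also have "\<dots> \<le> (\<Sum>i\<in>UNIV. C * (1 / \<bar>\<theta> $ i\<bar>) ^ n)"
        using C by (intro sum_mono) (simp add: contraction_matrix_funpow_nth power_abs power_divide divide_right_mono)
      finally show ?thesis .
    qed
    have "norm (1 / \<bar>\<theta> $ i\<bar>) < 1" for i using \<theta>[of i] by simp
    then show "summable (\<lambda>n. \<Sum>i\<in>UNIV. C * (1 / \<bar>\<theta> $ i\<bar>) ^ n)"
      by (intro summable_sum summable_mult summable_geometric)
  qed
  have X_Cons: "X (j ## \<omega>) = contraction_matrix \<theta> *v X \<omega> + a' j" for j \<omega>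
  proof -
    have "(\<Sum>n. (?T ^^ Suc n) (a' (\<omega> !! n))) = ?T (X \<omega>)"
      unfolding X_def 
      using bounded_linear.suminf[OF matrix_vector_mul_bounded_linear[of "contraction_matrix \<theta>"] summable, of \<omega>] by simp
    then show ?thesis
      using suminf_split_head[OF summable, of "j ## \<omega>"] by (simp add: X_def)
  qed
  have [measurable]: "X \<in> borel_measurable ?S"
    unfolding X_def by measurable
  have sp: "space ?S = UNIV" by (simp add: space_stream_space)
  let ?\<mu> = "distr ?S borel X"
  interpret S: prob_space ?S by (rule prob_space.prob_space_stream_space[OF measure_pmf.prob_space_axioms])
  have eq: "emeasure ?\<mu> B = (\<Sum>j=1..m. ennreal (p j) * emeasure (distr ?\<mu> borel (ifs_map \<theta> a j)) B)"
    if [measurable]: "B \<in> sets borel" for B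
  proof -
    have "emeasure ?\<mu> B = emeasure ?S (X -` B \<inter> space ?S)" by (rule emeasure_distr) measurable
    also have "\<dots> = (\<integral>\<^sup>+j. emeasure ?S {\<omega> \<in> space ?S. j ## \<omega> \<in> X -` B \<inter> space ?S} \<partial>?P)"
      by (rule prob_space.emeasure_stream_space[OF measure_pmf.prob_space_axioms]) measurable
    also have "\<dots> = (\<Sum>j=1..m. emeasure ?S {\<omega> \<in> space ?S. j ## \<omega> \<in> X -` B \<inter> space ?S} * ennreal (pmf (digit_pmf m p) j))"
      using set_digit_pmf[OF p] by (intro nn_integral_measure_pmf_support) auto
    also have "\<dots> = (\<Sum>j=1..m. ennreal (p j) * emeasure (distr ?\<mu> borel (ifs_map \<theta> a j)) B)"
    proof (rule sum.cong[OF refl])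
      fix j assume j: "j \<in> {1..m}"
      have "emeasure (distr ?\<mu> borel (ifs_map \<theta> a j)) B = emeasure ?S ((ifs_map \<theta> a j \<circ> X) -` B \<inter> space ?S)"
        by (subst distr_distr) (auto simp: emeasure_distr)
      also have "(ifs_map \<theta> a j \<circ> X) -` B \<inter> space ?S = {\<omega> \<in> space ?S. j ## \<omega> \<in> X -` B \<inter> space ?S}"
        using j by (auto simp: X_Cons ifs_map_def a'_def sp)
      finally show "emeasure ?S {\<omega> \<in> space ?S. j ## \<omega> \<in> X -` B \<inter> space ?S} * ennreal (pmf (digit_pmf m p) j)
          = ennreal (p j) * emeasure (distr ?\<mu> borel (ifs_map \<theta> a j)) B"
        using j by (simp add: pmf_digit_pmf[OF p] mult.commute)
    qed
    finally show ?thesis .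
  qed
  show "is_self_affine_measure \<theta> m a p ?\<mu>"
    unfolding is_self_affine_measure_def using eq S.prob_space_distr[of X borel] by auto
qed

text \<open>
  The decay makes every self-affine measure the density given by Fourier inversion. As the transform
  is unique, so is the measure, and the definite description picks it.
\<close>

lemma self_affine_measure_C_k_density:
  fixes \<theta> :: "real ^ 'd" and a :: "nat \<Rightarrow> real ^ 'd"
  assumes \<theta>: "\<And>i. 1 < \<bar>\<theta> $ i\<bar>" and p: "prob_vector m p"
    and decay: "\<And>\<xi>. \<exists>L. (\<Prod>n<L. norm (digit_sum m a p ((((*v) (contraction_matrix \<theta>)) ^^ n) \<xi>)))
      * (1 + norm \<xi>) ^ (k + 2 * CARD('d)) \<le> C"
  shows "abs_cont_with_C_k_density k (self_affine_measure \<theta> m a p)"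
proof -
  have bound: "norm (fourier_transform \<mu> \<xi>) * (1 + norm \<xi>) ^ (k + 2 * CARD('d)) \<le> C"
    if \<mu>: "is_self_affine_measure \<theta> m a p \<mu>" for \<mu> \<xi>
  proof -
    obtain L where L: "(\<Prod>n<L. norm (digit_sum m a p ((((*v) (contraction_matrix \<theta>)) ^^ n) \<xi>)))
      * (1 + norm \<xi>) ^ (k + 2 * CARD('d)) \<le> C" using decay by blast
    have "norm (fourier_transform \<mu> \<xi>) \<le> (\<Prod>n<L. norm (digit_sum m a p ((((*v) (contraction_matrix \<theta>)) ^^ n) \<xi>)))"
      using \<mu> by (subst fourier_transform_self_affine_iterate[OF p \<mu>, of \<xi> L])
        (auto simp: norm_mult prod_norm is_self_affine_measure_def intro!: mult_left_le norm_fourier_transform_le_1)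
    then show ?thesis
      by (rule order_trans[OF mult_right_mono L]) simp
  qed
  obtain \<mu> where \<mu>: "is_self_affine_measure \<theta> m a p \<mu>" using self_affine_measure_exists[OF \<theta> p] by blast
  have dens: "\<nu> = density lborel (\<lambda>x. ennreal (fourier_inverse (fourier_transform \<nu>) x))"
    if "is_self_affine_measure \<theta> m a p \<nu>" for \<nu>
    using that bound[OF that] by (intro fourier_decay_imp_density) (auto simp: is_self_affine_measure_def)
  have "\<nu> = \<mu>" if \<nu>: "is_self_affine_measure \<theta> m a p \<nu>" for \<nu>
    using dens[OF \<mu>] dens[OF \<nu>] fourier_transform_self_affine_unique[OF \<theta> p \<mu> \<nu>] by simp
  then have "self_affine_measure \<theta> m a p = \<mu>"
    unfolding self_affine_measure_def using \<mu> by (intro the_equality)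
  moreover have "abs_cont_with_C_k_density k \<mu>"
    using \<mu> bound[OF \<mu>] by (intro fourier_decay_imp_C_k_density) (auto simp: is_self_affine_measure_def)
  ultimately show ?thesis by simp
qed

section \<open>Counting nearest-integer sequences\<close>

lemma card_int_ball:
  fixes P r :: real
  assumes "0 \<le> r"
  shows "finite {k::int. \<bar>real_of_int k - P\<bar> \<le> r}"
    and "real (card {k::int. \<bar>real_of_int k - P\<bar> \<le> r}) \<le> 2 * r + 1"
proof -
  have eq: "{k::int. \<bar>real_of_int k - P\<bar> \<le> r} = {\<lceil>P - r\<rceil>..\<lfloor>P + r\<rfloor>}"
    by (auto simp: abs_le_iff ceiling_le_iff le_floor_iff)
  show "finite {k::int. \<bar>real_of_int k - P\<bar> \<le> r}" unfolding eq by simp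
  have "real_of_int (\<lfloor>P + r\<rfloor> - \<lceil>P - r\<rceil> + 1) \<le> 2 * r + 1" by linarith
  then show "real (card {k::int. \<bar>real_of_int k - P\<bar> \<le> r}) \<le> 2 * r + 1"
    unfolding eq using assms by simp
qed

text \<open>
  Think of a tree of words in which an unmarked extension is unique (\<open>G\<close>) and a marked one has at
  most \<open>H\<close> choices (\<open>F\<close>); \<open>X N m\<close> collects words of length \<open>N\<close> with at most \<open>m\<close> marks. Giving weight
  \<open>x\<close> to each mark multiplies the total weight by at most \<open>1 + H x\<close> per step. A small \<open>x\<close> thus
  bounds the number of words with few marks without any estimate of binomial coefficients.
\<close>

lemma weighted_tree_count:
  fixes X :: "nat \<Rightarrow> nat \<Rightarrow> 'a list set" and F G :: "'a list \<Rightarrow> 'a set" and x H :: real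
  assumes init: "\<And>m. finite (X n0 m)" "\<And>m. card (X n0 m) \<le> c0"
    and step0: "\<And>N. n0 \<le> N \<Longrightarrow> X (Suc N) 0 \<subseteq> (\<Union>ks\<in>X N 0. (\<lambda>k. ks @ [k]) ` G ks)"
    and step: "\<And>N m. n0 \<le> N \<Longrightarrow> X (Suc N) (Suc m) \<subseteq>
      (\<Union>ks\<in>X N (Suc m). (\<lambda>k. ks @ [k]) ` G ks) \<union> (\<Union>ks\<in>X N m. (\<lambda>k. ks @ [k]) ` F ks)"
    and G: "\<And>ks. finite (G ks)" "\<And>ks. card (G ks) \<le> 1"
    and F: "\<And>ks. finite (F ks)" "\<And>ks. real (card (F ks)) \<le> H"
    and x: "0 < x" "x \<le> 1" and "n0 \<le> N"
  shows "finite (X N m) \<and> real (card (X N m)) * x ^ m \<le> real c0 * (1 + H * x) ^ (N - n0)"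
  using \<open>n0 \<le> N\<close>
proof (induction N arbitrary: m rule: dec_induct)
  case base
  have "real (card (X n0 m)) * x ^ m \<le> real c0 * 1"
    using init(2)[of m] x by (intro mult_mono) (auto simp: power_le_one)
  then show ?case using init(1) by simp
next
  case (step N)
  have H0: "0 \<le> H" using F(2)[of undefined] by linarith
  have cardG: "card (\<Union>ks\<in>Y. (\<lambda>k. ks @ [k]) ` G ks) \<le> card Y" if "finite Y" for Y
  proof -
    have "card (\<Union>ks\<in>Y. (\<lambda>k. ks @ [k]) ` G ks) \<le> (\<Sum>ks\<in>Y. card ((\<lambda>k. ks @ [k]) ` G ks))"
      by (rule card_UN_le[OF that])
    also have "\<dots> \<le> (\<Sum>ks\<in>Y. 1)"
      by (rule sum_mono) (meson G card_image_le le_trans)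
    finally show ?thesis by simp
  qed
  have cardF: "real (card (\<Union>ks\<in>Y. (\<lambda>k. ks @ [k]) ` F ks)) \<le> H * card Y" if "finite Y" for Y
  proof -
    have "real (card (\<Union>ks\<in>Y. (\<lambda>k. ks @ [k]) ` F ks)) \<le> real (\<Sum>ks\<in>Y. card ((\<lambda>k. ks @ [k]) ` F ks))"
      using card_UN_le[OF that] of_nat_le_iff by blast
    also have "\<dots> \<le> (\<Sum>ks\<in>Y. H)"
      unfolding of_nat_sum
      by (rule sum_mono) (use F in \<open>auto intro: order_trans[OF of_nat_mono[OF card_image_le]]\<close>)
    finally show ?thesis by (simp add: mult.commute)
  qed
  have pow: "(1 + H * x) ^ (Suc N - n0) = (1 + H * x) ^ (N - n0) + H * x * (1 + H * x) ^ (N - n0)"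
    using step.hyps by (simp add: Suc_diff_le algebra_simps)
  show ?case
  proof (cases m)
    case 0
    have fin: "finite (\<Union>ks\<in>X N 0. (\<lambda>k. ks @ [k]) ` G ks)" using step.IH G by auto
    have "card (X (Suc N) 0) \<le> card (X N 0)"
      using card_mono[OF fin step0[OF step.hyps(1)]] cardG[of "X N 0"] step.IH by fastforce
    moreover have "real c0 * (1 + H * x) ^ (N - n0) \<le> real c0 * (1 + H * x) ^ (Suc N - n0)"
      unfolding pow using H0 x by (intro mult_left_mono) auto
    ultimately show ?thesis
      using step.IH[of 0] 0 finite_subset[OF step0[OF step.hyps(1)] fin] by simp
  next
    case (Suc m')
    let ?U = "\<Union>ks\<in>X N (Suc m'). (\<lambda>k. ks @ [k]) ` G ks" and ?V = "\<Union>ks\<in>X N m'. (\<lambda>k. ks @ [k]) ` F ks"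
    have fin: "finite (?U \<union> ?V)" using step.IH G F by auto
    note sub = assms(4)[OF step.hyps(1), of m']
    have "card (X (Suc N) m) \<le> card ?U + card ?V"
      using card_mono[OF fin sub] card_Un_le[of ?U ?V] Suc by simp
    then have "real (card (X (Suc N) m)) \<le> real (card ?U) + real (card ?V)" by linarith
    also have "\<dots> \<le> real (card (X N (Suc m'))) + H * real (card (X N m'))"
      using cardG[of "X N (Suc m')"] cardF[of "X N m'"] step.IH by fastforce
    finally have "real (card (X (Suc N) m)) * x ^ m
        \<le> (real (card (X N (Suc m'))) + H * real (card (X N m'))) * x ^ m"
      using x by (intro mult_right_mono) auto
    also have "\<dots> = real (card (X N (Suc m'))) * x ^ Suc m' + H * x * (real (card (X N m')) * x ^ m')"
      by (simp add: Suc algebra_simps)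
    also have "\<dots> \<le> real c0 * (1 + H * x) ^ (N - n0) + H * x * (real c0 * (1 + H * x) ^ (N - n0))"
      using step.IH[of "Suc m'"] step.IH[of m'] H0 x by (intro add_mono mult_left_mono) auto
    also have "\<dots> = real c0 * (1 + H * x) ^ (Suc N - n0)"
      unfolding pow by (simp add: algebra_simps)
    finally show ?thesis using finite_subset[OF sub fin] Suc by simp
  qed
qed

text \<open>
  The exact terms satisfy \<open>z2 = z1\<^sup>2 / z0\<close>; so approximations of two consecutive terms predict the
  next one and the ratio, with an error proportional to \<open>e\<close>.
\<close>

lemma geometric_prediction:
  fixes z0 z1 z2 Z0 Z1 Z2 \<tau> b e E :: real
  assumes err: "\<bar>z0 - Z0\<bar> \<le> e" "\<bar>z1 - Z1\<bar> \<le> e" 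
    and z: "z1 = \<tau> * z0" and \<tau>: "\<bar>\<tau>\<bar> \<le> b" and Z0: "1 \<le> \<bar>Z0\<bar>" 
  shows geometric_ratio_error: "\<bar>\<tau> - Z1 / Z0\<bar> \<le> (1 + b) * e / \<bar>Z0\<bar>"
    and "\<bar>z2 - Z2\<bar> \<le> e \<Longrightarrow> z2 = \<tau> * z1 \<Longrightarrow> e \<le> E \<Longrightarrow> \<bar>Z2 - Z1\<^sup>2 / Z0\<bar> \<le> (1 + b)\<^sup>2 * (1 + E) * e"
proof -
  have step: "\<bar>w' - \<tau> * w\<bar> \<le> (1 + b) * e" if "\<bar>u - w\<bar> \<le> e" "\<bar>\<tau> * u - w'\<bar> \<le> e" for u w w'
  proof -
    have "\<bar>\<tau> * (u - w)\<bar> \<le> b * e" unfolding abs_mult using that \<tau> by (intro mult_mono) auto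
    moreover have "w' - \<tau> * w = (w' - \<tau> * u) + \<tau> * (u - w)" by (simp add: algebra_simps)
    ultimately show ?thesis using that by (simp add: algebra_simps)
  qed
  have e0: "0 \<le> e" and b0: "0 \<le> b" using err \<tau> by auto
  have 1: "\<bar>Z1 - \<tau> * Z0\<bar> \<le> (1 + b) * e" using step[of z0 Z0 Z1] err z by simp
  have "\<bar>\<tau> - Z1 / Z0\<bar> = \<bar>Z1 - \<tau> * Z0\<bar> / \<bar>Z0\<bar>"
    using Z0 by (subst abs_divide[symmetric]) (auto simp: field_simps abs_minus_commute)
  then show ratio: "\<bar>\<tau> - Z1 / Z0\<bar> \<le> (1 + b) * e / \<bar>Z0\<bar>"
    using 1 by (simp add: divide_right_mono)
  assume "\<bar>z2 - Z2\<bar> \<le> e" and z2: "z2 = \<tau> * z1" and E: "e \<le> E"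
  then have 2: "\<bar>Z2 - \<tau> * Z1\<bar> \<le> (1 + b) * e" using step[of z1 Z1 Z2] err by simp
  have "(1 + b) * e / \<bar>Z0\<bar> \<le> (1 + b) * E"
    using Z0 e0 b0 E by (intro order_trans[OF divide_left_mono[of 1 "\<bar>Z0\<bar>"]]) (auto intro: mult_left_mono)
  then have q: "\<bar>Z1 / Z0\<bar> \<le> b + (1 + b) * E" using ratio \<tau> by linarith
  have "Z2 - Z1\<^sup>2 / Z0 = (Z2 - \<tau> * Z1) - Z1 / Z0 * (Z1 - \<tau> * Z0)"
    using Z0 by (auto simp: field_simps power2_eq_square)
  also have "\<bar>\<dots>\<bar> \<le> \<bar>Z2 - \<tau> * Z1\<bar> + \<bar>Z1 / Z0\<bar> * \<bar>Z1 - \<tau> * Z0\<bar>"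
    by (metis abs_mult abs_triangle_ineq4)
  also have "\<dots> \<le> (1 + b) * e + (b + (1 + b) * E) * ((1 + b) * e)"
    using 1 2 q b0 e0 order_trans[OF abs_ge_zero q] by (intro add_mono mult_mono) auto
  also have "\<dots> = (1 + b)\<^sup>2 * (1 + E) * e" by (simp add: power2_eq_square algebra_simps)
  finally show "\<bar>Z2 - Z1\<^sup>2 / Z0\<bar> \<le> (1 + b)\<^sup>2 * (1 + E) * e" .
qed

text \<open>
  The polynomial \<open>Q\<close> evaluated at the shift operator.
\<close>

definition recurrence_op :: "real poly \<Rightarrow> (nat \<Rightarrow> real) \<Rightarrow> nat \<Rightarrow> real" where
  "recurrence_op Q y n = (\<Sum>l\<le>degree Q. coeff Q l * y (n + l))"

text \<open>
  Pairs of a ratio \<open>\<tau>\<close> and a sequence \<open>y\<close> that \<open>Q\<close> maps to a geometric sequence with ratio \<open>\<tau>\<close> and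
  initial term of size at least \<open>a\<close>. The growth bound with \<open>M\<close> leaves finitely many
  possibilities for any initial segment of the rounded sequence.
\<close>

definition geometric_samples ::
  "real poly \<Rightarrow> real \<Rightarrow> real \<Rightarrow> real \<Rightarrow> real \<Rightarrow> (real \<times> (nat \<Rightarrow> real)) set" where
  "geometric_samples Q a M b1 b2 = {(\<tau>, y). b1 \<le> \<bar>\<tau>\<bar> \<and> \<bar>\<tau>\<bar> \<le> b2 \<and>
     (\<forall>n. \<bar>y n\<bar> \<le> M * b2 ^ n) \<and> (\<exists>c. a \<le> \<bar>c\<bar> \<and> (\<forall>n. recurrence_op Q y n = c * \<tau> ^ n))}"

lemma recurrence_op_error:
  assumes "\<And>l. l \<le> degree Q \<Longrightarrow> \<bar>y (n + l) - y' (n + l)\<bar> \<le> \<delta>" "(\<Sum>l\<le>degree Q. \<bar>coeff Q l\<bar>) \<le> B"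
  shows "\<bar>recurrence_op Q y n - recurrence_op Q y' n\<bar> \<le> B * \<delta>"
proof -
  have d0: "0 \<le> \<delta>" using assms(1)[of 0] by force
  have "\<bar>recurrence_op Q y n - recurrence_op Q y' n\<bar> = \<bar>\<Sum>l\<le>degree Q. coeff Q l * (y (n + l) - y' (n + l))\<bar>"
    by (simp add: recurrence_op_def sum_subtractf right_diff_distrib)
  also have "\<dots> \<le> (\<Sum>l\<le>degree Q. \<bar>coeff Q l\<bar> * \<delta>)"
    using assms(1) by (intro order_trans[OF sum_abs] sum_mono) (auto simp: abs_mult intro!: mult_left_mono)
  also have "\<dots> \<le> B * \<delta>"
    using assms(2) d0 by (simp flip: sum_distrib_right add: mult_right_mono)
  finally show ?thesis .
qed

text \<open>
  The nearest integers \<open>K n\<close> of \<open>y n\<close> form a word. Applying \<open>Q\<close> to them approximates a geometric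
  sequence, and since \<open>Q\<close> is monic the newest integer enters with coefficient \<open>1\<close>: it lies within
  \<open>C \<delta>\<close> of a number \<open>P\<close> computed from the preceding ones, where \<open>\<delta>\<close> bounds the last \<open>D + 3\<close> rounding
  errors. The threshold \<open>\<rho>\<close> makes \<open>C \<rho> = 1 / 4\<close>, which leaves one candidate; in general \<open>\<delta> = 1 / 2\<close>
  leaves at most \<open>C + 1\<close>. One large rounding error marks at most \<open>D + 3\<close> steps, whence the factor in
  the hypothesis on \<open>m\<close>. Finally the word determines \<open>\<tau>\<close> up to the error of the ratio of the last
  two terms.
\<close>

lemma rounded_samples_determine_ratio:
  fixes Q :: "real poly" and a M b1 b2 B x :: real
  defines "D \<equiv> degree Q" and "C \<equiv> (1 + b2)\<^sup>2 * (1 + B / 2) * B"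
  defines "\<rho> \<equiv> 1 / (4 * C)"
  assumes b: "1 < b1" "b1 \<le> b2" and Q: "lead_coeff Q = 1" "(\<Sum>l\<le>degree Q. \<bar>coeff Q l\<bar>) \<le> B"
    and "1 \<le> B" "0 < a" and x: "0 < x" "x \<le> 1"
  shows "\<exists>c0 n0. 0 \<le> c0 \<and> (\<forall>N\<ge>n0. \<forall>m. \<exists>T. finite T \<and>
    real (card T) * x ^ m \<le> c0 * (1 + (C + 1) * x) ^ N \<and>
    (\<forall>(\<tau>, y)\<in>geometric_samples Q a M b1 b2.
      card {n. n < N \<and> \<rho> < \<bar>y n - round (y n)\<bar>} * (D + 3) \<le> m \<longrightarrow>
      (\<exists>t\<in>T. \<bar>\<tau> - t\<bar> \<le> B * (1 + b2) / (a * b1 ^ (N - D - 2)))))"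
proof -
  have C1: "1 \<le> C"
  proof -
    have "1 * 1 * 1 \<le> (1 + b2)\<^sup>2 * (1 + B / 2) * B"
      using b \<open>1 \<le> B\<close> by (intro mult_mono) auto
    then show ?thesis by (simp add: C_def)
  qed
  have \<rho>: "0 < \<rho>" "\<rho> \<le> 1 / 2" "C * \<rho> = 1 / 4" using C1 by (auto simp: \<rho>_def field_simps)
  \<comment> \<open>from index \<open>n1\<close> on, the rounded terms are at least \<open>1\<close> and at least half of \<open>a * b1 ^ n\<close>\<close>
  obtain n1 where n1: "2 * B + 2 < a * b1 ^ n1"
    using real_arch_pow[OF b(1), of "(2 * B + 2) / a"] \<open>0 < a\<close> by (auto simp: field_simps)
  define n0 where "n0 = n1 + D + 2"
  define K where "K = (\<lambda>(y::nat \<Rightarrow> real) n. round (y n))"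
  define S where "S = (\<lambda>y N. map (K y) [0..<N])"
  define Z where "Z = (\<lambda>(ks::int list) n. \<Sum>l\<le>D. coeff Q l * real_of_int (ks ! (n + l)))"
  define P where "P = (\<lambda>ks. (Z ks (length ks - D - 1))\<^sup>2 / Z ks (length ks - D - 2)
      - (\<Sum>l<D. coeff Q l * real_of_int (ks ! (length ks - D + l))))"
  \<comment> \<open>steps at which some error in the window that enters the prediction is large\<close>
  define marks where "marks = (\<lambda>(y :: nat \<Rightarrow> real) N. {n\<in>{n0..<N}. \<exists>l\<le>D + 2. \<rho> < \<bar>y (n - l) - round (y (n - l))\<bar>})"
  define X where "X = (\<lambda>N m. {S y N |y. \<exists>\<tau>. (\<tau>, y) \<in> geometric_samples Q a M b1 b2 \<and> card (marks y N) \<le> m})"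
  define G where "G = (\<lambda>ks. {k::int. \<bar>real_of_int k - P ks\<bar> \<le> C * \<rho>})"
  define F where "F = (\<lambda>ks. {k::int. \<bar>real_of_int k - P ks\<bar> \<le> C / 2})"

  have lenS [simp]: "length (S y N) = N" for y N by (simp add: S_def)
  have nthS: "S y N ! n = K y n" if "n < N" for y N n using that by (simp add: S_def)
  have S_Suc: "S y (Suc N) = S y N @ [K y N]" for y N by (simp add: S_def)
  have Z_S: "Z (S y N) n = recurrence_op Q (\<lambda>n. real_of_int (K y n)) n" if "n + D < N" for y N n
    using that by (simp add: Z_def recurrence_op_def nthS D_def)
  have half: "\<bar>y n - real_of_int (K y n)\<bar> \<le> 1 / 2" for y n
    using of_int_round_abs_le[of "y n"] by (simp add: K_def abs_minus_commute)

  have close: "\<bar>recurrence_op Q y n - Z (S y N) n\<bar> \<le> B * \<delta>"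
    if "n + D < N" "\<And>l. l \<le> D \<Longrightarrow> \<bar>y (n + l) - real_of_int (K y (n + l))\<bar> \<le> \<delta>" for y n N \<delta>
    using recurrence_op_error[OF _ Q(2), of y n "\<lambda>n. real_of_int (K y n)" \<delta>] that by (simp add: Z_S D_def)

  have big: "1 \<le> \<bar>Z (S y N) n\<bar>" "a * b1 ^ n / 2 \<le> \<bar>Z (S y N) n\<bar>"
    if y: "(\<tau>, y) \<in> geometric_samples Q a M b1 b2" and n: "n1 \<le> n" "n + D < N" for \<tau> y n N
  proof -
    obtain c where c: "a \<le> \<bar>c\<bar>" "\<And>n. recurrence_op Q y n = c * \<tau> ^ n" and \<tau>: "b1 \<le> \<bar>\<tau>\<bar>"
      using y by (auto simp: geometric_samples_def)
    have 1: "a * b1 ^ n \<le> \<bar>recurrence_op Q y n\<bar>"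
      unfolding c(2) abs_mult power_abs using c(1) \<tau> b \<open>0 < a\<close> by (intro mult_mono power_mono) auto
    have 2: "2 * B + 2 \<le> a * b1 ^ n"
      using n1 mult_left_mono[OF power_increasing[OF n(1), of b1], of a] b \<open>0 < a\<close> by linarith
    have 3: "\<bar>recurrence_op Q y n - Z (S y N) n\<bar> \<le> B * (1 / 2)"
      using close[OF n(2)] half by blast
    show "1 \<le> \<bar>Z (S y N) n\<bar>" "a * b1 ^ n / 2 \<le> \<bar>Z (S y N) n\<bar>"
      using 1 2 3 \<open>1 \<le> B\<close> by linarith+
  qed

  have predict: "\<bar>real_of_int (K y N) - P (S y N)\<bar> \<le> C * \<delta>"
    if y: "(\<tau>, y) \<in> geometric_samples Q a M b1 b2" and N: "n0 \<le> N" and "\<delta> \<le> 1 / 2"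
      and \<delta>: "\<And>l. l \<le> D + 2 \<Longrightarrow> \<bar>y (N - l) - real_of_int (K y (N - l))\<bar> \<le> \<delta>" for \<tau> y N \<delta>
  proof -
    define n where "n = N - D - 2"
    have n: "N = n + D + 2" "n1 \<le> n" using N by (auto simp: n_def n0_def)
    obtain c where c: "\<And>n. recurrence_op Q y n = c * \<tau> ^ n" and \<tau>: "\<bar>\<tau>\<bar> \<le> b2"
      using y by (auto simp: geometric_samples_def)
    have cl: "\<bar>recurrence_op Q y k - Z (S y (Suc N)) k\<bar> \<le> B * \<delta>" if "n \<le> k" "k \<le> n + 2" for k
    proof (rule close)
      show "k + D < Suc N" using that n by simp
      show "\<bar>y (k + l) - real_of_int (K y (k + l))\<bar> \<le> \<delta>" if "l \<le> D" for l
        using \<delta>[of "N - (k + l)"] that \<open>n \<le> k\<close> \<open>k \<le> n + 2\<close> n by simp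
    qed
    have Zeq: "Z (S y (Suc N)) k = Z (S y N) k" if "k + D < N" for k
      using that by (simp add: Z_S)
    have "\<bar>Z (S y (Suc N)) (n + 2) - (Z (S y (Suc N)) (n + 1))\<^sup>2 / Z (S y (Suc N)) n\<bar>
        \<le> (1 + b2)\<^sup>2 * (1 + B / 2) * (B * \<delta>)"
    proof (rule geometric_prediction(2))
      show "1 \<le> \<bar>Z (S y (Suc N)) n\<bar>" using big(1)[OF y n(2), of "Suc N"] n by simp
      show "B * \<delta> \<le> B / 2" using mult_left_mono[OF \<open>\<delta> \<le> 1 / 2\<close>, of B] \<open>1 \<le> B\<close> by simp
    qed (use cl[of n] cl[of "n + 1"] cl[of "n + 2"] \<tau> c in \<open>auto simp: algebra_simps\<close>)
    moreover have "Z (S y (Suc N)) (n + 2) = (\<Sum>l<D. coeff Q l * real_of_int (K y (N - D + l))) + real_of_int (K y N)"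
    proof -
      have "{..D} = insert D {..<D}" by auto
      then have "Z (S y (Suc N)) (n + 2) = (\<Sum>l<D. coeff Q l * real_of_int (K y (n + 2 + l))) + real_of_int (K y (n + 2 + D))"
        using Q(1) n by (simp add: Z_def nthS D_def add.commute)
      then show ?thesis using n by (simp add: add_ac)
    qed
    moreover have "P (S y N) = (Z (S y (Suc N)) (n + 1))\<^sup>2 / Z (S y (Suc N)) n
        - (\<Sum>l<D. coeff Q l * real_of_int (K y (N - D + l)))"
    proof -
      have "Z (S y (Suc N)) (n + 1) = Z (S y N) (n + 1)" "Z (S y (Suc N)) n = Z (S y N) n"
        using Zeq n by auto
      then show ?thesis using n(1) by (simp add: P_def nthS)
    qed
    ultimately show ?thesis by (simp add: C_def algebra_simps)
  qed

  have marks_Suc: "marks y (Suc N) = (if \<exists>l\<le>D + 2. \<rho> < \<bar>y (N - l) - round (y (N - l))\<bar>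
      then insert N (marks y N) else marks y N)" if "n0 \<le> N" for y N
    using that by (auto simp: marks_def less_Suc_eq)
  have fin_marks: "finite (marks y N)" and notin: "N \<notin> marks y N" for y N by (auto simp: marks_def)
  have inG: "S y (Suc N) \<in> (\<lambda>k. S y N @ [k]) ` G (S y N)"
    if "(\<tau>, y) \<in> geometric_samples Q a M b1 b2" "n0 \<le> N"
      "\<not> (\<exists>l\<le>D + 2. \<rho> < \<bar>y (N - l) - round (y (N - l))\<bar>)" for \<tau> N and y :: "nat \<Rightarrow> real"
    using predict[OF that(1,2) \<rho>(2)] that(3) by (fastforce simp: S_Suc G_def K_def not_less)
  have inF: "S y (Suc N) \<in> (\<lambda>k. S y N @ [k]) ` F (S y N)"
    if "(\<tau>, y) \<in> geometric_samples Q a M b1 b2" "n0 \<le> N" for \<tau> y N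
    using predict[OF that(1,2) order_refl half] by (auto simp: S_Suc F_def)

  \<comment> \<open>a finite set that contains all initial words\<close>
  define L where "L = {ks :: int list. set ks \<subseteq> {k. \<bar>real_of_int k - 0\<bar> \<le> \<bar>M\<bar> * b2 ^ n0 + 1} \<and> length ks = n0}"
  have finL: "finite L"
    unfolding L_def using b by (intro finite_lists_length_eq card_int_ball(1)) auto
  have XL: "X n0 m \<subseteq> L" for m
  proof
    fix ks assume "ks \<in> X n0 m"
    then obtain \<tau> y where y: "(\<tau>, y) \<in> geometric_samples Q a M b1 b2" and ks: "ks = S y n0"
      by (auto simp: X_def)
    have "\<bar>real_of_int (K y n)\<bar> \<le> \<bar>M\<bar> * b2 ^ n0 + 1" if "n < n0" for n
    proof -
      have "\<bar>y n\<bar> \<le> M * b2 ^ n" using y by (auto simp: geometric_samples_def)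
      also have "\<dots> \<le> \<bar>M\<bar> * b2 ^ n0"
        using b that by (intro mult_mono power_increasing) auto
      finally show ?thesis using half[of y n] by linarith
    qed
    then show "ks \<in> L" by (auto simp: L_def ks S_def)
  qed

  have count: "finite (X N m) \<and> real (card (X N m)) * x ^ m \<le> real (card L) * (1 + (C + 1) * x) ^ (N - n0)"
    if "n0 \<le> N" for N m
  proof (rule weighted_tree_count[where G = G and F = F])
    show "finite (X n0 m)" "card (X n0 m) \<le> card L" for m
      using finL XL by (auto intro: finite_subset card_mono)
    show "X (Suc N) 0 \<subseteq> (\<Union>ks\<in>X N 0. (\<lambda>k. ks @ [k]) ` G ks)" if "n0 \<le> N" for N
    proof
      fix ks assume "ks \<in> X (Suc N) 0"
      then obtain \<tau> y where y: "(\<tau>, y) \<in> geometric_samples Q a M b1 b2" "card (marks y (Suc N)) = 0"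
        and ks: "ks = S y (Suc N)" by (auto simp: X_def)
      have good: "\<not> (\<exists>l\<le>D + 2. \<rho> < \<bar>y (N - l) - round (y (N - l))\<bar>)" and "card (marks y N) = 0"
        using y(2) fin_marks[of y N] unfolding marks_Suc[OF that] by (auto split: if_splits)
      then have "S y N \<in> X N 0" using y(1) by (auto simp: X_def)
      then show "ks \<in> (\<Union>ks\<in>X N 0. (\<lambda>k. ks @ [k]) ` G ks)"
        using inG[OF y(1) that good] ks by blast
    qed
    show "X (Suc N) (Suc m) \<subseteq> (\<Union>ks\<in>X N (Suc m). (\<lambda>k. ks @ [k]) ` G ks)
        \<union> (\<Union>ks\<in>X N m. (\<lambda>k. ks @ [k]) ` F ks)" if "n0 \<le> N" for N m
    proof
      fix ks assume "ks \<in> X (Suc N) (Suc m)"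
      then obtain \<tau> y where y: "(\<tau>, y) \<in> geometric_samples Q a M b1 b2" "card (marks y (Suc N)) \<le> Suc m"
        and ks: "ks = S y (Suc N)" by (auto simp: X_def)
      show "ks \<in> (\<Union>ks\<in>X N (Suc m). (\<lambda>k. ks @ [k]) ` G ks) \<union> (\<Union>ks\<in>X N m. (\<lambda>k. ks @ [k]) ` F ks)"
      proof (cases "\<exists>l\<le>D + 2. \<rho> < \<bar>y (N - l) - round (y (N - l))\<bar>")
        case True
        then have "card (marks y N) \<le> m"
          using y(2) fin_marks notin by (simp add: marks_Suc[OF that])
        then have "S y N \<in> X N m" using y(1) by (auto simp: X_def)
        then show ?thesis using inF[OF y(1) that] ks by blast
      next
        case False
        then have "card (marks y N) \<le> Suc m" using y(2) by (simp only: marks_Suc[OF that] if_False)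
        then have "S y N \<in> X N (Suc m)" using y(1) by (auto simp: X_def)
        then show ?thesis using inG[OF y(1) that False] ks by blast
      qed
    qed
    show "finite (G ks)" "finite (F ks)" "real (card (F ks)) \<le> C + 1" for ks
      using C1 \<rho> card_int_ball[of "C * \<rho>" "P ks"] card_int_ball[of "C / 2" "P ks"]
      by (auto simp: G_def F_def)
    have "real (card (G ks)) < 2" for ks
      using \<rho> card_int_ball(2)[of "C * \<rho>" "P ks"] by (simp add: G_def)
    then show "card (G ks) \<le> 1" for ks by (metis less_2_cases_iff nat_less_le not_le of_nat_less_iff of_nat_numeral less_one linorder_not_less)
  qed (use x that in auto)

  show ?thesis
  proof (intro exI[of _ "real (card L)"] exI[of _ n0] conjI allI impI)
    fix N m assume N: "n0 \<le> N"
    define T where "T = (\<lambda>ks. Z ks (N - D - 1) / Z ks (N - D - 2)) ` X N m"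
    have "real (card T) * x ^ m \<le> real (card (X N m)) * x ^ m"
      unfolding T_def using x count[OF N] by (intro mult_right_mono) (auto intro: card_image_le)
    also have "\<dots> \<le> real (card L) * (1 + (C + 1) * x) ^ (N - n0)" using count[OF N] by simp
    also have "\<dots> \<le> real (card L) * (1 + (C + 1) * x) ^ N"
      using C1 x by (intro mult_left_mono power_increasing) auto
    finally have card: "real (card T) * x ^ m \<le> real (card L) * (1 + (C + 1) * x) ^ N" .
    have near: "\<exists>t\<in>T. \<bar>\<tau> - t\<bar> \<le> B * (1 + b2) / (a * b1 ^ (N - D - 2))"
      if y: "(\<tau>, y) \<in> geometric_samples Q a M b1 b2"
        and bad: "card {n. n < N \<and> \<rho> < \<bar>y n - round (y n)\<bar>} * (D + 3) \<le> m" for \<tau> y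
    proof -
      define n where "n = N - D - 2"
      have n: "N = n + D + 2" "n1 \<le> n" using N by (auto simp: n_def n0_def)
      let ?bad = "{n. n < N \<and> \<rho> < \<bar>y n - round (y n)\<bar>}"
      have "marks y N \<subseteq> (\<lambda>(j, l). j + l) ` (?bad \<times> {..D + 2})"
      proof
        fix k assume "k \<in> marks y N"
        then obtain l where "l \<le> D + 2" "\<rho> < \<bar>y (k - l) - round (y (k - l))\<bar>" "n0 \<le> k" "k < N"
          by (auto simp: marks_def)
        then have "(k - l, l) \<in> ?bad \<times> {..D + 2}" "k = (\<lambda>(j, l). j + l) (k - l, l)"
          by (auto simp: n0_def)
        then show "k \<in> (\<lambda>(j, l). j + l) ` (?bad \<times> {..D + 2})" by blast
      qed
      then have "card (marks y N) \<le> card (?bad \<times> {..D + 2})"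
        by (rule surj_card_le[rotated]) simp
      also have "\<dots> = card ?bad * (D + 3)" by (simp add: card_cartesian_product algebra_simps)
      also note bad
      finally have "card (marks y N) \<le> m" .
      then have "S y N \<in> X N m" using y by (auto simp: X_def)
      then have inT: "Z (S y N) (n + 1) / Z (S y N) n \<in> T" using n by (auto simp: T_def)
      obtain c where c: "\<And>n. recurrence_op Q y n = c * \<tau> ^ n" and \<tau>: "\<bar>\<tau>\<bar> \<le> b2"
        using y by (auto simp: geometric_samples_def)
      have bigZ: "1 \<le> \<bar>Z (S y N) n\<bar>" "a * b1 ^ n / 2 \<le> \<bar>Z (S y N) n\<bar>"
        using big[OF y n(2), of N] n(1) by auto
      have "\<bar>\<tau> - Z (S y N) (n + 1) / Z (S y N) n\<bar> \<le> (1 + b2) * (B * (1 / 2)) / \<bar>Z (S y N) n\<bar>"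
        by (rule geometric_ratio_error[of "recurrence_op Q y n" _ _ "recurrence_op Q y (n + 1)"])
          (use bigZ \<tau> n c close[of n N y "1 / 2"] close[of "n + 1" N y "1 / 2"] half in \<open>auto\<close>)
      also have "\<dots> \<le> (1 + b2) * (B * (1 / 2)) / (a * b1 ^ n / 2)"
        using bigZ b \<open>1 \<le> B\<close> \<open>0 < a\<close> by (intro divide_left_mono) auto
      also have "\<dots> = B * (1 + b2) / (a * b1 ^ n)" by (simp add: mult.commute)
      finally show ?thesis using inT unfolding n_def by blast
    qed
    show "\<exists>T. finite T \<and> real (card T) * x ^ m \<le> real (card L) * (1 + (C + 1) * x) ^ N \<and>
      (\<forall>(\<tau>, y)\<in>geometric_samples Q a M b1 b2.
      card {n. n < N \<and> \<rho> < \<bar>y n - round (y n)\<bar>} * (D + 3) \<le> m \<longrightarrow>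
      (\<exists>t\<in>T. \<bar>\<tau> - t\<bar> \<le> B * (1 + b2) / (a * b1 ^ (N - D - 2))))"
      using card near count[OF N] by (intro exI[of _ T]) (auto simp: T_def)
  qed simp
qed

text \<open>
  Choose the weight \<open>x\<close> so small that the tree grows by at most \<open>b1 powr (1 / 3)\<close> per step, and then \<open>\<kappa>\<close>
  so small that \<open>(D + 3) \<kappa> N\<close> marks cost at most another \<open>b1 powr (N / 3)\<close>. The intervals have length
  of order \<open>b1 powr - N\<close>, so their total length decays like \<open>b1 powr (- N / 3)\<close>. Both \<open>\<rho>\<close> and \<open>\<kappa>\<close> are
  independent of \<open>a\<close>, \<open>M\<close> and the particular polynomial.
\<close>

theorem Erdos_Kahane:
  fixes b1 b2 B :: real and D :: nat
  assumes b: "1 < b1" "b1 \<le> b2" and "1 \<le> B"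
  shows "\<exists>\<rho> \<kappa>. 0 < \<rho> \<and> \<rho> < 1 / 2 \<and> 0 < \<kappa> \<and>
    (\<forall>Q a M. degree Q = D \<longrightarrow> lead_coeff Q = 1 \<longrightarrow> (\<Sum>l\<le>D. \<bar>coeff Q l\<bar>) \<le> B \<longrightarrow> 0 < a \<longrightarrow>
      (\<exists>C n0. \<forall>N\<ge>n0. \<exists>T r. finite T \<and> 0 \<le> r \<and> real (card T) * r \<le> C * (b1 powr (- 1 / 3)) ^ N \<and>
        (\<forall>(\<tau>, y)\<in>geometric_samples Q a M b1 b2.
          real (card {n. n < N \<and> \<rho> < \<bar>y n - round (y n)\<bar>}) \<le> \<kappa> * real N \<longrightarrow> (\<exists>t\<in>T. \<bar>\<tau> - t\<bar> \<le> r))))"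
proof -
  define C where "C = (1 + b2)\<^sup>2 * (1 + B / 2) * B"
  define \<rho> where "\<rho> = 1 / (4 * C)"
  define x where "x = min (1 / 2) ((b1 powr (1 / 3) - 1) / (C + 1))"
  define \<kappa> where "\<kappa> = ln b1 / (3 * real (D + 3) * ln (1 / x))"
  have "1 * 1 * 1 \<le> (1 + b2)\<^sup>2 * (1 + B / 2) * B"
    using b \<open>1 \<le> B\<close> by (intro mult_mono) auto
  then have C1: "1 \<le> C" by (simp add: C_def)
  have \<beta>: "1 < b1 powr (1 / 3)" using b by simp
  have x: "0 < x" "x < 1" using C1 \<beta> by (auto simp: x_def)
  have "(C + 1) * x \<le> b1 powr (1 / 3) - 1"
    using C1 mult_left_mono[of x "(b1 powr (1 / 3) - 1) / (C + 1)" "C + 1"] by (simp add: x_def)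
  then have xC: "1 + (C + 1) * x \<le> b1 powr (1 / 3)" by simp
  have lx: "0 < ln (1 / x)" using x by simp
  have \<rho>: "0 < \<rho>" "\<rho> < 1 / 2" using C1 by (auto simp: \<rho>_def field_simps)
  have \<kappa>: "0 < \<kappa>" using b lx by (auto simp: \<kappa>_def)
  have main: "\<exists>C n0. \<forall>N\<ge>n0. \<exists>T r. finite T \<and> 0 \<le> r \<and> real (card T) * r \<le> C * (b1 powr (- 1 / 3)) ^ N \<and>
        (\<forall>(\<tau>, y)\<in>geometric_samples Q a M b1 b2.
          real (card {n. n < N \<and> \<rho> < \<bar>y n - round (y n)\<bar>}) \<le> \<kappa> * real N \<longrightarrow> (\<exists>t\<in>T. \<bar>\<tau> - t\<bar> \<le> r))"
    if Q: "degree Q = D" "lead_coeff Q = 1" "(\<Sum>l\<le>D. \<bar>coeff Q l\<bar>) \<le> B" and a: "0 < a"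
    for Q :: "real poly" and a M :: real
  proof -
    define r where "r N = B * (1 + b2) / (a * b1 ^ (N - D - 2))" for N
    have "\<exists>c0 n0. 0 \<le> c0 \<and> (\<forall>N\<ge>n0. \<forall>m. \<exists>T. finite T \<and>
      real (card T) * x ^ m \<le> c0 * (1 + (C + 1) * x) ^ N \<and>
      (\<forall>(\<tau>, y)\<in>geometric_samples Q a M b1 b2.
        card {n. n < N \<and> \<rho> < \<bar>y n - round (y n)\<bar>} * (D + 3) \<le> m \<longrightarrow> (\<exists>t\<in>T. \<bar>\<tau> - t\<bar> \<le> r N)))"
      unfolding r_def \<rho>_def C_def Q(1)[symmetric]
      by (rule rounded_samples_determine_ratio)
        (use b Q \<open>1 \<le> B\<close> a x in auto)
    then obtain c0 n0 where c0: "0 \<le> c0" and *: "\<forall>N\<ge>n0. \<forall>m. \<exists>T. finite T \<and>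
      real (card T) * x ^ m \<le> c0 * (1 + (C + 1) * x) ^ N \<and>
      (\<forall>(\<tau>, y)\<in>geometric_samples Q a M b1 b2.
        card {n. n < N \<and> \<rho> < \<bar>y n - round (y n)\<bar>} * (D + 3) \<le> m \<longrightarrow> (\<exists>t\<in>T. \<bar>\<tau> - t\<bar> \<le> r N))"
      by (elim exE conjE) (rule that)
    show ?thesis
    proof (intro exI[of _ "c0 * (B * (1 + b2) * b1 ^ (D + 2) / a)"] exI[of _ "max n0 (D + 2)"] allI impI)
      fix N assume N: "max n0 (D + 2) \<le> N"
      define m where "m = nat \<lfloor>real (D + 3) * \<kappa> * real N\<rfloor>"
      have m: "real m \<le> real (D + 3) * \<kappa> * real N" using \<open>0 < \<kappa>\<close> by (simp add: m_def)
      have "n0 \<le> N" using N by simp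
      then obtain T where T: "finite T" "real (card T) * x ^ m \<le> c0 * (1 + (C + 1) * x) ^ N"
        and near: "\<And>\<tau> y. (\<tau>, y) \<in> geometric_samples Q a M b1 b2 \<Longrightarrow>
          card {n. n < N \<and> \<rho> < \<bar>y n - round (y n)\<bar>} * (D + 3) \<le> m \<Longrightarrow> \<exists>t\<in>T. \<bar>\<tau> - t\<bar> \<le> r N"
        using *[rule_format, of N m] by blast
      have r0: "0 \<le> r N" using b a \<open>1 \<le> B\<close> by (simp add: r_def)
      have "ln ((1 / x) ^ m) = real m * ln (1 / x)" using x by (simp add: ln_realpow)
      also have "\<dots> \<le> (real (D + 3) * \<kappa> * real N) * ln (1 / x)"
        using m lx by (intro mult_right_mono) auto
      also have "\<dots> = real N * (ln b1 / 3)"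
      proof -
        have "e * (u / (3 * e * l)) * k * l = k * (u / 3)" if "0 < e" "0 < l" for e u l k :: real
          using that by (simp add: field_simps)
        from this[of "real (D + 3)" "ln (1 / x)"] lx show ?thesis
          unfolding \<kappa>_def by (metis of_nat_0_less_iff add_gr_0 zero_less_numeral)
      qed
      also have "\<dots> = ln ((b1 powr (1 / 3)) ^ N)" using b by (subst ln_realpow) (auto simp: ln_powr)
      finally have xm: "(1 / x) ^ m \<le> (b1 powr (1 / 3)) ^ N"
        using x b by (subst (asm) ln_le_cancel_iff) auto
      have "real (card T) = real (card T) * x ^ m * (1 / x) ^ m" using x by (simp add: power_divide)
      also have "\<dots> \<le> c0 * (b1 powr (1 / 3)) ^ N * (b1 powr (1 / 3)) ^ N"
        using T(2) xC xm x c0 C1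
        by (intro mult_mono order_trans[OF T(2)] mult_left_mono power_mono) auto
      finally have cT: "real (card T) \<le> c0 * (b1 powr (1 / 3)) ^ N * (b1 powr (1 / 3)) ^ N" .
      have "b1 ^ N = b1 ^ (N - D - 2) * b1 ^ (D + 2)"
        unfolding power_add[symmetric] using N by (intro arg_cong[where f = "(^) b1"]) arith
      then have rN: "r N = B * (1 + b2) * b1 ^ (D + 2) / a / b1 ^ N"
        using b a by (simp add: r_def field_simps)
      have "b1 powr (1 / 3) * b1 powr (1 / 3) * b1 powr (- 1) = b1 powr (- 1 / 3)"
        by (simp only: powr_add[symmetric]) simp
      then have "b1 powr (- 1 / 3) = b1 powr (1 / 3) * b1 powr (1 / 3) / b1"
        using b by (simp only: powr_minus_divide powr_one) simp
      then have pw: "(b1 powr (1 / 3)) ^ N * (b1 powr (1 / 3)) ^ N / b1 ^ N = (b1 powr (- 1 / 3)) ^ N"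
        by (simp only: power_mult_distrib power_divide)
      have "real (card T) * r N \<le> c0 * (b1 powr (1 / 3)) ^ N * (b1 powr (1 / 3)) ^ N * r N"
        using cT r0 by (rule mult_right_mono)
      also have "\<dots> = c0 * (B * (1 + b2) * b1 ^ (D + 2) / a)
          * ((b1 powr (1 / 3)) ^ N * (b1 powr (1 / 3)) ^ N / b1 ^ N)"
        by (simp add: rN)
      finally have "real (card T) * r N \<le> c0 * (B * (1 + b2) * b1 ^ (D + 2) / a) * (b1 powr (- 1 / 3)) ^ N"
        unfolding pw .
      moreover have "\<exists>t\<in>T. \<bar>\<tau> - t\<bar> \<le> r N" if "(\<tau>, y) \<in> geometric_samples Q a M b1 b2"
        and "real (card {n. n < N \<and> \<rho> < \<bar>y n - round (y n)\<bar>}) \<le> \<kappa> * real N" for \<tau> y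
      proof (rule near[OF that(1)])
        have "real (card {n. n < N \<and> \<rho> < \<bar>y n - round (y n)\<bar>} * (D + 3)) \<le> \<kappa> * real N * real (D + 3)"
          using that(2) by (simp only: of_nat_mult mult_right_mono of_nat_0_le_iff)
        then show "card {n. n < N \<and> \<rho> < \<bar>y n - round (y n)\<bar>} * (D + 3) \<le> m"
          unfolding m_def by (intro le_nat_floor) (simp only: mult_ac)
      qed
      ultimately show "\<exists>T r. finite T \<and> 0 \<le> r \<and> real (card T) * r
          \<le> c0 * (B * (1 + b2) * b1 ^ (D + 2) / a) * (b1 powr (- 1 / 3)) ^ N \<and>
          (\<forall>(\<tau>, y)\<in>geometric_samples Q a M b1 b2.
            real (card {n. n < N \<and> \<rho> < \<bar>y n - round (y n)\<bar>}) \<le> \<kappa> * real N \<longrightarrow> (\<exists>t\<in>T. \<bar>\<tau> - t\<bar> \<le> r))"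
        using T(1) r0 by blast
    qed
  qed
  show ?thesis
    by (rule exI[of _ \<rho>], rule exI[of _ \<kappa>]) (intro conjI allI impI \<rho> \<kappa> main; assumption)
qed

section \<open>The exceptional set is null\<close>

text \<open>
  Translation invariance replaces a decomposition of the space: averaging the translates of \<open>S\<close> by
  \<open>t *\<^sub>R v\<close> over \<open>t \<in> {0..1}\<close> does not change its measure, and by Fubini's theorem the average only sees
  the slices.
\<close>

lemma null_set_from_line_slices:
  fixes S :: "'a::euclidean_space set"
  assumes [measurable]: "S \<in> sets borel"
    and slice: "\<And>x. {t. x + t *\<^sub>R v \<in> S} \<in> null_sets lborel"
  shows "S \<in> null_sets lborel"
proof -
  let ?f = "\<lambda>(x::'a) t. indicator S (x + t *\<^sub>R v) * indicator {0..1::real} t :: ennreal"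
  have eq: "(lborel :: 'a measure) = distr lborel borel (\<lambda>x. y + x)" for y :: 'a
    using lborel_affine[of 1 y] by (simp add: density_1)
  have shift: "(\<integral>\<^sup>+x. indicator S (x + t *\<^sub>R v) \<partial>lborel) = emeasure lborel S" for t
  proof -
    have "emeasure lborel S = (\<integral>\<^sup>+x. indicator S x \<partial>distr lborel borel (\<lambda>x. t *\<^sub>R v + x))"
      by (subst eq[symmetric]) (simp add: nn_integral_indicator)
    then show ?thesis by (subst (asm) nn_integral_distr) (auto simp: add.commute)
  qed
  have "emeasure lborel S = (\<integral>\<^sup>+t. \<integral>\<^sup>+x. ?f x t \<partial>lborel \<partial>lborel)"
    by (simp add: nn_integral_multc shift nn_integral_cmult)
  also have "\<dots> = (\<integral>\<^sup>+x. \<integral>\<^sup>+t. ?f x t \<partial>lborel \<partial>lborel)"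
  proof (rule lborel_pair.Fubini')
    have [measurable]: "(\<lambda>z::'a \<times> real. indicator S (fst z + snd z *\<^sub>R v) :: ennreal) \<in> borel_measurable (borel \<Otimes>\<^sub>M borel)"
      by (rule measurable_compose[OF _ borel_measurable_indicator[OF assms(1)]]) measurable
    show "case_prod ?f \<in> borel_measurable (lborel \<Otimes>\<^sub>M lborel)"
      unfolding case_prod_beta by measurable
  qed
  also have "\<dots> = (\<integral>\<^sup>+x. 0 \<partial>(lborel :: 'a measure))"
  proof (rule nn_integral_cong)
    fix x
    have "AE t in lborel. t \<notin> {t. x + t *\<^sub>R v \<in> S}" using slice[of x] by (rule AE_not_in)
    then have "AE t in lborel. ?f x t = 0" by eventually_elim auto
    then show "(\<integral>\<^sup>+t. ?f x t \<partial>lborel) = 0" by (subst nn_integral_0_iff_AE) auto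
  qed
  finally show ?thesis by (auto simp: null_sets_def)
qed

definition phase :: "real ^ 'd \<Rightarrow> real ^ 'd \<Rightarrow> nat \<Rightarrow> real" where
  "phase w \<tau> n = (\<Sum>s\<in>UNIV. w $ s * \<tau> $ s ^ n)"

definition coord_power :: "nat \<Rightarrow> real ^ 'd \<Rightarrow> real ^ 'd" where
  "coord_power q \<theta> = (\<chi> s. \<theta> $ s ^ q)"

lemma coord_power_nth [simp]: "coord_power q \<theta> $ s = \<theta> $ s ^ q"
  by (simp add: coord_power_def)

definition separated :: "real \<Rightarrow> real \<Rightarrow> real \<Rightarrow> (real ^ 'd) set" where
  "separated b1 b2 c = {\<tau>. (\<forall>s. b1 \<le> \<bar>\<tau> $ s\<bar> \<and> \<bar>\<tau> $ s\<bar> \<le> b2) \<and> (\<forall>s t. s \<noteq> t \<longrightarrow> c \<le> \<bar>\<tau> $ s - \<tau> $ t\<bar>)}"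

definition off_phases :: "real \<Rightarrow> real ^ 'd \<Rightarrow> real ^ 'd \<Rightarrow> nat \<Rightarrow> nat set" where
  "off_phases \<gamma> w \<tau> N = {n. n < N \<and> cos (phase w \<tau> n) < \<gamma>}"

text \<open>
  The set is formulated for \<open>\<theta>\<close>, with conditions on \<open>\<theta>\<^sup>q\<close>, so that no null set has to be transported
  through the power map. The lower bound uses \<open>Suc M\<close> so that it is meaningful for \<open>M = 0\<close>.
\<close>

definition exceptional_at ::
  "real \<Rightarrow> real \<Rightarrow> real \<Rightarrow> nat \<Rightarrow> real \<Rightarrow> real \<Rightarrow> 'd::finite \<Rightarrow> nat \<Rightarrow> nat \<Rightarrow> (real ^ 'd) set" where
  "exceptional_at b1 b2 c q \<gamma> \<kappa> i M N = {\<theta>. coord_power q \<theta> \<in> separated b1 b2 c \<and>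
     (\<exists>w. (\<forall>s. \<bar>w $ s\<bar> \<le> real M) \<and> 1 / real (Suc M) \<le> \<bar>w $ i\<bar> \<and>
       real (card (off_phases \<gamma> w (coord_power q \<theta>) N)) \<le> \<kappa> * real N)}"

definition exceptional ::
  "real \<Rightarrow> real \<Rightarrow> real \<Rightarrow> nat \<Rightarrow> real \<Rightarrow> real \<Rightarrow> (real ^ 'd) set" where
  "exceptional b1 b2 c q \<gamma> \<kappa> = (\<Union>i. \<Union>M. limsup (exceptional_at b1 b2 c q \<gamma> \<kappa> i M))"

text \<open>
  The set is a projection of a compact set of pairs \<open>(\<theta>, w)\<close>: the counting condition says that the
  closed condition \<open>\<gamma> \<le> cos (phase w \<tau> n)\<close> holds outside one of finitely many small sets \<open>S\<close> of
  indices. Compactness provides the measurability that Fubini's theorem needs.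
\<close>

lemma compact_exceptional_at:
  fixes i :: "'d::finite"
  assumes "1 \<le> b2" "0 < q"
  shows "compact (exceptional_at b1 b2 c q \<gamma> \<kappa> i M N)"
proof -
  let ?K = "\<lambda>S. {(\<theta>, w). (\<theta> :: real ^ 'd) \<in> {\<theta>. coord_power q \<theta> \<in> separated b1 b2 c} \<and>
     (\<forall>s. \<bar>w $ s\<bar> \<le> real M) \<and> 1 / real (Suc M) \<le> \<bar>w $ i\<bar> \<and>
     (\<forall>n\<in>{..<N} - S. \<gamma> \<le> cos (phase w (coord_power q \<theta>) n))}"
  let ?SS = "{S. S \<subseteq> {..<N} \<and> real (card S) \<le> \<kappa> * real N}"
  have "compact (?K S)" for S
  proof (rule compact_eq_bounded_closed[THEN iffD2], rule conjI)
    have "?K S \<subseteq> cbox (\<chi> s. - b2) (\<chi> s. b2) \<times> cbox (\<chi> s. - real M) (\<chi> s. real M)"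
    proof
      fix z assume "z \<in> ?K S"
      then obtain \<theta> w where z: "z = (\<theta>, w)"
        and \<theta>: "coord_power q \<theta> \<in> separated b1 b2 c" and w: "\<forall>s. \<bar>w $ s\<bar> \<le> real M" by auto
      have "\<bar>\<theta> $ s\<bar> \<le> b2" for s
      proof (rule ccontr)
        assume "\<not> ?thesis"
        then have big: "b2 < \<bar>\<theta> $ s\<bar>" by simp
        then have "\<bar>\<theta> $ s\<bar> ^ 1 \<le> \<bar>\<theta> $ s\<bar> ^ q" using assms by (intro power_increasing) auto
        moreover have "\<bar>\<theta> $ s\<bar> ^ q \<le> b2" using \<theta> by (simp add: separated_def power_abs)
        ultimately show False using big by simp
      qed
      then have "- b2 \<le> \<theta> $ s \<and> \<theta> $ s \<le> b2" "- real M \<le> w $ s \<and> w $ s \<le> real M" for s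
        using w by (auto simp: abs_le_iff dest!: spec[of _ s]) (metis minus_le_iff)+
      then show "z \<in> cbox (\<chi> s. - b2) (\<chi> s. b2) \<times> cbox (\<chi> s. - real M) (\<chi> s. real M)"
        by (simp add: z mem_box_cart)
    qed
    then show "bounded (?K S)" by (rule bounded_subset[rotated]) (intro bounded_Times bounded_cbox)
    have "?K S = (\<Inter>s. {z. b1 \<le> \<bar>fst z $ s ^ q\<bar>}) \<inter> (\<Inter>s. {z. \<bar>fst z $ s ^ q\<bar> \<le> b2})
      \<inter> (\<Inter>s. \<Inter>t. {z. s \<noteq> t \<longrightarrow> c \<le> \<bar>fst z $ s ^ q - fst z $ t ^ q\<bar>})
      \<inter> (\<Inter>s. {z. \<bar>snd z $ s\<bar> \<le> real M}) \<inter> {z. 1 / real (Suc M) \<le> \<bar>snd z $ i\<bar>}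
      \<inter> (\<Inter>n\<in>{..<N} - S. {z. \<gamma> \<le> cos (\<Sum>s\<in>UNIV. snd z $ s * (fst z $ s ^ q) ^ n)})"
      by (auto simp: separated_def phase_def)
    also have "closed \<dots>"
      by (intro closed_Int closed_INT ballI closed_Collect_imp open_Collect_const closed_Collect_le continuous_intros)
    finally show "closed (?K S)" .
  qed
  then have "compact (\<Union>S\<in>?SS. fst ` ?K S)"
    by (intro compact_UN compact_continuous_image continuous_intros) auto
  also have "(\<Union>S\<in>?SS. fst ` ?K S) = exceptional_at b1 b2 c q \<gamma> \<kappa> i M N"
  proof (intro subset_antisym subsetI)
    fix \<theta> assume "\<theta> \<in> (\<Union>S\<in>?SS. fst ` ?K S)"
    then obtain S w where S: "S \<subseteq> {..<N}" "real (card S) \<le> \<kappa> * real N" and K: "(\<theta>, w) \<in> ?K S" by auto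
    have "off_phases \<gamma> w (coord_power q \<theta>) N \<subseteq> S" 
    proof
      have Kn: "\<forall>n\<in>{..<N} - S. \<gamma> \<le> cos (phase w (coord_power q \<theta>) n)" using K by simp
      fix n assume n: "n \<in> off_phases \<gamma> w (coord_power q \<theta>) N"
      show "n \<in> S"
      proof (rule ccontr)
        assume "n \<notin> S"
        then have "n \<in> {..<N} - S" using n by (simp add: off_phases_def)
        then have "\<gamma> \<le> cos (phase w (coord_power q \<theta>) n)" using Kn by (rule bspec[rotated])
        then show False using n by (simp add: off_phases_def)
      qed
    qed
    then have "card (off_phases \<gamma> w (coord_power q \<theta>) N) \<le> card S"
      using S(1) by (intro card_mono) (auto intro: finite_subset)
    then have "real (card (off_phases \<gamma> w (coord_power q \<theta>) N)) \<le> \<kappa> * real N" using S(2) by linarith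
    then show "\<theta> \<in> exceptional_at b1 b2 c q \<gamma> \<kappa> i M N" using K by (auto simp: exceptional_at_def)
  next
    fix \<theta> assume "\<theta> \<in> exceptional_at b1 b2 c q \<gamma> \<kappa> i M N"
    then obtain w where "coord_power q \<theta> \<in> separated b1 b2 c" "\<forall>s. \<bar>w $ s\<bar> \<le> real M" "1 / real (Suc M) \<le> \<bar>w $ i\<bar>"
      and card: "real (card (off_phases \<gamma> w (coord_power q \<theta>) N)) \<le> \<kappa> * real N" by (auto simp: exceptional_at_def)
    then have K: "(\<theta>, w) \<in> ?K (off_phases \<gamma> w (coord_power q \<theta>) N)" by (auto simp: off_phases_def)
    have SS: "off_phases \<gamma> w (coord_power q \<theta>) N \<in> ?SS" using card by (auto simp: off_phases_def)
    show "\<theta> \<in> (\<Union>S\<in>?SS. fst ` ?K S)"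
      by (rule UN_I[OF SS], rule image_eqI[OF _ K]) simp
  qed
  finally show ?thesis .
qed

lemma abs_root_gt_one:
  assumes "1 < b" "b \<le> \<bar>x ^ q\<bar>"
  shows "1 < \<bar>x :: real\<bar>"
proof (rule ccontr)
  assume "\<not> ?thesis"
  then have "\<bar>x\<bar> ^ q \<le> 1" by (intro power_le_one) auto
  then show False using assms by (simp add: power_abs)
qed

text \<open>
  On each of the half-lines \<open>u + t \<ge> 1\<close> and \<open>u + t \<le> - 1\<close> the power map expands distances, so the
  preimage of an interval of length \<open>2 r\<close> lies in two intervals of length \<open>4 r\<close>.
\<close>

lemma emeasure_power_preimage_le:
  fixes u e r :: real
  assumes "0 < q" "0 \<le> r"
  shows "\<exists>J\<in>sets lborel. {t. 1 \<le> \<bar>u + t\<bar> \<and> \<bar>(u + t) ^ q - e\<bar> \<le> r} \<subseteq> J \<and> emeasure lborel J \<le> ennreal (8 * r)"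
proof -
  let ?A = "\<lambda>\<sigma>. {t. 1 \<le> \<sigma> * (u + t) \<and> \<bar>(u + t) ^ q - e\<bar> \<le> r}"
  have "\<exists>t0. ?A \<sigma> \<subseteq> {t0 - 2 * r..t0 + 2 * r}" if \<sigma>: "\<sigma> = 1 \<or> \<sigma> = -1" for \<sigma> :: real
  proof (cases "?A \<sigma> = {}")
    case False
    then obtain t0 where t0: "t0 \<in> ?A \<sigma>" by blast
    have pow: "y - x \<le> y ^ q - x ^ q" if "1 \<le> x" "x \<le> y" for x y :: real
    proof -
      obtain p where p: "q = Suc p" using \<open>0 < q\<close> by (cases q) auto
      have "(y - x) * 1 \<le> (y - x) * y ^ p" using that by (intro mult_left_mono) (auto simp: one_le_power)
      moreover have "x * x ^ p \<le> x * y ^ p" using that by (intro mult_left_mono power_mono) auto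
      ultimately show ?thesis by (simp add: p algebra_simps)
    qed
    have abs: "\<bar>x - y\<bar> \<le> \<bar>x ^ q - y ^ q\<bar>" if "1 \<le> x" "1 \<le> y" for x y :: real
      using pow[of x y] pow[of y x] that by (cases "x \<le> y") auto
    have "\<bar>t - t0\<bar> \<le> 2 * r" if t: "t \<in> ?A \<sigma>" for t
    proof -
      have "\<bar>t - t0\<bar> = \<bar>\<sigma> * (u + t) - \<sigma> * (u + t0)\<bar>" using \<sigma> by auto
      also have "\<dots> \<le> \<bar>(\<sigma> * (u + t)) ^ q - (\<sigma> * (u + t0)) ^ q\<bar>" using t t0 by (intro abs) auto
      also have "\<dots> = \<bar>(u + t) ^ q - (u + t0) ^ q\<bar>"
        using \<sigma> by (auto simp: power_mult_distrib abs_mult power_abs simp flip: right_diff_distrib)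
      also have "\<dots> \<le> 2 * r" using t t0 by auto
      finally show ?thesis .
    qed
    then have "t0 - 2 * r \<le> t \<and> t \<le> t0 + 2 * r" if "t \<in> ?A \<sigma>" for t
      using that by (fastforce simp only: abs_le_iff diff_le_eq le_diff_eq minus_diff_eq add.commute)
    then show ?thesis by (intro exI[of _ t0] subsetI) simp
  qed auto
  from this[OF disjI1[OF refl]] this[OF disjI2[OF refl]] obtain s t where st: "?A 1 \<subseteq> {s - 2 * r..s + 2 * r}" "?A (-1) \<subseteq> {t - 2 * r..t + 2 * r}"
    by (elim exE) (rule that)
  show ?thesis
  proof (intro bexI[of _ "{s - 2 * r..s + 2 * r} \<union> {t - 2 * r..t + 2 * r}"] conjI)
    show "{t. 1 \<le> \<bar>u + t\<bar> \<and> \<bar>(u + t) ^ q - e\<bar> \<le> r} \<subseteq> {s - 2 * r..s + 2 * r} \<union> {t - 2 * r..t + 2 * r}"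
    proof
      fix x assume "x \<in> {t. 1 \<le> \<bar>u + t\<bar> \<and> \<bar>(u + t) ^ q - e\<bar> \<le> r}"
      then have "x \<in> ?A 1 \<union> ?A (-1)" by (auto simp: abs_if split: if_splits)
      then show "x \<in> {s - 2 * r..s + 2 * r} \<union> {t - 2 * r..t + 2 * r}" using st by blast
    qed
    have "emeasure lborel ({s - 2 * r..s + 2 * r} \<union> {t - 2 * r..t + 2 * r})
        \<le> emeasure lborel {s - 2 * r..s + 2 * r} + emeasure lborel {t - 2 * r..t + 2 * r}"
      by (rule emeasure_subadditive) auto
    also have "\<dots> = ennreal (4 * r) + ennreal (4 * r)" using \<open>0 \<le> r\<close> by simp
    also have "\<dots> = ennreal (8 * r)" using \<open>0 \<le> r\<close> by (simp flip: ennreal_plus)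
    finally show "emeasure lborel ({s - 2 * r..s + 2 * r} \<union> {t - 2 * r..t + 2 * r}) \<le> ennreal (8 * r)" .
  qed auto
qed

lemma prod_linear_factors:
  fixes x :: "'s \<Rightarrow> real"
  assumes "finite S" "\<And>s. s \<in> S \<Longrightarrow> \<bar>x s\<bar> \<le> b"
  defines "Q \<equiv> \<Prod>s\<in>S. [:- x s, 1:]"
  shows "degree Q = card S" "lead_coeff Q = 1" "(\<Sum>l\<le>card S. \<bar>coeff Q l\<bar>) \<le> (1 + b) ^ card S"
proof -
  show deg: "degree Q = card S" unfolding Q_def by (subst degree_prod_eq_sum_degree) auto
  show "lead_coeff Q = 1" unfolding Q_def by (simp add: lead_coeff_prod)
  show "(\<Sum>l\<le>card S. \<bar>coeff Q l\<bar>) \<le> (1 + b) ^ card S"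
    using assms(1,2) unfolding Q_def
  proof (induction S)
    case (insert u F)
    let ?p = "\<Prod>s\<in>F. [:- x s, 1:]"
    have b0: "0 \<le> b" using insert.prems[of u] by force
    have "degree ?p = card F" by (subst degree_prod_eq_sum_degree) auto
    then have top: "coeff ?p (Suc (card F)) = 0" by (simp add: coeff_eq_0)
    have c: "coeff ([:- x u, 1:] * ?p) l = - x u * coeff ?p l + coeff (pCons 0 ?p) l" for l
      by simp
    have "(\<Sum>l\<le>Suc (card F). \<bar>coeff ([:- x u, 1:] * ?p) l\<bar>)
        \<le> (\<Sum>l\<le>Suc (card F). \<bar>x u\<bar> * \<bar>coeff ?p l\<bar>) + (\<Sum>l\<le>Suc (card F). \<bar>coeff (pCons 0 ?p) l\<bar>)"
      unfolding c sum.distrib[symmetric]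
      by (intro sum_mono order_trans[OF abs_triangle_ineq]) (simp add: abs_mult)
    also have "(\<Sum>l\<le>Suc (card F). \<bar>x u\<bar> * \<bar>coeff ?p l\<bar>) = \<bar>x u\<bar> * (\<Sum>l\<le>card F. \<bar>coeff ?p l\<bar>)"
      by (simp add: top sum_distrib_left)
    also have "(\<Sum>l\<le>Suc (card F). \<bar>coeff (pCons 0 ?p) l\<bar>) = (\<Sum>l\<le>card F. \<bar>coeff ?p l\<bar>)"
      by (subst sum.atMost_Suc_shift) simp
    also have "\<bar>x u\<bar> * (\<Sum>l\<le>card F. \<bar>coeff ?p l\<bar>) + (\<Sum>l\<le>card F. \<bar>coeff ?p l\<bar>)
        = (1 + \<bar>x u\<bar>) * (\<Sum>l\<le>card F. \<bar>coeff ?p l\<bar>)" by (simp add: algebra_simps)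
    also have "\<dots> \<le> (1 + b) * (1 + b) ^ card F"
      using insert b0 by (intro mult_mono) (auto intro: sum_nonneg)
    finally show ?case using insert.hyps by simp
  qed simp
qed

text \<open>
  A polynomial in the shift operator multiplies the exponential \<open>\<tau> $ s ^ n\<close> by its value at \<open>\<tau> $ s\<close>.
\<close>

lemma recurrence_op_phase:
  assumes "\<And>s. s \<noteq> i \<Longrightarrow> poly Q (\<tau> $ s) = 0"
  shows "recurrence_op Q (\<lambda>n. phase w \<tau> n / k) n = w $ i * poly Q (\<tau> $ i) / k * \<tau> $ i ^ n"
proof -
  have "recurrence_op Q (\<lambda>n. phase w \<tau> n / k) n
      = (\<Sum>l\<le>degree Q. \<Sum>s\<in>UNIV. w $ s * \<tau> $ s ^ n / k * (coeff Q l * \<tau> $ s ^ l))"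
    unfolding recurrence_op_def phase_def sum_divide_distrib sum_distrib_left
    by (intro sum.cong refl) (simp add: power_add mult_ac)
  also have "\<dots> = (\<Sum>s\<in>UNIV. \<Sum>l\<le>degree Q. w $ s * \<tau> $ s ^ n / k * (coeff Q l * \<tau> $ s ^ l))"
    by (rule sum.swap)
  also have "\<dots> = (\<Sum>s\<in>UNIV. w $ s * \<tau> $ s ^ n / k * poly Q (\<tau> $ s))"
    by (simp add: poly_altdef sum_distrib_left)
  also have "\<dots> = (\<Sum>s\<in>{i}. w $ s * \<tau> $ s ^ n / k * poly Q (\<tau> $ s))"
    by (rule sum.mono_neutral_right) (auto simp: assms)
  finally show ?thesis by simp
qed

lemma cos_ge_imp_near_integer:
  assumes "0 < \<rho>" "\<rho> < 1 / 2" and cos: "cos (2 * pi * \<rho>) \<le> cos u"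
  shows "\<bar>u / (2 * pi) - round (u / (2 * pi))\<bar> \<le> \<rho>"
proof (rule ccontr)
  define v where "v = \<bar>u / (2 * pi) - round (u / (2 * pi))\<bar>"
  assume "\<not> ?thesis"
  then have v: "\<rho> < v" "v \<le> 1 / 2"
    using of_int_round_abs_le[of "u / (2 * pi)"] by (auto simp: v_def abs_minus_commute)
  have "2 * pi * v = \<bar>u - 2 * pi * round (u / (2 * pi))\<bar>"
    by (simp add: v_def abs_mult_pos' right_diff_distrib)
  then have "cos (2 * pi * v) = cos (u - 2 * pi * round (u / (2 * pi)))"
    by (simp only: cos_abs_real)
  also have "\<dots> = cos u"
    using cos_int_2pin[of "round (u / (2 * pi))"] sin_int_2pin[of "round (u / (2 * pi))"]
    by (simp add: cos_diff)
  finally have "cos (2 * pi * v) = cos u" .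
  moreover have "cos (2 * pi * v) < cos (2 * pi * \<rho>)"
    using v assms by (intro cos_monotone_0_pi) auto
  ultimately show False using cos by simp
qed

text \<open>
  It suffices to consider slices in the direction of the distinguished coordinate \<open>i\<close>. There
  \<open>Q = \<Prod>s \<noteq> i. (X - \<tau> s)\<close> is constant, its coefficients are bounded in terms of \<open>b2\<close>, and
  \<open>\<bar>poly Q (\<tau> i)\<bar> \<ge> c ^ D\<close> by the separation of the coordinates. So \<open>Erdos_Kahane\<close> bounds the slice at
  level \<open>N\<close> by a geometric sequence, and the Borel--Cantelli lemma applies. The separation \<open>c\<close> and the
  bound \<open>M\<close> influence only the constant in front, not \<open>\<gamma>\<close> and \<open>\<kappa>\<close>.
\<close>

theorem exceptional_null:
  fixes b1 b2 :: real
  assumes b: "1 < b1" "b1 \<le> b2"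
  obtains \<gamma> \<kappa> :: real where "\<gamma> < 1" "0 < \<kappa>"
    "\<And>c q. 0 < c \<Longrightarrow> 0 < q \<Longrightarrow> (exceptional b1 b2 c q \<gamma> \<kappa> :: (real ^ 'd) set) \<in> null_sets lborel"
proof -
  define D where "D = CARD('d) - 1"
  have one: "1 \<le> (1 + b2) ^ D" using b by (simp add: one_le_power)
  obtain \<rho> \<kappa> where \<rho>: "0 < \<rho>" "\<rho> < 1 / 2" and \<kappa>: "0 < \<kappa>"
    and EK: "\<forall>Q a M. degree Q = D \<longrightarrow> lead_coeff Q = 1 \<longrightarrow> (\<Sum>l\<le>D. \<bar>coeff Q l\<bar>) \<le> (1 + b2) ^ D \<longrightarrow> 0 < a \<longrightarrow>
      (\<exists>C n0. \<forall>N\<ge>n0. \<exists>T r. finite T \<and> 0 \<le> r \<and> real (card T) * r \<le> C * (b1 powr (- 1 / 3)) ^ N \<and>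
        (\<forall>(\<tau>, y)\<in>geometric_samples Q a M b1 b2.
          real (card {n. n < N \<and> \<rho> < \<bar>y n - round (y n)\<bar>}) \<le> \<kappa> * real N \<longrightarrow> (\<exists>t\<in>T. \<bar>\<tau> - t\<bar> \<le> r)))"
    using Erdos_Kahane[OF b one, of D] by (elim exE conjE) (rule that)
  define \<gamma> where "\<gamma> = cos (2 * pi * \<rho>)"
  have \<gamma>1: "\<gamma> < 1"
    unfolding \<gamma>_def using \<rho> cos_monotone_0_pi[of 0 "2 * pi * \<rho>"] by simp
  have slice: "{t. x + t *\<^sub>R axis i 1 \<in> limsup (exceptional_at b1 b2 c q \<gamma> \<kappa> i M)} \<in> null_sets lborel"
    if c: "0 < c" and q: "0 < q" for c q i M and x :: "real ^ 'd"
  proof (cases "\<forall>s. s \<noteq> i \<longrightarrow> \<bar>x $ s ^ q\<bar> \<le> b2")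
    case False
    then obtain s where s: "s \<noteq> i" "\<not> \<bar>x $ s ^ q\<bar> \<le> b2" by blast
    have "coord_power q (x + t *\<^sub>R axis i 1) $ s = x $ s ^ q" for t using s(1) by (simp add: axis_def)
    then have "coord_power q (x + t *\<^sub>R axis i 1) \<notin> separated b1 b2 c" for t
      using s(2) unfolding separated_def by (metis (mono_tags, lifting) mem_Collect_eq)
    then have "{t. x + t *\<^sub>R axis i 1 \<in> limsup (exceptional_at b1 b2 c q \<gamma> \<kappa> i M)} = {}"
      by (auto simp: limsup_INF_SUP exceptional_at_def)
    then show ?thesis by simp
  next
    case True
    define Q where "Q = (\<Prod>s\<in>UNIV - {i}. [:- (x $ s ^ q), 1:])"
    have card: "card (UNIV - {i}) = D" by (simp add: D_def card_Diff_singleton)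
    have Q: "degree Q = D" "lead_coeff Q = 1" "(\<Sum>l\<le>D. \<bar>coeff Q l\<bar>) \<le> (1 + b2) ^ D"
      using prod_linear_factors[of "UNIV - {i}" "\<lambda>s. x $ s ^ q" b2] True unfolding Q_def card by auto
    define a where "a = c ^ D / (2 * pi * real (Suc M))"
    have a: "0 < a" using c by (simp add: a_def)
    define A where "A N = {t. x + t *\<^sub>R axis i 1 \<in> exceptional_at b1 b2 c q \<gamma> \<kappa> i M N}" for N
    obtain C n0 where C: "\<And>N. n0 \<le> N \<Longrightarrow> \<exists>T r. finite T \<and> 0 \<le> r \<and> real (card T) * r \<le> C * (b1 powr (- 1 / 3)) ^ N \<and>
        (\<forall>(\<tau>, y)\<in>geometric_samples Q a (real CARD('d) * real M) b1 b2.
          real (card {n. n < N \<and> \<rho> < \<bar>y n - round (y n)\<bar>}) \<le> \<kappa> * real N \<longrightarrow> (\<exists>t\<in>T. \<bar>\<tau> - t\<bar> \<le> r))"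
      using EK[rule_format, OF Q a] by blast
    have sample: "((x $ i + t) ^ q, \<lambda>n. phase w (coord_power q (x + t *\<^sub>R axis i 1)) n / (2 * pi))
          \<in> geometric_samples Q a (real CARD('d) * real M) b1 b2"
      if \<tau>: "coord_power q (x + t *\<^sub>R axis i 1) \<in> separated b1 b2 c"
        and w: "\<forall>s. \<bar>w $ s\<bar> \<le> real M" "1 / real (Suc M) \<le> \<bar>w $ i\<bar>" for t w
    proof -
      define \<tau> where "\<tau> = coord_power q (x + t *\<^sub>R axis i 1)"
      have \<tau>i: "\<tau> $ i = (x $ i + t) ^ q" and \<tau>s: "\<And>s. s \<noteq> i \<Longrightarrow> \<tau> $ s = x $ s ^ q"
        by (auto simp: \<tau>_def axis_def)
      have sep: "b1 \<le> \<bar>\<tau> $ s\<bar>" "\<bar>\<tau> $ s\<bar> \<le> b2" "s \<noteq> s' \<Longrightarrow> c \<le> \<bar>\<tau> $ s - \<tau> $ s'\<bar>" for s s'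
        using \<tau> by (auto simp: separated_def simp flip: \<tau>_def)
      have bound: "\<bar>phase w \<tau> n / (2 * pi)\<bar> \<le> real CARD('d) * real M * b2 ^ n" for n
      proof -
        have "\<bar>phase w \<tau> n\<bar> \<le> (\<Sum>s\<in>(UNIV :: 'd set). real M * b2 ^ n)"
          unfolding phase_def
          using w(1) sep(2) by (intro order_trans[OF sum_abs] sum_mono) (auto simp: abs_mult power_abs intro!: mult_mono power_mono)
        also have "\<dots> = real CARD('d) * real M * b2 ^ n" by simp
        finally have le: "\<bar>phase w \<tau> n\<bar> \<le> real CARD('d) * real M * b2 ^ n" .
        have "\<bar>phase w \<tau> n / (2 * pi)\<bar> \<le> \<bar>phase w \<tau> n\<bar>"
          using mult_left_mono[of 1 "2 * pi" "\<bar>phase w \<tau> n\<bar>"] pi_ge_two by (simp add: abs_divide divide_le_eq)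
        then show ?thesis using le by simp
      qed
      have rec: "recurrence_op Q (\<lambda>n. phase w \<tau> n / (2 * pi)) n = w $ i * poly Q (\<tau> $ i) / (2 * pi) * \<tau> $ i ^ n" for n
        by (rule recurrence_op_phase) (auto simp: Q_def poly_prod \<tau>s)
      have "c ^ D \<le> \<bar>poly Q (\<tau> $ i)\<bar>"
      proof -
        have "c ^ D = (\<Prod>s\<in>UNIV - {i}. c)" by (simp add: card)
        also have "\<dots> \<le> (\<Prod>s\<in>UNIV - {i}. \<bar>\<tau> $ i - \<tau> $ s\<bar>)" using c sep(3) by (intro prod_mono) auto
        also have "\<dots> = \<bar>poly Q (\<tau> $ i)\<bar>"
          unfolding Q_def poly_prod abs_prod by (intro prod.cong refl) (simp add: \<tau>s)
        finally show ?thesis .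
      qed
      then have "1 / real (Suc M) * c ^ D \<le> \<bar>w $ i\<bar> * \<bar>poly Q (\<tau> $ i)\<bar>"
        using w(2) c by (intro mult_mono) auto
      then have "a \<le> \<bar>w $ i * poly Q (\<tau> $ i) / (2 * pi)\<bar>"
      proof -
        have "a = 1 / real (Suc M) * c ^ D / (2 * pi)" by (simp add: a_def)
        also have "\<dots> \<le> \<bar>w $ i\<bar> * \<bar>poly Q (\<tau> $ i)\<bar> / (2 * pi)"
          using \<open>1 / real (Suc M) * c ^ D \<le> \<bar>w $ i\<bar> * \<bar>poly Q (\<tau> $ i)\<bar>\<close> by (rule divide_right_mono) simp
        finally show ?thesis by (simp add: abs_mult)
      qed
      then have "\<exists>z. a \<le> \<bar>z\<bar> \<and> (\<forall>n. recurrence_op Q (\<lambda>n. phase w \<tau> n / (2 * pi)) n = z * \<tau> $ i ^ n)"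
        using rec by blast
      then show ?thesis
        unfolding geometric_samples_def \<tau>_def[symmetric] \<tau>i[symmetric] mem_Collect_eq prod.case
        using bound sep(1,2)[of i] by blast
    qed
    have meas: "A N \<in> sets lborel" for N
    proof -
      have "closed (exceptional_at b1 b2 c q \<gamma> \<kappa> i M N)"
        using b q by (intro compact_imp_closed compact_exceptional_at) auto
      then have "closed ((\<lambda>t. x + t *\<^sub>R axis i 1) -` exceptional_at b1 b2 c q \<gamma> \<kappa> i M N)"
        by (rule closed_vimage) (intro continuous_intros)
      then show ?thesis by (simp add: A_def vimage_def)
    qed
    have small: "emeasure lborel (A N) \<le> ennreal (8 * C * (b1 powr (- 1 / 3)) ^ N)" if N: "n0 \<le> N" for N
    proof -
      obtain T r where T: "finite T" "0 \<le> r" "real (card T) * r \<le> C * (b1 powr (- 1 / 3)) ^ N"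
        and near: "\<And>\<tau> y. (\<tau>, y) \<in> geometric_samples Q a (real CARD('d) * real M) b1 b2 \<Longrightarrow>
          real (card {n. n < N \<and> \<rho> < \<bar>y n - round (y n)\<bar>}) \<le> \<kappa> * real N \<Longrightarrow> \<exists>t\<in>T. \<bar>\<tau> - t\<bar> \<le> r"
        using C[OF N] by blast
      have "\<forall>e. \<exists>J. J \<in> sets lborel \<and> {t. 1 \<le> \<bar>x $ i + t\<bar> \<and> \<bar>(x $ i + t) ^ q - e\<bar> \<le> r} \<subseteq> J \<and>
          emeasure lborel J \<le> ennreal (8 * r)"
        using emeasure_power_preimage_le[OF q T(2), of "x $ i"] by blast
      from choice[OF this] obtain J where J: "\<And>e. J e \<in> sets lborel"
        "\<And>e. {t. 1 \<le> \<bar>x $ i + t\<bar> \<and> \<bar>(x $ i + t) ^ q - e\<bar> \<le> r} \<subseteq> J e" "\<And>e. emeasure lborel (J e) \<le> ennreal (8 * r)"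
        by blast
      have "A N \<subseteq> (\<Union>e\<in>T. J e)"
      proof
        fix t assume "t \<in> A N"
        then obtain w where \<tau>: "coord_power q (x + t *\<^sub>R axis i 1) \<in> separated b1 b2 c"
          and w: "\<forall>s. \<bar>w $ s\<bar> \<le> real M" "1 / real (Suc M) \<le> \<bar>w $ i\<bar>"
          and off: "real (card (off_phases \<gamma> w (coord_power q (x + t *\<^sub>R axis i 1)) N)) \<le> \<kappa> * real N"
          by (auto simp: A_def exceptional_at_def)
        let ?y = "\<lambda>n. phase w (coord_power q (x + t *\<^sub>R axis i 1)) n / (2 * pi)"
        have "{n. n < N \<and> \<rho> < \<bar>?y n - round (?y n)\<bar>} \<subseteq> off_phases \<gamma> w (coord_power q (x + t *\<^sub>R axis i 1)) N"
        proof
          fix n assume n: "n \<in> {n. n < N \<and> \<rho> < \<bar>?y n - round (?y n)\<bar>}"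
          have "\<not> cos (2 * pi * \<rho>) \<le> cos (phase w (coord_power q (x + t *\<^sub>R axis i 1)) n)"
          proof
            assume "cos (2 * pi * \<rho>) \<le> cos (phase w (coord_power q (x + t *\<^sub>R axis i 1)) n)"
            from cos_ge_imp_near_integer[OF \<rho> this] n show False by simp
          qed
          then show "n \<in> off_phases \<gamma> w (coord_power q (x + t *\<^sub>R axis i 1)) N"
            using n by (simp add: off_phases_def \<gamma>_def not_le)
        qed
        then have "card {n. n < N \<and> \<rho> < \<bar>?y n - round (?y n)\<bar>} \<le> card (off_phases \<gamma> w (coord_power q (x + t *\<^sub>R axis i 1)) N)"
          by (intro card_mono) (auto simp: off_phases_def)
        then have "\<exists>e\<in>T. \<bar>(x $ i + t) ^ q - e\<bar> \<le> r"
          using off by (intro near[OF sample[OF \<tau> w]]) linarith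
        moreover have "1 \<le> \<bar>x $ i + t\<bar>"
          using abs_root_gt_one[OF b(1), of "x $ i + t" q] \<tau> by (auto simp: separated_def dest!: spec[of _ i])
        ultimately show "t \<in> (\<Union>e\<in>T. J e)" using J(2) by blast
      qed
      then have "emeasure lborel (A N) \<le> emeasure lborel (\<Union>e\<in>T. J e)"
        using J(1) T(1) by (intro emeasure_mono) auto
      also have "\<dots> \<le> (\<Sum>e\<in>T. emeasure lborel (J e))"
        using J(1) T(1) by (intro emeasure_subadditive_finite) auto
      also have "\<dots> \<le> (\<Sum>e\<in>T. ennreal (8 * r))" using J(3) by (intro sum_mono)
      also have "\<dots> = ennreal (8 * (real (card T) * r))"
        using T(2) by (simp add: ennreal_of_nat_eq_real_of_nat mult_ac flip: ennreal_mult)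
      also have "\<dots> \<le> ennreal (8 * C * (b1 powr (- 1 / 3)) ^ N)" using T(3) by (intro ennreal_leI) simp
      finally show ?thesis .
    qed
    define A' where "A' N = (if n0 \<le> N then A N else {})" for N
    have A': "emeasure lborel (A' N) \<le> ennreal (8 * \<bar>C\<bar> * (b1 powr (- 1 / 3)) ^ N)" for N
    proof (cases "n0 \<le> N")
      case True
      have "8 * C * (b1 powr (- 1 / 3)) ^ N \<le> 8 * \<bar>C\<bar> * (b1 powr (- 1 / 3)) ^ N"
        by (intro mult_right_mono) auto
      then show ?thesis using order_trans[OF small[OF True] ennreal_leI] True by (simp add: A'_def)
    qed (simp add: A'_def)
    have "limsup A' \<in> null_sets lborel"
    proof (rule borel_cantelli_limsup1)
      show "A' N \<in> sets lborel" for N using meas by (simp add: A'_def)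
      show "emeasure lborel (A' N) < \<infinity>" for N using A'[of N] by (rule le_less_trans) simp
      have "b1 powr (- 1 / 3) < 1" using b by (simp add: powr_less_one)
      then have "summable (\<lambda>N. 8 * \<bar>C\<bar> * (b1 powr (- 1 / 3)) ^ N)"
        by (intro summable_mult summable_geometric) simp
      then show "summable (\<lambda>N. measure lborel (A' N))"
      proof (rule summable_comparison_test')
        show "norm (measure lborel (A' N)) \<le> 8 * \<bar>C\<bar> * (b1 powr (- 1 / 3)) ^ N" for N
          unfolding measure_def using A'[of N] by (simp add: enn2real_leI)
      qed
    qed
    moreover have "{t. x + t *\<^sub>R axis i 1 \<in> limsup (exceptional_at b1 b2 c q \<gamma> \<kappa> i M)} \<subseteq> limsup A'"
    proof
      fix t assume "t \<in> {t. x + t *\<^sub>R axis i 1 \<in> limsup (exceptional_at b1 b2 c q \<gamma> \<kappa> i M)}"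
      then have *: "\<exists>N\<ge>n. t \<in> A N" for n by (auto simp: limsup_INF_SUP A_def)
      have "\<exists>N\<ge>n. t \<in> A' N" for n using *[of "max n n0"] by (auto simp: A'_def)
      then show "t \<in> limsup A'" by (auto simp: limsup_INF_SUP)
    qed
    moreover have "{t. x + t *\<^sub>R axis i 1 \<in> limsup (exceptional_at b1 b2 c q \<gamma> \<kappa> i M)} = limsup A"
      by (auto simp: limsup_INF_SUP A_def)
    moreover have "limsup A \<in> sets lborel" using meas by (simp add: limsup_INF_SUP)
    ultimately show ?thesis by (metis null_sets_subset)
  qed
  have "(exceptional b1 b2 c q \<gamma> \<kappa> :: (real ^ 'd) set) \<in> null_sets lborel" if "0 < c" "0 < q" for c q
    unfolding exceptional_def
  proof (intro null_sets_UN null_set_from_line_slices[OF _ slice[OF that]])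
    have "closed (exceptional_at b1 b2 c q \<gamma> \<kappa> i M N)" for i :: 'd and M N
      using b that by (intro compact_imp_closed compact_exceptional_at) auto
    then show "limsup (exceptional_at b1 b2 c q \<gamma> \<kappa> i M) \<in> sets borel" for i :: 'd and M
      by (auto simp: limsup_INF_SUP)
  qed
  then show thesis using that \<gamma>1 \<kappa> by blast
qed

section \<open>Power decay and the density\<close>

text \<open>
  Let \<open>N\<close> be the least number with \<open>\<bar>\<xi> s\<bar> \<le> \<bar>\<tau> s\<bar> ^ N\<close> for all \<open>s\<close>; then \<open>norm \<xi>\<close> is at most of order
  \<open>b2 ^ N\<close>. Minimality yields a coordinate \<open>i\<close> in which the rescaled vector \<open>\<xi> s / \<tau> s ^ (N - 1)\<close> is
  larger than \<open>1\<close>, while all its coordinates are at most \<open>b2\<close>. This choice of the scale, governed by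
  the slowest coordinate, is what keeps all weights \<open>w\<close> bounded. A digit difference that does not
  vanish at \<open>i\<close> makes \<open>w i\<close> bounded below. As \<open>\<theta>\<close> is not exceptional, more than \<open>\<kappa> N\<close> factors
  are at most \<open>\<beta>\<close>, and \<open>\<alpha>\<close> is defined by \<open>\<beta> powr \<kappa> = b2 powr - \<alpha>\<close>.
\<close>

lemma decay_along_power_subsequence:
  fixes \<theta> :: "real ^ 'd" and a :: "nat \<Rightarrow> real ^ 'd"
  assumes b: "1 < b1" "b1 \<le> b2" and \<epsilon>: "0 < \<epsilon>" and \<gamma>: "\<gamma> < 1" and \<kappa>: "0 < \<kappa>"
    and sep: "coord_power q \<theta> \<in> separated b1 b2 c" and nexc: "\<theta> \<notin> exceptional b1 b2 c q \<gamma> \<kappa>"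
    and irr: "affinely_irreducible \<theta> (a ` {1..m})" and p: "prob_vector m p" "\<And>j. j \<in> {1..m} \<Longrightarrow> \<epsilon> \<le> p j"
    and m: "2 \<le> m"
  defines "T \<equiv> (*v) (contraction_matrix \<theta>)"
  defines "\<beta> \<equiv> max (1 / 2) (1 - \<epsilon>\<^sup>2 * (1 - \<gamma>))"
  defines "\<alpha> \<equiv> - \<kappa> * ln \<beta> / ln b2"
  shows "\<exists>C\<ge>0. \<forall>\<xi>. \<exists>N. (\<Prod>n<N. norm (digit_sum m a p ((T ^^ (q * n)) \<xi>))) * (1 + norm \<xi>) powr \<alpha> \<le> C"
proof -
  define \<tau> where "\<tau> = coord_power q \<theta>"
  let ?d = "real CARD('d)"
  let ?\<phi> = "digit_sum m a p"
  have \<tau>: "b1 \<le> \<bar>\<tau> $ s\<bar>" "\<bar>\<tau> $ s\<bar> \<le> b2" for s using sep by (auto simp: separated_def \<tau>_def)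
  have \<tau>1: "1 \<le> \<bar>\<tau> $ s\<bar>" "\<tau> $ s \<noteq> 0" for s using \<tau>(1)[of s] b by auto
  have b2: "1 < b2" using b by simp
  have \<beta>: "0 < \<beta>" "\<beta> < 1" using \<epsilon> \<gamma> by (auto simp: \<beta>_def)
  have "ln \<beta> < 0" using \<beta> by simp
  then have \<alpha>: "0 \<le> \<alpha>" using b2 \<kappa> by (simp add: \<alpha>_def divide_nonpos_pos mult_nonneg_nonpos)
  have Tq: "(T ^^ (q * n)) \<xi> $ s = \<xi> $ s / \<tau> $ s ^ n" for n \<xi> s
    by (simp add: T_def contraction_matrix_funpow_nth \<tau>_def power_mult)
  have \<phi>1: "norm (?\<phi> \<xi>) \<le> 1" for \<xi> using norm_digit_sum_le_1[OF p(1)] .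
  obtain J where J: "\<And>i. J i \<in> {1..m}" "\<And>i. a (J i) $ i \<noteq> a 1 $ i"
    using irreducible_imp_coordinate_differs[OF irr] by metis
  define v where "v i = a (J i) - a 1" for i
  have vi: "v i $ i \<noteq> 0" for i using J(2)[of i] by (simp add: v_def)
  \<comment> \<open>one bound for the finitely many digit differences \<open>v i\<close>\<close>
  obtain M :: nat where M: "(\<Sum>i\<in>UNIV. \<Sum>s\<in>UNIV. \<bar>v i $ s\<bar> * b2) + (\<Sum>i\<in>UNIV. 1 / \<bar>v i $ i\<bar>) \<le> real M"
    using real_arch_simple by blast
  have M1: "\<bar>v i $ s\<bar> * b2 \<le> real M" for i s
  proof -
    have "\<bar>v i $ s\<bar> * b2 \<le> (\<Sum>s\<in>UNIV. \<bar>v i $ s\<bar> * b2)" using b2 by (intro member_le_sum) auto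
    also have "\<dots> \<le> (\<Sum>i\<in>UNIV. \<Sum>s\<in>UNIV. \<bar>v i $ s\<bar> * b2)"
      using b2 by (intro member_le_sum[of i UNIV "\<lambda>i. \<Sum>s\<in>UNIV. \<bar>v i $ s\<bar> * b2"]) (auto intro!: sum_nonneg)
    also have "\<dots> \<le> real M" using M sum_nonneg[of UNIV "\<lambda>i. 1 / \<bar>v i $ i\<bar>"] by force
    finally show ?thesis .
  qed
  have M2: "1 / real (Suc M) \<le> \<bar>v i $ i\<bar>" for i
  proof -
    have "1 / \<bar>v i $ i\<bar> \<le> (\<Sum>i\<in>UNIV. 1 / \<bar>v i $ i\<bar>)"
      by (intro member_le_sum[of i UNIV "\<lambda>i. 1 / \<bar>v i $ i\<bar>"]) auto
    moreover have "0 \<le> (\<Sum>i\<in>UNIV. \<Sum>s\<in>UNIV. \<bar>v i $ s\<bar> * b2)" using b2 by (intro sum_nonneg) auto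
    ultimately have "1 / \<bar>v i $ i\<bar> \<le> real (Suc M)" using M by simp
    then show ?thesis using vi[of i] by (simp add: field_simps)
  qed
  have "\<exists>N. \<forall>n\<ge>N. \<theta> \<notin> exceptional_at b1 b2 c q \<gamma> \<kappa> i M n" for i
    using nexc by (simp add: exceptional_def limsup_INF_SUP Ball_def)
  then obtain N1 where N1: "\<And>i n. N1 i \<le> n \<Longrightarrow> \<theta> \<notin> exceptional_at b1 b2 c q \<gamma> \<kappa> i M n" by metis
  define N0 where "N0 = Max (range N1)"
  have N0: "N1 i \<le> N0" for i by (simp add: N0_def)
  define C where "C = ((1 + ?d) * b2 ^ N0) powr \<alpha>"
  have norm_le: "1 + norm \<xi> \<le> (1 + ?d) * b2 ^ n" if "\<And>s. \<bar>\<xi> $ s\<bar> \<le> b2 ^ n" for \<xi> :: "real ^ 'd" and n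
  proof -
    have "norm \<xi> \<le> (\<Sum>s\<in>UNIV. \<bar>\<xi> $ s\<bar>)" by (rule norm_le_l1_cart)
    also have "\<dots> \<le> (\<Sum>s\<in>(UNIV :: 'd set). b2 ^ n)" by (intro sum_mono that)
    finally have "norm \<xi> \<le> ?d * b2 ^ n" by simp
    moreover have "1 \<le> b2 ^ n" using b2 by (simp add: one_le_power)
    ultimately show ?thesis by (simp add: distrib_right)
  qed
  have prod1: "(\<Prod>n\<in>A. norm (?\<phi> (h n))) \<le> 1" for A and h :: "nat \<Rightarrow> real ^ 'd"
    using \<phi>1 by (intro prod_le_1) auto
  have small: "(\<Prod>n<N. norm (?\<phi> (h n))) * (1 + norm \<xi>) powr \<alpha> \<le> C"
    if "\<And>s. \<bar>\<xi> $ s\<bar> \<le> b2 ^ n" "n \<le> N0" for \<xi> :: "real ^ 'd" and n N and h :: "nat \<Rightarrow> real ^ 'd"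
  proof -
    have "1 + norm \<xi> \<le> (1 + ?d) * b2 ^ n" by (rule norm_le[OF that(1)])
    also have "\<dots> \<le> (1 + ?d) * b2 ^ N0"
      using that(2) b2 by (intro mult_left_mono power_increasing) auto
    finally have "1 + norm \<xi> \<le> (1 + ?d) * b2 ^ N0" .
    then have "(1 + norm \<xi>) powr \<alpha> \<le> C" unfolding C_def using \<alpha> by (intro powr_mono2) auto
    moreover have "(\<Prod>n<N. norm (?\<phi> (h n))) * (1 + norm \<xi>) powr \<alpha> \<le> (1 + norm \<xi>) powr \<alpha>"
      using prod1 by (intro mult_left_le_one_le) (auto intro: prod_nonneg)
    ultimately show ?thesis by linarith
  qed
  have "\<exists>N. (\<Prod>n<N. norm (?\<phi> ((T ^^ (q * n)) \<xi>))) * (1 + norm \<xi>) powr \<alpha> \<le> C" for \<xi>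
  proof -
    let ?ok = "\<lambda>n. \<forall>s. \<bar>\<xi> $ s\<bar> \<le> \<bar>\<tau> $ s\<bar> ^ n"
    have "\<exists>n. ?ok n"
    proof -
      obtain n where n: "norm \<xi> < b1 ^ n" using real_arch_pow[OF b(1)] by blast
      have "\<bar>\<xi> $ s\<bar> \<le> \<bar>\<tau> $ s\<bar> ^ n" for s
        using component_le_norm_cart[of \<xi> s] n power_mono[OF \<tau>(1)[of s], of n] b by linarith
      then show ?thesis by blast
    qed
    define N where "N = (LEAST n. ?ok n)"
    have N: "?ok N" unfolding N_def using \<open>\<exists>n. ?ok n\<close> by (rule LeastI_ex)
    have Nb: "\<bar>\<xi> $ s\<bar> \<le> b2 ^ N" for s
      using N power_mono[OF \<tau>(2)[of s], of N] by (meson abs_ge_zero order_trans)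
    show ?thesis
    proof (cases "N \<le> N0")
      case True
      show ?thesis by (rule exI[of _ N], rule small[OF Nb True])
    next
      case False
      then obtain K where K: "N = Suc K" by (cases N) auto
      have "\<not> ?ok K" using not_less_Least[of K ?ok] K by (simp add: N_def)
      then obtain i where i: "\<bar>\<tau> $ i\<bar> ^ K < \<bar>\<xi> $ i\<bar>" by (auto simp: not_le)
      define w where "w = (\<chi> s. v i $ s * \<xi> $ s / \<tau> $ s ^ K)"
      have w1: "\<bar>w $ s\<bar> \<le> real M" for s
      proof -
        have "\<bar>\<xi> $ s\<bar> \<le> \<bar>\<tau> $ s\<bar> * \<bar>\<tau> $ s\<bar> ^ K" using N K by simp
        also have "\<dots> \<le> b2 * \<bar>\<tau> $ s\<bar> ^ K" using \<tau>(2) by (intro mult_right_mono) auto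
        finally have "\<bar>\<xi> $ s\<bar> / \<bar>\<tau> $ s\<bar> ^ K \<le> b2" using \<tau>1 by (simp add: divide_le_eq)
        then have "\<bar>v i $ s\<bar> * (\<bar>\<xi> $ s\<bar> / \<bar>\<tau> $ s\<bar> ^ K) \<le> \<bar>v i $ s\<bar> * b2" by (rule mult_left_mono) simp
        then show ?thesis using M1[of i s] by (simp add: w_def abs_mult power_abs)
      qed
      have w2: "1 / real (Suc M) \<le> \<bar>w $ i\<bar>"
      proof -
        have "1 \<le> \<bar>\<xi> $ i\<bar> / \<bar>\<tau> $ i\<bar> ^ K" using i \<tau>1[of i] by (simp add: le_divide_eq)
        then have "\<bar>v i $ i\<bar> * 1 \<le> \<bar>v i $ i\<bar> * (\<bar>\<xi> $ i\<bar> / \<bar>\<tau> $ i\<bar> ^ K)" by (rule mult_left_mono) simp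
        then show ?thesis using M2[of i] by (simp add: w_def abs_mult power_abs)
      qed
      have "\<theta> \<notin> exceptional_at b1 b2 c q \<gamma> \<kappa> i M N" using False N0[of i] by (intro N1) simp
      then have many: "\<kappa> * real N < real (card (off_phases \<gamma> w \<tau> N))"
        using sep w1 w2 unfolding exceptional_at_def \<tau>_def mem_Collect_eq not_le[symmetric] by blast
      have contr: "norm (?\<phi> ((T ^^ (q * (N - Suc n))) \<xi>)) \<le> \<beta>" if n: "n \<in> off_phases \<gamma> w \<tau> N" for n
      proof -
        have nN: "n \<le> K" using n K by (simp add: off_phases_def)
        have "phase w \<tau> n = v i \<bullet> (T ^^ (q * (K - n))) \<xi>"
          unfolding phase_def inner_vec_def
        proof (rule sum.cong[OF refl])
          fix s
          have "\<tau> $ s ^ K = \<tau> $ s ^ n * \<tau> $ s ^ (K - n)" using nN by (simp flip: power_add)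
          then show "w $ s * \<tau> $ s ^ n = v i $ s \<bullet> (T ^^ (q * (K - n))) \<xi> $ s"
            using \<tau>1(2)[of s] by (simp add: w_def Tq)
        qed
        then have "cos ((a (J i) - a 1) \<bullet> (T ^^ (q * (K - n))) \<xi>) \<le> \<gamma>"
          using n by (simp add: off_phases_def v_def)
        then have "norm (?\<phi> ((T ^^ (q * (K - n))) \<xi>)) \<le> 1 - \<epsilon>\<^sup>2 * (1 - \<gamma>)"
          using J[of i] m by (intro norm_digit_sum_le[OF p(1) \<epsilon> p(2)]) auto
        then show ?thesis by (simp add: \<beta>_def K)
      qed
      \<comment> \<open>read the factors backwards, so that they match the growing phases\<close>
      have "(\<Prod>n<N. norm (?\<phi> ((T ^^ (q * n)) \<xi>))) = (\<Prod>n<N. norm (?\<phi> ((T ^^ (q * (N - Suc n))) \<xi>)))"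
        by (rule prod.nat_diff_reindex[symmetric])
      also have "\<dots> \<le> (\<Prod>n<N. if n \<in> off_phases \<gamma> w \<tau> N then \<beta> else 1)"
        using contr \<phi>1 by (intro prod_mono) auto
      also have "\<dots> = \<beta> ^ card (off_phases \<gamma> w \<tau> N)"
        by (subst prod.If_cases) (auto simp: off_phases_def intro!: arg_cong[where f = card] arg_cong[where f = "(^) \<beta>"])
      also have "\<dots> \<le> \<beta> powr (\<kappa> * real N)"
        using many \<beta> powr_mono'[of "\<kappa> * real N" "real (card (off_phases \<gamma> w \<tau> N))" \<beta>]
        by (simp add: powr_realpow)
      finally have prod: "(\<Prod>n<N. norm (?\<phi> ((T ^^ (q * n)) \<xi>))) \<le> \<beta> powr (\<kappa> * real N)" .
      have "(1 + norm \<xi>) powr \<alpha> \<le> ((1 + ?d) * b2 ^ N) powr \<alpha>"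
        using norm_le[OF Nb] \<alpha> by (intro powr_mono2) auto
      also have "\<dots> = (1 + ?d) powr \<alpha> * b2 powr (real N * \<alpha>)"
        using b2 by (simp add: powr_mult powr_powr flip: powr_realpow)
      finally have nm: "(1 + norm \<xi>) powr \<alpha> \<le> (1 + ?d) powr \<alpha> * b2 powr (real N * \<alpha>)" .
      have "\<beta> powr (\<kappa> * real N) * b2 powr (real N * \<alpha>) = 1"
        using \<beta> b2 by (simp add: powr_def \<alpha>_def flip: exp_add)
      have "(\<Prod>n<N. norm (?\<phi> ((T ^^ (q * n)) \<xi>))) * (1 + norm \<xi>) powr \<alpha>
          \<le> \<beta> powr (\<kappa> * real N) * ((1 + ?d) powr \<alpha> * b2 powr (real N * \<alpha>))"
        using prod nm by (intro mult_mono) (auto intro: prod_nonneg)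
      also have "\<dots> = (1 + ?d) powr \<alpha> * (\<beta> powr (\<kappa> * real N) * b2 powr (real N * \<alpha>))" by simp
      also have "\<dots> = (1 + ?d) powr \<alpha>" unfolding \<open>\<beta> powr (\<kappa> * real N) * b2 powr (real N * \<alpha>) = 1\<close> by simp
      also have "\<dots> \<le> C"
        unfolding C_def using \<alpha> b2 by (intro powr_mono2) (auto simp: one_le_power mult_left_le[of _ "1 + ?d"])
      finally show ?thesis by blast
    qed
  qed
  moreover have "0 \<le> C" by (simp add: C_def)
  ultimately show ?thesis by blast
qed

lemma prod_residue_classes:
  fixes f :: "nat \<Rightarrow> 'a::comm_monoid_mult"
  shows "(\<Prod>n<L * q. f n) = (\<Prod>r<q. \<Prod>n<L. f (q * n + r))"
proof -
  have "(\<Prod>n<L * q. f n) = (\<Prod>n<L. prod f {n * q..<n * q + q})" by (rule prod.nat_group[symmetric])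
  also have "\<dots> = (\<Prod>n<L. \<Prod>r<q. f (q * n + r))"
  proof (rule prod.cong[OF refl])
    fix n
    show "prod f {n * q..<n * q + q} = (\<Prod>r<q. f (q * n + r))"
      using prod.shift_bounds_nat_ivl[of f 0 "n * q" q] by (simp add: atLeast0LessThan add.commute mult.commute)
  qed
  also have "\<dots> = (\<Prod>r<q. \<Prod>n<L. f (q * n + r))" by (rule prod.swap)
  finally show ?thesis .
qed

text \<open>
  The factors with \<open>n mod q = r\<close> form the product along the powers of \<open>A\<^sup>q\<close> that starts at \<open>A\<^sup>r \<xi>\<close>. For
  \<open>r < q\<close> this vector is shorter than \<open>\<xi>\<close> by a factor of at most \<open>b2\<close>, so each of the \<open>q\<close> residue
  classes contributes the full exponent \<open>\<alpha>\<close>.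
\<close>

lemma decay_of_fourier_product:
  fixes \<theta> :: "real ^ 'd" and a :: "nat \<Rightarrow> real ^ 'd"
  assumes b: "1 < b1" "b1 \<le> b2" and q: "0 < q" and \<alpha>: "0 \<le> \<alpha>"
    and sep: "coord_power q \<theta> \<in> separated b1 b2 c" and p: "prob_vector m p"
  defines "T \<equiv> (*v) (contraction_matrix \<theta>)"
  assumes C0: "0 \<le> C"
    and C: "\<And>\<xi>. \<exists>N. (\<Prod>n<N. norm (digit_sum m a p ((T ^^ (q * n)) \<xi>))) * (1 + norm \<xi>) powr \<alpha> \<le> C"
  shows "\<exists>L. (\<Prod>n<L. norm (digit_sum m a p ((T ^^ n) \<xi>))) * (1 + norm \<xi>) powr (real q * \<alpha>) \<le> (C * b2 powr \<alpha>) ^ q"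
proof -
  let ?\<phi> = "digit_sum m a p"
  have b2: "1 < b2" using b by simp
  have \<theta>q: "b1 \<le> \<bar>\<theta> $ s\<bar> ^ q" "\<bar>\<theta> $ s\<bar> ^ q \<le> b2" for s
    using sep by (auto simp: separated_def power_abs)
  have \<theta>1: "1 \<le> \<bar>\<theta> $ s\<bar>" for s
    using abs_root_gt_one[OF b(1), of "\<theta> $ s" q] \<theta>q(1)[of s] by (simp add: power_abs)
  have shrink: "(1 + norm \<xi>) / b2 \<le> 1 + norm ((T ^^ r) \<xi>)" if "r < q" for r
  proof -
    have "norm \<xi> \<le> norm (b2 *\<^sub>R (T ^^ r) \<xi>)"
    proof (rule norm_le_componentwise_cart)
      fix s
      have "\<bar>\<theta> $ s\<bar> ^ r \<le> b2"
        using power_increasing[of r q "\<bar>\<theta> $ s\<bar>"] that \<theta>1[of s] \<theta>q(2)[of s] by simp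
      then have "\<bar>\<xi> $ s\<bar> * \<bar>\<theta> $ s\<bar> ^ r \<le> \<bar>\<xi> $ s\<bar> * b2" by (rule mult_left_mono) simp
      then show "norm (\<xi> $ s) \<le> norm ((b2 *\<^sub>R (T ^^ r) \<xi>) $ s)"
        using \<theta>1[of s] b2 by (auto simp add: T_def contraction_matrix_funpow_nth abs_mult power_abs le_divide_eq mult.commute)
    qed
    then have "norm \<xi> \<le> b2 * norm ((T ^^ r) \<xi>)" using b2 by simp
    then show ?thesis using b2 by (simp add: divide_le_eq algebra_simps)
  qed
  define N where "N r = (SOME N. (\<Prod>n<N. norm (?\<phi> ((T ^^ (q * n)) ((T ^^ r) \<xi>)))) * (1 + norm ((T ^^ r) \<xi>)) powr \<alpha> \<le> C)" for r
  have N: "(\<Prod>n<N r. norm (?\<phi> ((T ^^ (q * n)) ((T ^^ r) \<xi>)))) * (1 + norm ((T ^^ r) \<xi>)) powr \<alpha> \<le> C" for r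
    unfolding N_def by (rule someI_ex[OF C])
  define L where "L = (\<Sum>r<q. N r)"
  have NL: "N r \<le> L" if "r < q" for r unfolding L_def using that by (intro member_le_sum) auto
  have \<phi>1: "norm (?\<phi> \<xi>) \<le> 1" for \<xi> using norm_digit_sum_le_1[OF p] .
  have each: "(\<Prod>n<L. norm (?\<phi> ((T ^^ (q * n + r)) \<xi>))) * (1 + norm \<xi>) powr \<alpha> \<le> C * b2 powr \<alpha>" if r: "r < q" for r
  proof -
    have "(\<Prod>n<L. norm (?\<phi> ((T ^^ (q * n + r)) \<xi>))) \<le> (\<Prod>n<N r. norm (?\<phi> ((T ^^ (q * n)) ((T ^^ r) \<xi>))))"
    proof -
      have "(\<Prod>n<L. norm (?\<phi> ((T ^^ (q * n + r)) \<xi>))) = (\<Prod>n\<in>{..<N r} \<union> {N r..<L}. norm (?\<phi> ((T ^^ (q * n + r)) \<xi>)))"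
        using NL[OF r] by (simp add: ivl_disj_un)
      also have "\<dots> = (\<Prod>n<N r. norm (?\<phi> ((T ^^ (q * n + r)) \<xi>))) * (\<Prod>n\<in>{N r..<L}. norm (?\<phi> ((T ^^ (q * n + r)) \<xi>)))"
        by (rule prod.union_disjoint) auto
      also have "\<dots> \<le> (\<Prod>n<N r. norm (?\<phi> ((T ^^ (q * n + r)) \<xi>)))"
        using \<phi>1 by (intro mult_left_le) (auto intro!: prod_le_1 prod_nonneg)
      finally show ?thesis by (simp add: funpow_add)
    qed
    moreover have "(1 + norm \<xi>) powr \<alpha> \<le> (1 + norm ((T ^^ r) \<xi>)) powr \<alpha> * b2 powr \<alpha>"
    proof -
      have "1 + norm \<xi> \<le> (1 + norm ((T ^^ r) \<xi>)) * b2" using shrink[OF r] b2 by (simp add: divide_le_eq)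
      then have "(1 + norm \<xi>) powr \<alpha> \<le> ((1 + norm ((T ^^ r) \<xi>)) * b2) powr \<alpha>" using \<alpha> by (intro powr_mono2) auto
      then show ?thesis using b2 by (simp add: powr_mult add_nonneg_nonneg)
    qed
    ultimately have "(\<Prod>n<L. norm (?\<phi> ((T ^^ (q * n + r)) \<xi>))) * (1 + norm \<xi>) powr \<alpha>
        \<le> (\<Prod>n<N r. norm (?\<phi> ((T ^^ (q * n)) ((T ^^ r) \<xi>)))) * ((1 + norm ((T ^^ r) \<xi>)) powr \<alpha> * b2 powr \<alpha>)"
      by (intro mult_mono) (auto intro: prod_nonneg)
    also have "\<dots> \<le> C * b2 powr \<alpha>"
      using mult_right_mono[OF N[of r], of "b2 powr \<alpha>"] by (simp add: mult.assoc)
    finally show ?thesis .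
  qed
  have "(\<Prod>n<L * q. norm (?\<phi> ((T ^^ n) \<xi>))) * (1 + norm \<xi>) powr (real q * \<alpha>)
      = (\<Prod>r<q. (\<Prod>n<L. norm (?\<phi> ((T ^^ (q * n + r)) \<xi>))) * (1 + norm \<xi>) powr \<alpha>)"
  proof -
    have "0 < 1 + norm \<xi>" by (simp add: add_pos_nonneg)
    then have "(1 + norm \<xi>) powr (real q * \<alpha>) = ((1 + norm \<xi>) powr \<alpha>) ^ q"
      by (simp add: powr_powr mult.commute flip: powr_realpow)
    then show ?thesis by (simp add: prod_residue_classes prod.distrib)
  qed
  also have "\<dots> \<le> (\<Prod>r<q. C * b2 powr \<alpha>)"
    using each by (intro prod_mono) (auto intro!: mult_nonneg_nonneg prod_nonneg)
  finally show ?thesis by auto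
qed

theorem corollary1p4:
  fixes b\<^sub>1 b\<^sub>2 c\<^sub>1 \<epsilon> :: real
  assumes "1 < b\<^sub>1" and "b\<^sub>1 < b\<^sub>2" and "c\<^sub>1 > 0" and "\<epsilon> > 0"
  shows "\<exists>(n :: nat \<Rightarrow> nat) (E :: nat \<Rightarrow> (real ^ 'd) set).
    (\<forall>k. n k > 0) \<and> filterlim n at_top sequentially \<and>
    (\<forall>k. E k \<in> null_sets lebesgue) \<and>
    (\<forall>k. \<forall>\<theta> :: real ^ 'd.
       \<theta> \<notin> E k \<longrightarrow>
       b\<^sub>1 \<le> Min (range (\<lambda>j. \<bar>\<theta> $ j ^ n k\<bar>)) \<longrightarrow>
       Min (range (\<lambda>j. \<bar>\<theta> $ j ^ n k\<bar>)) < Max (range (\<lambda>j. \<bar>\<theta> $ j ^ n k\<bar>)) \<longrightarrow>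
       Max (range (\<lambda>j. \<bar>\<theta> $ j ^ n k\<bar>)) \<le> b\<^sub>2 \<longrightarrow>
       (\<forall>i j. i \<noteq> j \<longrightarrow> \<bar>\<theta> $ i ^ n k - \<theta> $ j ^ n k\<bar> \<ge> c\<^sub>1) \<longrightarrow>
       (\<forall>(m :: nat) (a :: nat \<Rightarrow> real ^ 'd).
          m \<ge> 2 \<longrightarrow> inj_on a {1..m} \<longrightarrow> affinely_irreducible \<theta> (a ` {1..m}) \<longrightarrow>
          (\<forall>p. prob_vector m p \<longrightarrow> Min (p ` {1..m}) \<ge> \<epsilon> \<longrightarrow>
             abs_cont_with_C_k_density k (self_affine_measure \<theta> m a p))))"
proof -
  have b: "1 < b\<^sub>1" "b\<^sub>1 \<le> b\<^sub>2" using assms by auto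
  obtain \<gamma> \<kappa> :: real where \<gamma>: "\<gamma> < 1" and \<kappa>: "0 < \<kappa>"
    and null: "\<And>c q. 0 < c \<Longrightarrow> 0 < q \<Longrightarrow> (exceptional b\<^sub>1 b\<^sub>2 c q \<gamma> \<kappa> :: (real ^ 'd) set) \<in> null_sets lborel"
    using exceptional_null[OF b] by metis
  define \<beta> where "\<beta> = max (1 / 2) (1 - \<epsilon>\<^sup>2 * (1 - \<gamma>))"
  define \<alpha> where "\<alpha> = - \<kappa> * ln \<beta> / ln b\<^sub>2"
  have "0 < \<beta>" "\<beta> < 1" using assms \<gamma> by (auto simp: \<beta>_def)
  then have "ln \<beta> < 0" by simp
  then have \<alpha>: "0 < \<alpha>" using b \<kappa> by (simp add: \<alpha>_def divide_neg_pos mult_pos_neg)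
  \<comment> \<open>\<open>n k \<ge> s k\<close> gives enough decay for class \<open>C\<^sup>k\<close>, and \<open>n k \<ge> k\<close> gives \<open>n k \<rightarrow> \<infinity>\<close>\<close>
  define s where "s k = real (k + 2 * CARD('d)) / \<alpha>" for k
  define n where "n k = k + nat \<lceil>s k\<rceil> + 1" for k
  have n: "0 < n k" "real (k + 2 * CARD('d)) \<le> real (n k) * \<alpha>" for k
  proof -
    have "s k \<le> real (n k)" unfolding n_def by linarith
    then show "real (k + 2 * CARD('d)) \<le> real (n k) * \<alpha>" using \<alpha> by (simp add: s_def divide_le_eq)
  qed (simp add: n_def)
  have lim: "filterlim n at_top sequentially"
    by (rule filterlim_at_top_mono[OF filterlim_ident]) (simp add: n_def)
  have smooth: "abs_cont_with_C_k_density k (self_affine_measure \<theta> m a p)"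
    if \<theta>: "\<theta> \<notin> exceptional b\<^sub>1 b\<^sub>2 c\<^sub>1 (n k) \<gamma> \<kappa>" and sep: "coord_power (n k) \<theta> \<in> separated b\<^sub>1 b\<^sub>2 c\<^sub>1"
      and m: "2 \<le> m" and irr: "affinely_irreducible \<theta> (a ` {1..m})"
      and p: "prob_vector m p" "\<And>j. j \<in> {1..m} \<Longrightarrow> \<epsilon> \<le> p j"
    for k m p and \<theta> :: "real ^ 'd" and a :: "nat \<Rightarrow> real ^ 'd"
  proof -
    have \<theta>1: "1 < \<bar>\<theta> $ i\<bar>" for i
      using sep by (intro abs_root_gt_one[OF b(1), of "\<theta> $ i" "n k"]) (simp add: separated_def)
    from decay_along_power_subsequence[OF b assms(4) \<gamma> \<kappa> sep \<theta> irr p m] obtain C where C0: "0 \<le> C"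
      and C: "\<And>\<xi>. \<exists>N. (\<Prod>l<N. norm (digit_sum m a p ((((*v) (contraction_matrix \<theta>)) ^^ (n k * l)) \<xi>)))
        * (1 + norm \<xi>) powr \<alpha> \<le> C"
      unfolding \<alpha>_def \<beta>_def by blast
    show ?thesis
    proof (rule self_affine_measure_C_k_density[OF \<theta>1 p(1)])
      fix \<xi> :: "real ^ 'd"
      obtain L where L: "(\<Prod>l<L. norm (digit_sum m a p ((((*v) (contraction_matrix \<theta>)) ^^ l) \<xi>)))
          * (1 + norm \<xi>) powr (real (n k) * \<alpha>) \<le> (C * b\<^sub>2 powr \<alpha>) ^ n k"
        using decay_of_fourier_product[OF b n(1) less_imp_le[OF \<alpha>] sep p(1) C0 C] by blast
      have "(1 + norm \<xi>) ^ (k + 2 * CARD('d)) = (1 + norm \<xi>) powr real (k + 2 * CARD('d))"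
        by (rule powr_realpow[symmetric]) (simp add: add_pos_nonneg)
      also have "\<dots> \<le> (1 + norm \<xi>) powr (real (n k) * \<alpha>)" using n(2) by (intro powr_mono) auto
      finally have "(\<Prod>l<L. norm (digit_sum m a p ((((*v) (contraction_matrix \<theta>)) ^^ l) \<xi>))) * (1 + norm \<xi>) ^ (k + 2 * CARD('d))
          \<le> (\<Prod>l<L. norm (digit_sum m a p ((((*v) (contraction_matrix \<theta>)) ^^ l) \<xi>))) * (1 + norm \<xi>) powr (real (n k) * \<alpha>)"
        by (rule mult_left_mono) (simp add: prod_nonneg)
      then show "\<exists>L. (\<Prod>l<L. norm (digit_sum m a p ((((*v) (contraction_matrix \<theta>)) ^^ l) \<xi>)))
          * (1 + norm \<xi>) ^ (k + 2 * CARD('d)) \<le> (C * b\<^sub>2 powr \<alpha>) ^ n k"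
        using L order_trans by blast
    qed
  qed
  show ?thesis
  proof (rule exI[of _ n], rule exI[of _ "\<lambda>k. exceptional b\<^sub>1 b\<^sub>2 c\<^sub>1 (n k) \<gamma> \<kappa>"], intro conjI allI impI)
    show "0 < n k" for k by (rule n)
    show "filterlim n at_top sequentially" by (rule lim)
    show "exceptional b\<^sub>1 b\<^sub>2 c\<^sub>1 (n k) \<gamma> \<kappa> \<in> null_sets (lebesgue :: (real ^ 'd) measure)" for k
      using null[OF assms(3) n(1)] by (rule null_sets_completionI)
    fix k m p and \<theta> :: "real ^ 'd" and a :: "nat \<Rightarrow> real ^ 'd"
    assume \<theta>: "\<theta> \<notin> exceptional b\<^sub>1 b\<^sub>2 c\<^sub>1 (n k) \<gamma> \<kappa>"
      and Min: "b\<^sub>1 \<le> Min (range (\<lambda>j. \<bar>\<theta> $ j ^ n k\<bar>))" and Max: "Max (range (\<lambda>j. \<bar>\<theta> $ j ^ n k\<bar>)) \<le> b\<^sub>2"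
      and sep: "\<forall>i j. i \<noteq> j \<longrightarrow> c\<^sub>1 \<le> \<bar>\<theta> $ i ^ n k - \<theta> $ j ^ n k\<bar>"
      and m: "2 \<le> m" and irr: "affinely_irreducible \<theta> (a ` {1..m})"
      and p: "prob_vector m p" and pmin: "\<epsilon> \<le> Min (p ` {1..m})"
    have "coord_power (n k) \<theta> \<in> separated b\<^sub>1 b\<^sub>2 c\<^sub>1"
      using Min Max sep by (simp add: separated_def)
    moreover have "\<epsilon> \<le> p j" if "j \<in> {1..m}" for j
      using pmin that by (meson Min_le finite_atLeastAtMost finite_imageI imageI order_trans)
    ultimately show "abs_cont_with_C_k_density k (self_affine_measure \<theta> m a p)"
      using smooth[OF \<theta> _ m irr p] by blast
  qed
qed

end
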